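(* Let $(\Gamma,G,\alpha,\beta)$ be a matched pair of a discrete group $\Gamma$ and a compact group $G$, and let $\mathbb{G}=\mathbb{G}(\Gamma,G,\alpha,\beta)$ be the associated bicrossed product compact quantum group. The following conditions are equivalent: (1) $\mathcal{A}(\mathbb{G})$ is RFD; (2) the action $\alpha$ has enough finite orbits and the group algebra $\mathbb{C}\Gamma$ is RFD.
   Context: Matched pair: $\Gamma$ is a discrete group and $G$ a compact group, realized as closed subgroups of a locally compact group $H$ with $\Gamma\cap G=\{e\}$ and such that the product $\Gamma G$ has full Haar measure in $H$. Equivalently, one has a left action $\alpha$ of $\Gamma$ on the space $G$ by homeomorphisms and a (continuous) right action $\beta$ of $G$ on the set $\Gamma$, determined by $\gamma g=\alpha_\gamma(g)\beta_g(\gamma)$ in $H$ ($\gamma\in\Gamma$, $g\in G$), satisfying $\alpha_\gamma(gh)=\alpha_\gamma(g)\alpha_{\beta_g(\gamma)}(h)$, $\beta_g(\gamma\mu)=\beta_{\alpha_\mu(g)}(\gamma)\beta_g(\mu)$, $\alpha_\gamma(e)=e$, $\beta_g(e)=e$. Bicrossed product: $\mathbb{G}=\mathbb{G}(\Gamma,G,\alpha,\beta)$ is the compact quantum group whose universal $C^*$-algebra is the full crossed product $C(G)\rtimes_\alpha\Gamma$, generated by $C(G)$ and unitaries $u_\gamma$, $\gamma\in\Gamma$, with $u_\gamma f u_\gamma^*=f\circ\alpha_{\gamma^{-1}}$, with coproduct extending that of $C(G)$ and with $\Delta(u_\gamma)=\sum_{r\in\beta_G(\gamma)}u_\gamma 1_{\{g:\beta_g(\gamma)=r\}}\otimes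 u_r$ (a finite sum). As a $*$-algebra, its CQG algebra (the Hopf $*$-algebra spanned by coefficients of finite-dimensional unitary representations of $\mathbb{G}$) is the algebraic crossed product $\mathcal{A}(\mathbb{G})=\mathcal{A}(G)\rtimes\Gamma$ for the action induced by $\alpha$, where $\mathcal{A}(G)$ is the algebra of representative functions on $G$. RFD: a $*$-algebra $\mathcal{A}$ is RFD if for every $0\neq a\in\mathcal{A}$ there is a $*$-representation $\pi$ of $\mathcal{A}$ on a finite-dimensional Hilbert space with $\pi(a)\neq 0$. $\mathbb{C}\Gamma$ is the group $*$-algebra with $\gamma^*=\gamma^{-1}$. Enough finite orbits: an action of a discrete group on a compact Hausdorff space $X$ has enough finite orbits if the points of $X$ with finite orbit form a dense subset of $X$. *)

theory Defs
  imports
    "HOL-Analysis.Analysis"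
    "HOL-Algebra.Module"
    "HOL-Library.Function_Algebras"
    "HOL-Library.Poly_Mapping"
    "Jordan_Normal_Form.Schur_Decomposition"
begin

section \<open>Residually finite-dimensional *-algebras\<close>

record 'a star_algebra = "(complex, 'a) module" +
  star :: "'a \<Rightarrow> 'a"

text \<open>
  A finite-dimensional Hilbert space is unitarily equivalent to some $\mathbb{C}^n$, so
  *-representations are taken in matrix algebras. They are not required to be unital;
  compressing to the range of $\pi(1)$ shows that this makes no difference for \<open>RFD\<close>.
\<close>

definition star_rep :: "('a, 'm) star_algebra_scheme \<Rightarrow> nat \<Rightarrow> ('a \<Rightarrow> complex mat) \<Rightarrow> bool" where
  "star_rep A n \<pi> \<longleftrightarrow>
     (\<forall>a\<in>carrier A. \<pi> a \<in> carrier_mat n n) \<and>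
     (\<forall>a\<in>carrier A. \<forall>b\<in>carrier A. \<pi> (a \<oplus>\<^bsub>A\<^esub> b) = \<pi> a + \<pi> b) \<and>
     (\<forall>c. \<forall>a\<in>carrier A. \<pi> (c \<odot>\<^bsub>A\<^esub> a) = c \<cdot>\<^sub>m \<pi> a) \<and>
     (\<forall>a\<in>carrier A. \<forall>b\<in>carrier A. \<pi> (a \<otimes>\<^bsub>A\<^esub> b) = \<pi> a * \<pi> b) \<and>
     (\<forall>a\<in>carrier A. \<pi> (star A a) = mat_adjoint (\<pi> a))"

definition RFD :: "('a, 'm) star_algebra_scheme \<Rightarrow> bool" where
  "RFD A \<longleftrightarrow> (\<forall>a\<in>carrier A. a \<noteq> \<zero>\<^bsub>A\<^esub> \<longrightarrow> (\<exists>n \<pi>. star_rep A n \<pi> \<and> \<pi> a \<noteq> 0\<^sub>m n n))"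

text \<open>
  Groups are types of class \<open>group_add\<close>, written additively although not assumed commutative.
  The convolution product of the group algebra is the multiplication of \<open>\<Rightarrow>\<^sub>0\<close>.
\<close>

definition group_algebra :: "('g::group_add \<Rightarrow>\<^sub>0 complex) star_algebra" where
  "group_algebra =
     \<lparr>carrier = UNIV, mult = (*), one = 1, zero = 0, add = (+),
      smult = (\<lambda>c. Poly_Mapping.map ((*) c)),
      star = (\<lambda>a. Poly_Mapping.map cnj (Poly_Mapping.map_key uminus a))\<rparr>"

lemma lookup_star_group_algebra:
  "poly_mapping.lookup (star group_algebra a) \<gamma> = cnj (poly_mapping.lookup a (- \<gamma>))"
  by (simp add: group_algebra_def Poly_Mapping.map.rep_eq Poly_Mapping.map_key.rep_eq when_def)


section \<open>Matched pairs\<close>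

definition enough_finite_orbits :: "('g \<Rightarrow> 'x::topological_space \<Rightarrow> 'x) \<Rightarrow> bool" where
  "enough_finite_orbits \<alpha> \<longleftrightarrow> closure {x. finite (range (\<lambda>\<gamma>. \<alpha> \<gamma> x))} = UNIV"

text \<open>
  The discrete group \<open>'g\<close> carries no topology, so continuity of \<open>\<beta>\<close> is expressed by openness of
  the sets in \<open>open_fibre\<close>. Each \<open>\<alpha> \<gamma>\<close> is a homeomorphism with inverse \<open>\<alpha> (- \<gamma>)\<close>.
\<close>

locale matched_pair =
  fixes \<alpha> :: "'g::group_add \<Rightarrow> 'h::{topological_group_add, t2_space} \<Rightarrow> 'h"
    and \<beta> :: "'h \<Rightarrow> 'g \<Rightarrow> 'g"
  assumes compact_group: "compact (UNIV :: 'h set)"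
    and \<alpha>_zero: "\<alpha> 0 g = g"
    and \<alpha>_add: "\<alpha> (\<gamma> + \<mu>) g = \<alpha> \<gamma> (\<alpha> \<mu> g)"
    and \<alpha>_continuous: "continuous_on UNIV (\<alpha> \<gamma>)"
    and \<beta>_zero: "\<beta> 0 \<gamma> = \<gamma>"
    and \<beta>_add: "\<beta> (g + h) \<gamma> = \<beta> h (\<beta> g \<gamma>)"
    and open_fibre: "open {g. \<beta> g \<gamma> = \<mu>}"
    and \<alpha>_matched: "\<alpha> \<gamma> (g + h) = \<alpha> \<gamma> g + \<alpha> (\<beta> g \<gamma>) h"
    and \<beta>_matched: "\<beta> g (\<gamma> + \<mu>) = \<beta> (\<alpha> \<mu> g) \<gamma> + \<beta> g \<mu>"
    and \<alpha>_unit: "\<alpha> \<gamma> 0 = 0"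
    and \<beta>_unit: "\<beta> g 0 = 0"


section \<open>The bicrossed product\<close>

text \<open>
  A function $a$ stands for the finite sum $\sum_\gamma u_\gamma a_\gamma$ with $a_\gamma \in C(G)$;
  these sums form the canonical dense *-subalgebra of the full crossed product. The operations come
  from $f u_\gamma = u_\gamma (f \circ \alpha_\gamma)$.
\<close>

definition crossed_product_core :: "('g \<Rightarrow> 'h::topological_space \<Rightarrow> complex) set" where
  "crossed_product_core = {a. finite {\<gamma>. a \<gamma> \<noteq> 0} \<and> (\<forall>\<gamma>. continuous_on UNIV (a \<gamma>))}"

definition cp_one :: "'g::group_add \<Rightarrow> 'h \<Rightarrow> complex" where
  "cp_one \<gamma> = (if \<gamma> = 0 then 1 else 0)"

definition cp_mult ::
    "('g::group_add \<Rightarrow> 'h \<Rightarrow> 'h) \<Rightarrow> ('g \<Rightarrow> 'h \<Rightarrow> complex) \<Rightarrow> ('g \<Rightarrow> 'h \<Rightarrow> complex) \<Rightarrow> 'g \<Rightarrow> 'h \<Rightarrow> complex"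
  where "cp_mult \<alpha> a b \<nu> g = (\<Sum>\<mu> | b \<mu> \<noteq> 0. a (\<nu> - \<mu>) (\<alpha> \<mu> g) * b \<mu> g)"

definition cp_star ::
    "('g::group_add \<Rightarrow> 'h \<Rightarrow> 'h) \<Rightarrow> ('g \<Rightarrow> 'h \<Rightarrow> complex) \<Rightarrow> 'g \<Rightarrow> 'h \<Rightarrow> complex"
  where "cp_star \<alpha> a \<gamma> g = cnj (a (- \<gamma>) (\<alpha> \<gamma> g))"

text \<open>
  The elementary tensor $a \otimes b$ is identified with
  $(\gamma, r, g, h) \mapsto a_\gamma(g)\, b_r(h)$. In this picture
  $\Delta(u_\gamma f) = \sum_r (u_\gamma 1_{\{g : \beta_g(\gamma) = r\}} \otimes u_r)\,\Delta(f)$,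
  with $\Delta(f)(g,h) = f(gh)$, reads as follows.
\<close>

definition comult ::
    "('h::plus \<Rightarrow> 'g \<Rightarrow> 'g) \<Rightarrow> ('g \<Rightarrow> 'h \<Rightarrow> complex) \<Rightarrow> 'g \<Rightarrow> 'g \<Rightarrow> 'h \<Rightarrow> 'h \<Rightarrow> complex"
  where "comult \<beta> a \<gamma> r g h = (if \<beta> g \<gamma> = r then a \<gamma> (g + h) else 0)"

text \<open>
  An $n$-dimensional unitary representation of the bicrossed product: a unitary matrix $U$ with
  $\Delta(U_{ij}) = \sum_k U_{ik} \otimes U_{kj}$. Coefficients of finite-dimensional unitary
  representations lie in $\mathcal{A}(G) \rtimes \Gamma$, so no representation is lost by taking
  the entries in the dense subalgebra instead of its C*-completion.
\<close>

definition bicrossed_unitary_rep ::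
    "('g::group_add \<Rightarrow> 'h::topological_group_add \<Rightarrow> 'h) \<Rightarrow> ('h \<Rightarrow> 'g \<Rightarrow> 'g) \<Rightarrow>
      nat \<Rightarrow> (nat \<Rightarrow> nat \<Rightarrow> 'g \<Rightarrow> 'h \<Rightarrow> complex) \<Rightarrow> bool" where
  "bicrossed_unitary_rep \<alpha> \<beta> n U \<longleftrightarrow>
     (\<forall>i<n. \<forall>j<n.
        U i j \<in> crossed_product_core \<and>
        comult \<beta> (U i j) = (\<lambda>\<gamma> r g h. \<Sum>k<n. U i k \<gamma> g * U k j r h) \<and>
        (\<Sum>k<n. cp_mult \<alpha> (U i k) (cp_star \<alpha> (U j k))) = (if i = j then cp_one else 0) \<and>
        (\<Sum>k<n. cp_mult \<alpha> (cp_star \<alpha> (U k i)) (U k j)) = (if i = j then cp_one else 0))"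

definition bicrossed_cqg_algebra ::
    "('g::group_add \<Rightarrow> 'h::topological_group_add \<Rightarrow> 'h) \<Rightarrow> ('h \<Rightarrow> 'g \<Rightarrow> 'g) \<Rightarrow>
      ('g \<Rightarrow> 'h \<Rightarrow> complex) star_algebra" where
  "bicrossed_cqg_algebra \<alpha> \<beta> =
     \<lparr>carrier = Modules.module.span (\<lambda>c a \<gamma> g. c * a \<gamma> g)
        {U i j | U n i j. bicrossed_unitary_rep \<alpha> \<beta> n U \<and> i < n \<and> j < n},
      mult = cp_mult \<alpha>, one = cp_one, zero = 0, add = (+),
      smult = (\<lambda>c a \<gamma> g. c * a \<gamma> g),
      star = cp_star \<alpha>\<rparr>"


section \<open>Identification with the algebraic crossed product\<close>

text \<open>
  The definitions below only serve to show that the carrier of \<open>bicrossed_cqg_algebra\<close> is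
  $\mathcal{A}(G) \rtimes \Gamma$. Finite-dimensional continuous representations of a compact group
  are unitarizable, so restricting to unitary ones yields all representative functions.
\<close>

definition group_unitary_rep :: "nat \<Rightarrow> (nat \<Rightarrow> nat \<Rightarrow> 'h::topological_group_add \<Rightarrow> complex) \<Rightarrow> bool" where
  "group_unitary_rep n u \<longleftrightarrow>
     (\<forall>i<n. \<forall>j<n.
        continuous_on UNIV (u i j) \<and>
        (\<forall>g h. u i j (g + h) = (\<Sum>k<n. u i k g * u k j h)) \<and>
        (\<forall>g. (\<Sum>k<n. u i k g * cnj (u j k g)) = (if i = j then 1 else 0)) \<and>
        (\<forall>g. (\<Sum>k<n. cnj (u k i g) * u k j g) = (if i = j then 1 else 0)))"

definition representative_functions :: "('h::topological_group_add \<Rightarrow> complex) set" where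
  "representative_functions =
     Modules.module.span (\<lambda>c f g. c * f g) {u i j | u n i j. group_unitary_rep n u \<and> i < n \<and> j < n}"

definition algebraic_crossed_product :: "('g \<Rightarrow> 'h::topological_group_add \<Rightarrow> complex) set" where
  "algebraic_crossed_product =
     {a. finite {\<gamma>. a \<gamma> \<noteq> 0} \<and> (\<forall>\<gamma>. a \<gamma> \<in> representative_functions)}"

lemma function_module1: "Modules.module (\<lambda>c (f :: 'x \<Rightarrow> complex) x. c * f x)"
  by unfold_locales (auto simp: fun_eq_iff algebra_simps)

lemma function_module2: "Modules.module (\<lambda>c (f :: 'x \<Rightarrow> 'y \<Rightarrow> complex) x y. c * f x y)"
  by unfold_locales (auto simp: fun_eq_iff algebra_simps)

lemma sum_fun_apply: "sum f A x = (\<Sum>a\<in>A. f a x)"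
  by (induction A rule: infinite_finite_induct) auto

context matched_pair
begin

lemma \<beta>_inj: "\<beta> g \<gamma> = \<beta> g \<mu> \<longleftrightarrow> \<gamma> = \<mu>"
  by (metis \<beta>_add \<beta>_zero add.right_inverse)

lemma \<beta>_cancel: "\<beta> g (\<beta> (- g) \<gamma>) = \<gamma>" "\<beta> (- g) (\<beta> g \<gamma>) = \<gamma>"
  by (simp_all flip: \<beta>_add add: \<beta>_zero)

lemma \<alpha>_cancel: "\<alpha> \<gamma> (\<alpha> (- \<gamma>) g) = g" "\<alpha> (- \<gamma>) (\<alpha> \<gamma> g) = g"
  by (simp_all flip: \<alpha>_add add: \<alpha>_zero)

lemma finite_\<beta>_orbit: "finite (range (\<lambda>g. \<beta> g \<gamma>))"
proof -
  define F where "F = range (\<lambda>\<mu>. {g. \<beta> g \<gamma> = \<mu>})"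
  have "\<forall>t\<in>F. open t" "UNIV \<subseteq> \<Union>F"
    by (auto simp: F_def open_fibre)
  then obtain D where D: "D \<subseteq> F" "finite D" "UNIV \<subseteq> \<Union>D"
    using compact_group unfolding compact_eq_Heine_Borel by meson
  note D = D[unfolded F_def]
  obtain M where M: "finite M" "D = (\<lambda>\<mu>. {g. \<beta> g \<gamma> = \<mu>}) ` M"
    using finite_subset_image[OF D(2,1)] by blast
  have "range (\<lambda>g. \<beta> g \<gamma>) \<subseteq> M"
    using D(3) M(2) by blast
  then show ?thesis
    using M(1) finite_subset by blast
qed

lemma cp_mult_star_apply:
  assumes "finite T" "{\<gamma>. b \<gamma> \<noteq> 0} \<subseteq> T"
  shows "cp_mult \<alpha> a (cp_star \<alpha> b) \<nu> g =
    (\<Sum>\<mu>\<in>T. a (\<nu> + \<mu>) (\<alpha> (- \<mu>) g) * cnj (b \<mu> (\<alpha> (- \<mu>) g)))"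
proof -
  have "{\<mu>. cp_star \<alpha> b \<mu> \<noteq> 0} \<subseteq> uminus ` T"
  proof
    fix \<mu> assume "\<mu> \<in> {\<mu>. cp_star \<alpha> b \<mu> \<noteq> 0}"
    then have "b (- \<mu>) \<noteq> 0"
      by (auto simp: cp_star_def fun_eq_iff)
    then have "- \<mu> \<in> T" using assms(2) by auto
    then show "\<mu> \<in> uminus ` T" by (metis image_eqI minus_minus)
  qed
  then have "cp_mult \<alpha> a (cp_star \<alpha> b) \<nu> g =
      (\<Sum>\<mu>\<in>uminus ` T. a (\<nu> - \<mu>) (\<alpha> \<mu> g) * cp_star \<alpha> b \<mu> g)"
    unfolding cp_mult_def using assms(1) by (intro sum.mono_neutral_left) auto
  also have "\<dots> = (\<Sum>\<mu>\<in>T. a (\<nu> + \<mu>) (\<alpha> (- \<mu>) g) * cnj (b \<mu> (\<alpha> (- \<mu>) g)))"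
    by (subst sum.reindex) (auto simp: cp_star_def inj_on_def)
  finally show ?thesis .
qed

lemma cp_star_mult_apply:
  assumes "finite T" "{\<gamma>. b \<gamma> \<noteq> 0} \<subseteq> T"
  shows "cp_mult \<alpha> (cp_star \<alpha> a) b \<nu> g = (\<Sum>\<mu>\<in>T. cnj (a (\<mu> - \<nu>) (\<alpha> \<nu> g)) * b \<mu> g)"
proof -
  have "cp_mult \<alpha> (cp_star \<alpha> a) b \<nu> g =
      (\<Sum>\<mu>\<in>T. cp_star \<alpha> a (\<nu> - \<mu>) (\<alpha> \<mu> g) * b \<mu> g)"
    unfolding cp_mult_def using assms by (intro sum.mono_neutral_left) auto
  also have "\<dots> = (\<Sum>\<mu>\<in>T. cnj (a (\<mu> - \<nu>) (\<alpha> \<nu> g)) * b \<mu> g)"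
  proof (rule sum.cong)
    fix \<mu>
    have "\<alpha> (\<nu> - \<mu>) (\<alpha> \<mu> g) = \<alpha> \<nu> g"
      by (simp flip: \<alpha>_add)
    then show "cp_star \<alpha> a (\<nu> - \<mu>) (\<alpha> \<mu> g) * b \<mu> g = cnj (a (\<mu> - \<nu>) (\<alpha> \<nu> g)) * b \<mu> g"
      by (simp add: cp_star_def)
  qed simp
  finally show ?thesis .
qed

text \<open>The representation with coefficients $u_\gamma 1_{\{\beta_g(\gamma) = s\}} u_{ij}$ on a finite \<open>\<beta>\<close>-orbit.\<close>

lemma orbit_rep_coefficient:
  assumes u: "group_unitary_rep n u" and ij: "i < n" "j < n"
  shows "(\<lambda>\<gamma>' g. if \<gamma>' = \<gamma> then u i j g else 0) \<in> Modules.module.span (\<lambda>c a \<gamma> g. c * a \<gamma> g)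
    {U i j | U n i j. bicrossed_unitary_rep \<alpha> \<beta> n U \<and> i < n \<and> j < n}"
proof -
  interpret md: Modules.module "\<lambda>c (a :: 'g \<Rightarrow> 'h \<Rightarrow> complex) \<gamma> g. c * a \<gamma> g"
    by (rule function_module2)
  note uD = u[unfolded group_unitary_rep_def, rule_format]
  define S where "S = range (\<lambda>g. \<beta> g \<gamma>)"
  have finS: "finite S" unfolding S_def by (rule finite_\<beta>_orbit)
  have S: "\<beta> g s \<in> S" if "s \<in> S" for g s
    using that unfolding S_def by (auto simp flip: \<beta>_add)
  have \<gamma>S: "\<gamma> \<in> S" unfolding S_def using \<beta>_zero by (metis rangeI)
  define I where "I = S \<times> {..<n}"
  have finI: "finite I" using finS by (simp add: I_def)
  then obtain \<phi> where \<phi>: "bij_betw \<phi> {0..<card I} I"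
    using ex_bij_betw_nat_finite by blast
  have \<phi>: "bij_betw \<phi> {..<card I} I" using \<phi> by (simp add: atLeast0LessThan)
  define V :: "'g \<times> nat \<Rightarrow> 'g \<times> nat \<Rightarrow> 'g \<Rightarrow> 'h \<Rightarrow> complex" where
    "V p q = (\<lambda>\<gamma> g. if \<gamma> = fst p \<and> \<beta> g (fst p) = fst q then u (snd p) (snd q) g else 0)" for p q
  have suppV: "{\<gamma>. V p q \<gamma> \<noteq> 0} \<subseteq> {fst p}" for p q
    by (auto simp: V_def fun_eq_iff)
  have core: "V p q \<in> crossed_product_core" if "p \<in> I" "q \<in> I" for p q
  proof -
    have "continuous_on UNIV (V p q \<gamma>')" for \<gamma>'
    proof -
      have cl: "open (- {g. \<beta> g (fst p) = fst q})"
      proof -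
        have "- {g. \<beta> g (fst p) = fst q} = (\<Union>\<mu>\<in>-{fst q}. {g. \<beta> g (fst p) = \<mu>})" by auto
        then show ?thesis using open_fibre by auto
      qed
      have c: "continuous_on UNIV (u (snd p) (snd q))"
        using uD that by (auto simp: I_def)
      have "continuous_on ({g. \<beta> g (fst p) = fst q} \<union> - {g. \<beta> g (fst p) = fst q})
          (\<lambda>g. if \<beta> g (fst p) = fst q then u (snd p) (snd q) g else 0)"
        by (rule continuous_on_open_Un[OF open_fibre cl])
          (auto intro!: continuous_on_subset[OF c] continuous_on_const cong: continuous_on_cong_simp)
      then show ?thesis by (cases "\<gamma>' = fst p") (auto simp: V_def)
    qed
    moreover have "finite {\<gamma>. V p q \<gamma> \<noteq> 0}"
      using suppV finite_subset by blast
    ultimately show ?thesis by (simp add: crossed_product_core_def)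
  qed
  have comul: "comult \<beta> (V p q) = (\<lambda>\<gamma> r g h. \<Sum>k\<in>I. V p k \<gamma> g * V k q r h)"
    if "p \<in> I" "q \<in> I" for p q
  proof (intro ext)
    fix \<gamma>' r g h
    obtain a i where p: "p = (a, i)" "a \<in> S" "i < n" using \<open>p \<in> I\<close> by (auto simp: I_def)
    obtain b j where q: "q = (b, j)" "b \<in> S" "j < n" using \<open>q \<in> I\<close> by (auto simp: I_def)
    have "(\<Sum>k\<in>I. V p k \<gamma>' g * V k q r h) = (\<Sum>c\<in>S. \<Sum>k<n. V p (c, k) \<gamma>' g * V (c, k) q r h)"
      unfolding I_def by (simp add: sum.cartesian_product)
    also have "\<dots> = (\<Sum>c\<in>S. if \<beta> g a = c then
        (if \<gamma>' = a \<and> r = c \<and> \<beta> h c = b then \<Sum>k<n. u i k g * u k j h else 0) else 0)"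
      by (rule sum.cong) (auto simp: V_def p q)
    also have "\<dots> = (if \<gamma>' = a \<and> r = \<beta> g a \<and> \<beta> h (\<beta> g a) = b then \<Sum>k<n. u i k g * u k j h else 0)"
      using finS S[OF p(2)] by (simp add: sum.delta')
    also have "\<dots> = comult \<beta> (V p q) \<gamma>' r g h"
      using uD[OF p(3) q(3)] by (auto simp: comult_def V_def p q \<beta>_add)
    finally show "comult \<beta> (V p q) \<gamma>' r g h = (\<Sum>k\<in>I. V p k \<gamma>' g * V k q r h)" ..
  qed
  have uni1: "(\<Sum>k\<in>I. cp_mult \<alpha> (V p k) (cp_star \<alpha> (V q k))) = (if p = q then cp_one else 0)"
    if "p \<in> I" "q \<in> I" for p q
  proof (intro ext)
    fix \<nu> g
    obtain a i where p: "p = (a, i)" "a \<in> S" "i < n" using \<open>p \<in> I\<close> by (auto simp: I_def)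
    obtain b j where q: "q = (b, j)" "b \<in> S" "j < n" using \<open>q \<in> I\<close> by (auto simp: I_def)
    define g' where "g' = \<alpha> (- b) g"
    have right_zero: "x = 0" if "x + y = y" for x y :: 'g
      using that by (metis add.left_neutral add_right_cancel)
    have "(\<Sum>k\<in>I. cp_mult \<alpha> (V p k) (cp_star \<alpha> (V q k))) \<nu> g =
        (\<Sum>k\<in>I. V p k (\<nu> + b) g' * cnj (V q k b g'))"
      using cp_mult_star_apply[OF _ suppV] by (simp add: sum_fun_apply g'_def q)
    also have "\<dots> = (\<Sum>c\<in>S. \<Sum>k<n. V p (c, k) (\<nu> + b) g' * cnj (V q (c, k) b g'))"
      unfolding I_def by (simp add: sum.cartesian_product)
    also have "\<dots> = (\<Sum>c\<in>S. if \<beta> g' b = c then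
        (if \<nu> + b = a \<and> \<beta> g' a = \<beta> g' b then \<Sum>k<n. u i k g' * cnj (u j k g') else 0) else 0)"
      by (rule sum.cong) (auto simp: V_def p q)
    also have "\<dots> = (if \<nu> + b = a \<and> \<beta> g' a = \<beta> g' b then \<Sum>k<n. u i k g' * cnj (u j k g') else 0)"
      using finS S[OF q(2)] by (simp add: sum.delta')
    also have "\<dots> = (if p = q then cp_one else 0) \<nu> g"
      using uD[OF p(3) q(3)] right_zero by (auto simp: p q \<beta>_inj cp_one_def)
    finally show "(\<Sum>k\<in>I. cp_mult \<alpha> (V p k) (cp_star \<alpha> (V q k))) \<nu> g = (if p = q then cp_one else 0) \<nu> g" .
  qed
  have uni2: "(\<Sum>k\<in>I. cp_mult \<alpha> (cp_star \<alpha> (V k p)) (V k q)) = (if p = q then cp_one else 0)"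
    if "p \<in> I" "q \<in> I" for p q
  proof (intro ext)
    fix \<nu> g
    obtain a i where p: "p = (a, i)" "a \<in> S" "i < n" using \<open>p \<in> I\<close> by (auto simp: I_def)
    obtain b j where q: "q = (b, j)" "b \<in> S" "j < n" using \<open>q \<in> I\<close> by (auto simp: I_def)
    have "(\<Sum>k\<in>I. cp_mult \<alpha> (cp_star \<alpha> (V k p)) (V k q)) \<nu> g =
        (\<Sum>k\<in>I. cnj (V k p (fst k - \<nu>) (\<alpha> \<nu> g)) * V k q (fst k) g)"
      using cp_star_mult_apply[OF _ suppV] by (simp add: sum_fun_apply)
    also have "\<dots> = (\<Sum>c\<in>S. \<Sum>k<n. cnj (V (c, k) p (c - \<nu>) (\<alpha> \<nu> g)) * V (c, k) q c g)"
      unfolding I_def by (simp add: sum.cartesian_product split_def)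
    also have "\<dots> = (\<Sum>c\<in>S. if \<beta> (- g) b = c then
        (if \<nu> = 0 \<and> a = b then \<Sum>k<n. cnj (u k i g) * u k j g else 0) else 0)"
    proof (rule sum.cong)
      fix c
      have 1: "\<beta> (- g) b = c \<longleftrightarrow> \<beta> g c = b" using \<beta>_cancel by metis
      have 2: "c - \<nu> = c \<longleftrightarrow> \<nu> = 0"
        by (metis add_0_right diff_add_cancel diff_zero add_left_imp_eq)
      show "(\<Sum>k<n. cnj (V (c, k) p (c - \<nu>) (\<alpha> \<nu> g)) * V (c, k) q c g) =
          (if \<beta> (- g) b = c then
            (if \<nu> = 0 \<and> a = b then \<Sum>k<n. cnj (u k i g) * u k j g else 0) else 0)"
        unfolding 1 by (cases "\<nu> = 0") (auto simp: V_def p q 2 \<alpha>_zero)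
    qed simp
    also have "\<dots> = (if \<nu> = 0 \<and> a = b then \<Sum>k<n. cnj (u k i g) * u k j g else 0)"
      using finS S[OF q(2)] by (simp add: sum.delta')
    also have "\<dots> = (if p = q then cp_one else 0) \<nu> g"
      using uD[OF p(3) q(3)] by (auto simp: p q cp_one_def)
    finally show "(\<Sum>k\<in>I. cp_mult \<alpha> (cp_star \<alpha> (V k p)) (V k q)) \<nu> g = (if p = q then cp_one else 0) \<nu> g" .
  qed
  define U where "U k l = V (\<phi> k) (\<phi> l)" for k l
  have \<phi>I: "\<phi> k \<in> I" if "k < card I" for k
    using \<phi> that by (auto dest: bij_betwE)
  have \<phi>_eq: "\<phi> k = \<phi> l \<longleftrightarrow> k = l" if "k < card I" "l < card I" for k l
    using \<phi> that by (auto simp: bij_betw_def inj_on_def)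
  have rep: "bicrossed_unitary_rep \<alpha> \<beta> (card I) U"
    unfolding bicrossed_unitary_rep_def
  proof (intro allI impI conjI)
    fix k l assume kl: "k < card I" "l < card I"
    show "U k l \<in> crossed_product_core"
      using core \<phi>I kl by (simp add: U_def)
    show "comult \<beta> (U k l) = (\<lambda>\<gamma> r g h. \<Sum>m<card I. U k m \<gamma> g * U m l r h)"
      using comul[OF \<phi>I \<phi>I, OF kl]
      by (simp add: U_def sum.reindex_bij_betw[OF \<phi>, where g = "\<lambda>m. V (\<phi> k) m _ _ * V m (\<phi> l) _ _"])
    show "(\<Sum>m<card I. cp_mult \<alpha> (U k m) (cp_star \<alpha> (U l m))) = (if k = l then cp_one else 0)"
      using uni1[OF \<phi>I \<phi>I, OF kl] \<phi>_eq[OF kl]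
      by (simp add: U_def sum.reindex_bij_betw[OF \<phi>, where g = "\<lambda>m. cp_mult \<alpha> (V (\<phi> k) m) (cp_star \<alpha> (V (\<phi> l) m))"])
    show "(\<Sum>m<card I. cp_mult \<alpha> (cp_star \<alpha> (U m k)) (U m l)) = (if k = l then cp_one else 0)"
      using uni2[OF \<phi>I \<phi>I, OF kl] \<phi>_eq[OF kl]
      by (simp add: U_def sum.reindex_bij_betw[OF \<phi>, where g = "\<lambda>m. cp_mult \<alpha> (cp_star \<alpha> (V m (\<phi> k))) (V m (\<phi> l))"])
  qed
  let ?B = "{U i j | U n i j. bicrossed_unitary_rep \<alpha> \<beta> n U \<and> i < n \<and> j < n}"
  have VB: "V p q \<in> ?B" if "p \<in> I" "q \<in> I" for p q
  proof -
    have "p \<in> \<phi> ` {..<card I}" "q \<in> \<phi> ` {..<card I}"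
      using \<phi> that by (simp_all add: bij_betw_def)
    then obtain k l where "k < card I" "p = \<phi> k" "l < card I" "q = \<phi> l"
      by blast
    then have "V p q = U k l" "k < card I" "l < card I" by (simp_all add: U_def)
    with rep show ?thesis by blast
  qed
  have "(\<lambda>\<gamma>' g. if \<gamma>' = \<gamma> then u i j g else 0) = (\<Sum>s\<in>S. V (\<gamma>, i) (s, j))"
  proof (intro ext)
    fix \<gamma>' g
    have "(\<Sum>s\<in>S. V (\<gamma>, i) (s, j)) \<gamma>' g = (\<Sum>s\<in>S. if \<beta> g \<gamma> = s then (if \<gamma>' = \<gamma> then u i j g else 0) else 0)"
      unfolding sum_fun_apply by (rule sum.cong) (auto simp: V_def)
    also have "\<dots> = (if \<gamma>' = \<gamma> then u i j g else 0)"
      using finS S[OF \<gamma>S] by (simp add: sum.delta')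
    finally show "(if \<gamma>' = \<gamma> then u i j g else 0) = (\<Sum>s\<in>S. V (\<gamma>, i) (s, j)) \<gamma>' g" ..
  qed
  also have "\<dots> \<in> md.span ?B"
    by (intro md.span_sum md.span_base VB) (use \<gamma>S ij in \<open>auto simp: I_def\<close>)
  finally show ?thesis .
qed

lemma bicrossed_coefficient_representative:
  assumes U: "bicrossed_unitary_rep \<alpha> \<beta> n U" and ij: "i < n" "j < n"
  shows "U i j \<gamma> \<in> representative_functions"
proof -
  interpret md: Modules.module "\<lambda>c (f :: 'h \<Rightarrow> complex) g. c * f g"
    by (rule function_module1)
  note UD = U[unfolded bicrossed_unitary_rep_def, rule_format]
  define T0 where "T0 = insert \<gamma> (\<Union>i<n. \<Union>j<n. {\<gamma>. U i j \<gamma> \<noteq> 0})"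
  define T where "T = (\<Union>r\<in>T0. range (\<lambda>g. \<beta> g r))"
  have "finite T0"
    unfolding T0_def using UD by (auto simp: crossed_product_core_def)
  then have finT: "finite T"
    unfolding T_def using finite_\<beta>_orbit by blast
  have "r \<in> range (\<lambda>g. \<beta> g r)" for r
    using \<beta>_zero by (metis rangeI)
  then have T0T: "T0 \<subseteq> T"
    unfolding T_def by blast
  have supp: "{\<gamma>. U i j \<gamma> \<noteq> 0} \<subseteq> T" if "i < n" "j < n" for i j
    using T0T that unfolding T0_def by blast
  have \<gamma>T: "\<gamma> \<in> T"
    using T0T by (auto simp: T0_def)
  have T: "\<beta> g r \<in> T" if r: "r \<in> T" for g r
  proof -
    obtain s h where "s \<in> T0" "r = \<beta> h s"
      using r unfolding T_def by blast
    then have "\<beta> g r = \<beta> (h + g) s" by (simp add: \<beta>_add)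
    then show ?thesis
      using \<open>s \<in> T0\<close> unfolding T_def by blast
  qed
  have cont: "continuous_on UNIV (U i j r)" if "i < n" "j < n" for i j r
    using UD that by (simp add: crossed_product_core_def)
  have UU: "(\<Sum>k<n. U i k r g * U k j s h) = (if \<beta> g r = s then U i j r (g + h) else 0)"
    if "i < n" "j < n" for i j r s g h
    using UD[OF that] by (metis comult_def)
  have PU: "(\<Sum>k<n. U i k r 0 * U k j s h) = (if r = s then U i j r h else 0)"
    if "i < n" "j < n" for i j r s h
    using UU[OF that, of r 0 s h] by (simp add: \<beta>_zero)
  have unit: "(\<Sum>k<n. \<Sum>r\<in>T. U i k r (\<alpha> (- r) g) * cnj (U j k r (\<alpha> (- r) g))) = (if i = j then 1 else 0)"
    if "i < n" "j < n" for i j g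
  proof -
    have "(\<Sum>k<n. cp_mult \<alpha> (U i k) (cp_star \<alpha> (U j k))) 0 g = (if i = j then 1 else 0)"
      using UD[OF that] by (simp add: cp_one_def)
    moreover have "cp_mult \<alpha> (U i k) (cp_star \<alpha> (U j k)) 0 g =
        (\<Sum>r\<in>T. U i k r (\<alpha> (- r) g) * cnj (U j k r (\<alpha> (- r) g)))" if "k < n" for k
      using cp_mult_star_apply[OF finT supp[OF \<open>j < n\<close> that]] by simp
    ultimately show ?thesis by (simp add: sum_fun_apply)
  qed
  have proj: "(\<Sum>k<n. U i k r y * cnj (U j k r y)) = U i j r 0"
    if "i < n" "j < n" "r \<in> T" for i j r y
  proof -
    define g where "g = \<alpha> r y"
    have "U i j r 0 = (\<Sum>l<n. U i l r 0 * (if l = j then 1 else 0))"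
      using that by (simp add: if_distrib[where f = "\<lambda>x. _ * x"] sum.delta cong: if_cong)
    also have "\<dots> = (\<Sum>l<n. U i l r 0 * (\<Sum>k<n. \<Sum>s\<in>T. U l k s (\<alpha> (- s) g) * cnj (U j k s (\<alpha> (- s) g))))"
      using unit that by simp
    also have "\<dots> = (\<Sum>l<n. \<Sum>k<n. \<Sum>s\<in>T. U i l r 0 * U l k s (\<alpha> (- s) g) * cnj (U j k s (\<alpha> (- s) g)))"
      by (simp add: sum_distrib_left mult.assoc)
    also have "\<dots> = (\<Sum>k<n. \<Sum>l<n. \<Sum>s\<in>T. U i l r 0 * U l k s (\<alpha> (- s) g) * cnj (U j k s (\<alpha> (- s) g)))"
      by (rule sum.swap)
    also have "\<dots> = (\<Sum>k<n. \<Sum>s\<in>T. \<Sum>l<n. U i l r 0 * U l k s (\<alpha> (- s) g) * cnj (U j k s (\<alpha> (- s) g)))"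
      by (intro sum.cong refl sum.swap)
    also have "\<dots> = (\<Sum>k<n. \<Sum>s\<in>T. (if r = s then U i k r y * cnj (U j k r y) else 0))"
      by (intro sum.cong refl, simp only: sum_distrib_right[symmetric])
        (use that PU in \<open>auto simp: g_def \<alpha>_cancel\<close>)
    also have "\<dots> = (\<Sum>k<n. U i k r y * cnj (U j k r y))"
      using finT that by (simp add: sum.delta)
    finally show ?thesis ..
  qed
  have herm: "cnj (U i j r 0) = U j i r 0" if "i < n" "j < n" "r \<in> T" for i j r
  proof -
    have "cnj (U i j r 0) = (\<Sum>k<n. cnj (U i k r 0) * U j k r 0)"
      using proj[OF that, of 0, symmetric] by simp
    also have "\<dots> = U j i r 0"
      using proj[OF that(2,1,3), of 0] by (simp add: mult.commute)
    finally show ?thesis .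
  qed
  define I where "I = T \<times> {..<n}"
  have finI: "finite I" using finT by (simp add: I_def)
  define P :: "'g \<times> nat \<Rightarrow> 'g \<times> nat \<Rightarrow> complex" where
    "P p q = (if fst p = fst q then U (snd p) (snd q) (fst p) 0 else 0)" for p q
  define W :: "'g \<times> nat \<Rightarrow> 'g \<times> nat \<Rightarrow> 'h \<Rightarrow> complex" where
    "W p q g = (if \<beta> g (fst p) = fst q then U (snd p) (snd q) (fst p) g else 0)" for p q g
  define \<delta> :: "'g \<times> nat \<Rightarrow> 'g \<times> nat \<Rightarrow> complex" where "\<delta> p q = (if p = q then 1 else 0)" for p q
  define V where "V p q g = W p q g + (\<delta> p q - P p q)" for p q g
  have W0: "W p q 0 = P p q" for p q
    by (simp add: W_def P_def \<beta>_zero)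
  have sumI: "(\<Sum>k\<in>I. f k) = (\<Sum>c\<in>T. \<Sum>k<n. f (c, k))" for f :: "'g \<times> nat \<Rightarrow> complex"
    unfolding I_def by (simp add: sum.cartesian_product)
  have WW: "(\<Sum>k\<in>I. W p k g * W k q h) = W p q (g + h)" if "p \<in> I" "q \<in> I" for p q g h
  proof -
    obtain a i where p: "p = (a, i)" "a \<in> T" "i < n" using \<open>p \<in> I\<close> by (auto simp: I_def)
    obtain b j where q: "q = (b, j)" "b \<in> T" "j < n" using \<open>q \<in> I\<close> by (auto simp: I_def)
    have "(\<Sum>k\<in>I. W p k g * W k q h) = (\<Sum>c\<in>T. if \<beta> g a = c then
        (if \<beta> h c = b then \<Sum>k<n. U i k a g * U k j c h else 0) else 0)"
      unfolding sumI by (rule sum.cong) (auto simp: W_def p q)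
    also have "\<dots> = (if \<beta> h (\<beta> g a) = b then \<Sum>k<n. U i k a g * U k j (\<beta> g a) h else 0)"
      using finT T[OF p(2)] by (simp add: sum.delta')
    also have "\<dots> = W p q (g + h)"
      using UU[OF p(3) q(3)] by (auto simp: W_def p q \<beta>_add)
    finally show ?thesis .
  qed
  have WWs: "(\<Sum>k\<in>I. W p k g * cnj (W q k g)) = P p q" if "p \<in> I" "q \<in> I" for p q g
  proof -
    obtain a i where p: "p = (a, i)" "a \<in> T" "i < n" using \<open>p \<in> I\<close> by (auto simp: I_def)
    obtain b j where q: "q = (b, j)" "b \<in> T" "j < n" using \<open>q \<in> I\<close> by (auto simp: I_def)
    have "(\<Sum>k\<in>I. W p k g * cnj (W q k g)) = (\<Sum>c\<in>T. if \<beta> g a = c then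
        (if a = b then \<Sum>k<n. U i k a g * cnj (U j k a g) else 0) else 0)"
      unfolding sumI by (rule sum.cong) (auto simp: W_def p q \<beta>_inj)
    also have "\<dots> = (if a = b then \<Sum>k<n. U i k a g * cnj (U j k a g) else 0)"
      using finT T[OF p(2)] by (simp add: sum.delta')
    also have "\<dots> = P p q"
      using proj[OF p(3) q(3) p(2)] by (auto simp: P_def p q)
    finally show ?thesis .
  qed
  have Pherm: "cnj (P p q) = P q p" if "p \<in> I" "q \<in> I" for p q
    using that herm by (auto simp: P_def I_def)
  have \<delta>L: "(\<Sum>k\<in>I. \<delta> p k * f k) = f p" if "p \<in> I" for p f
    using that finI by (simp add: \<delta>_def if_distrib[where f = "\<lambda>x. x * _"] sum.delta' cong: if_cong)
  have \<delta>R: "(\<Sum>k\<in>I. f k * \<delta> k q) = f q" if "q \<in> I" for q f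
    using that finI by (simp add: \<delta>_def if_distrib[where f = "\<lambda>x. _ * x"] sum.delta cong: if_cong)
  have \<delta>sym: "\<delta> p q = \<delta> q p" "cnj (\<delta> p q) = \<delta> p q" for p q
    by (auto simp: \<delta>_def)
  have WP: "(\<Sum>k\<in>I. W p k g * P k q) = W p q g" "(\<Sum>k\<in>I. P p k * W k q g) = W p q g"
    if "p \<in> I" "q \<in> I" for p q g
    using WW[OF that, of g 0] WW[OF that, of 0 g] by (simp_all add: W0)
  have PP: "(\<Sum>k\<in>I. P p k * P k q) = P p q" if "p \<in> I" "q \<in> I" for p q
    using WW[OF that, of 0 0] by (simp add: W0)
  have VV: "V p q (g + h) = (\<Sum>k\<in>I. V p k g * V k q h)" if "p \<in> I" "q \<in> I" for p q g h
    unfolding V_def using that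
    by (simp add: ring_distribs sum.distrib sum_subtractf WW WP PP \<delta>L \<delta>R)
  have VVs: "(\<Sum>k\<in>I. V p k g * cnj (V q k g)) = \<delta> p q" if pq: "p \<in> I" "q \<in> I" for p q g
  proof -
    have *: "(\<Sum>k\<in>I. W p k g * cnj (P q k)) = W p q g" if "p \<in> I" "q \<in> I" for p q
      using WP(1)[OF that, of g] Pherm that by (simp cong: sum.cong)
    have **: "(\<Sum>k\<in>I. P p k * cnj (W q k g)) = cnj (W q p g)"
      using arg_cong[OF *[OF pq(2,1)], of cnj] by (simp add: mult.commute)
    show ?thesis
      unfolding V_def using pq
      by (simp add: ring_distribs sum.distrib sum_subtractf WWs ** WP PP \<delta>L \<delta>sym(2) Pherm
          \<delta>R[of q, unfolded \<delta>sym(1)[of _ q]] \<delta>sym(1)[of q p])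
  qed
  obtain \<phi> where "bij_betw \<phi> {0..<card I} I"
    using ex_bij_betw_nat_finite[OF finI] by blast
  then have \<phi>: "bij_betw \<phi> {..<card I} I" by (simp add: atLeast0LessThan)
  have \<phi>I: "\<phi> k \<in> I" if "k < card I" for k
    using \<phi> that by (auto dest: bij_betwE)
  have \<phi>_eq: "\<phi> k = \<phi> l \<longleftrightarrow> k = l" if "k < card I" "l < card I" for k l
    using \<phi> that by (auto simp: bij_betw_def inj_on_def)
  define v where "v k l = V (\<phi> k) (\<phi> l)" for k l
  have contV: "continuous_on UNIV (V p q)" if "p \<in> I" "q \<in> I" for p q
  proof -
    have cl: "open (- {g. \<beta> g (fst p) = fst q})"
    proof -
      have "- {g. \<beta> g (fst p) = fst q} = (\<Union>\<mu>\<in>-{fst q}. {g. \<beta> g (fst p) = \<mu>})" by auto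
      then show ?thesis using open_fibre by auto
    qed
    have c: "continuous_on UNIV (U (snd p) (snd q) (fst p))"
      using cont that by (auto simp: I_def)
    have "continuous_on ({g. \<beta> g (fst p) = fst q} \<union> - {g. \<beta> g (fst p) = fst q}) (W p q)"
      unfolding W_def by (rule continuous_on_open_Un[OF open_fibre cl])
        (auto intro!: continuous_on_subset[OF c] continuous_on_const cong: continuous_on_cong_simp)
    then have "continuous_on UNIV (W p q)" by simp
    then show ?thesis unfolding V_def[abs_def] by (intro continuous_intros)
  qed
  have rep: "group_unitary_rep (card I) v"
  proof -
    have uni: "(\<Sum>m<card I. v k m g * cnj (v l m g)) = (if k = l then 1 else 0)"
      if "k < card I" "l < card I" for k l g
      using VVs[OF \<phi>I \<phi>I, OF that, of g] \<phi>_eq[OF that]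
      by (simp add: v_def \<delta>_def sum.reindex_bij_betw[OF \<phi>, where g = "\<lambda>m. V (\<phi> k) m g * cnj (V (\<phi> l) m g)"])
    have uni': "(\<Sum>m<card I. cnj (v m k g) * v m l g) = (if k = l then 1 else 0)"
      if kl: "k < card I" "l < card I" for k l g
    proof -
      define A where "A = mat (card I) (card I) (\<lambda>(k, l). v k l g)"
      define B where "B = mat (card I) (card I) (\<lambda>(k, l). cnj (v l k g))"
      have AB: "A \<in> carrier_mat (card I) (card I)" "B \<in> carrier_mat (card I) (card I)"
        by (auto simp: A_def B_def)
      have "A * B = 1\<^sub>m (card I)"
        by (rule eq_matI) (auto simp: A_def B_def scalar_prod_def uni atLeast0LessThan)
      then have "B * A = 1\<^sub>m (card I)"
        using mat_mult_left_right_inverse[OF AB] by simp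
      then have "(B * A) $$ (k, l) = (if k = l then 1 else 0)"
        using kl by simp
      then show ?thesis
        using kl by (simp add: A_def B_def scalar_prod_def atLeast0LessThan)
    qed
    show ?thesis
      unfolding group_unitary_rep_def
    proof (intro allI impI conjI)
      fix k l g h assume kl: "k < card I" "l < card I"
      show "continuous_on UNIV (v k l)"
        unfolding v_def using contV \<phi>I kl by simp
      show "v k l (g + h) = (\<Sum>m<card I. v k m g * v m l h)"
        using VV[OF \<phi>I \<phi>I, OF kl, of g h]
        by (simp add: v_def sum.reindex_bij_betw[OF \<phi>, where g = "\<lambda>m. V (\<phi> k) m g * V m (\<phi> l) h"])
    qed (use uni uni' in auto)
  qed
  let ?B = "{u i j | u n i j. group_unitary_rep n u \<and> i < n \<and> j < n} :: ('h \<Rightarrow> complex) set"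
  have VB: "V p q \<in> md.span ?B" if "p \<in> I" "q \<in> I" for p q
  proof -
    have "p \<in> \<phi> ` {..<card I}" "q \<in> \<phi> ` {..<card I}"
      using \<phi> that by (simp_all add: bij_betw_def)
    then obtain k l where "k < card I" "p = \<phi> k" "l < card I" "q = \<phi> l"
      by blast
    then have "V p q = v k l" "k < card I" "l < card I" by (simp_all add: v_def fun_eq_iff)
    with rep have "V p q \<in> ?B" by blast
    then show ?thesis by (rule md.span_base)
  qed
  have one: "(\<lambda>g. 1 :: complex) \<in> md.span ?B"
  proof -
    have "group_unitary_rep 1 (\<lambda>i j (g :: 'h). 1)"
      by (simp add: group_unitary_rep_def)
    then have "(\<lambda>g. 1 :: complex) \<in> ?B"
      unfolding mem_Collect_eq
      by (rule_tac x = "\<lambda>i j g. 1" in exI, rule_tac x = 1 in exI, rule_tac x = 0 in exI,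
          rule_tac x = 0 in exI) simp
    then show ?thesis by (rule md.span_base)
  qed
  have const: "(\<lambda>g. c) \<in> md.span ?B" for c :: complex
    using md.span_scale[OF one, of c] by simp
  have "U i j \<gamma> = (\<Sum>s\<in>T. V (\<gamma>, i) (s, j) - (\<lambda>g. \<delta> (\<gamma>, i) (s, j) - P (\<gamma>, i) (s, j)))"
  proof
    fix g
    have "(\<Sum>s\<in>T. V (\<gamma>, i) (s, j) - (\<lambda>g. \<delta> (\<gamma>, i) (s, j) - P (\<gamma>, i) (s, j))) g
        = (\<Sum>s\<in>T. if \<beta> g \<gamma> = s then U i j \<gamma> g else 0)"
      unfolding sum_fun_apply by (rule sum.cong) (auto simp: V_def W_def)
    also have "\<dots> = U i j \<gamma> g"
      using finT T[OF \<gamma>T] by (simp add: sum.delta')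
    finally show "U i j \<gamma> g = (\<Sum>s\<in>T. V (\<gamma>, i) (s, j) - (\<lambda>g. \<delta> (\<gamma>, i) (s, j) - P (\<gamma>, i) (s, j))) g" ..
  qed
  also have "\<dots> \<in> md.span ?B"
    by (intro md.span_sum md.span_diff VB const) (use \<gamma>T ij in \<open>auto simp: I_def\<close>)
  finally show ?thesis unfolding representative_functions_def .
qed

lemma carrier_bicrossed_cqg_algebra:
  "carrier (bicrossed_cqg_algebra \<alpha> \<beta>) = algebraic_crossed_product"
proof -
  interpret m1: Modules.module "\<lambda>c (f :: 'h \<Rightarrow> complex) g. c * f g"
    by (rule function_module1)
  interpret m2: Modules.module "\<lambda>c (a :: 'g \<Rightarrow> 'h \<Rightarrow> complex) \<gamma> g. c * a \<gamma> g"
    by (rule function_module2)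
  let ?B = "{U i j | U n i j. bicrossed_unitary_rep \<alpha> \<beta> n U \<and> i < n \<and> j < n}"
  let ?C = "algebraic_crossed_product :: ('g \<Rightarrow> 'h \<Rightarrow> complex) set"
  have sub1: "m1.subspace representative_functions"
    unfolding representative_functions_def by (rule m1.subspace_span)
  have "m2.span ?B \<subseteq> ?C"
  proof (rule m2.span_minimal)
    show "?B \<subseteq> ?C"
    proof clarify
      fix U n i j assume *: "bicrossed_unitary_rep \<alpha> \<beta> n U" "i < n" "j < n"
      then have "finite {\<gamma>. U i j \<gamma> \<noteq> 0}"
        by (simp add: bicrossed_unitary_rep_def crossed_product_core_def)
      then show "U i j \<in> ?C"
        using bicrossed_coefficient_representative[OF *]
        by (simp add: algebraic_crossed_product_def)
    qed
    show "m2.subspace ?C"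
    proof (rule m2.subspaceI)
      show "0 \<in> ?C"
        using m1.subspace_0[OF sub1] by (simp add: algebraic_crossed_product_def)
    next
      fix a b assume ab: "a \<in> ?C" "b \<in> ?C"
      have "finite {\<gamma>. (a + b) \<gamma> \<noteq> 0}"
        by (rule finite_subset[of _ "{\<gamma>. a \<gamma> \<noteq> 0} \<union> {\<gamma>. b \<gamma> \<noteq> 0}"])
          (use ab in \<open>auto simp: algebraic_crossed_product_def\<close>)
      then show "a + b \<in> ?C"
        using ab m1.subspace_add[OF sub1] by (simp add: algebraic_crossed_product_def)
    next
      fix c a assume a: "a \<in> ?C"
      have "finite {\<gamma>. (\<lambda>g. c * a \<gamma> g) \<noteq> 0}"
        by (rule finite_subset[of _ "{\<gamma>. a \<gamma> \<noteq> 0}"])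
          (use a in \<open>auto simp: algebraic_crossed_product_def fun_eq_iff\<close>)
      then show "(\<lambda>\<gamma> g. c * a \<gamma> g) \<in> ?C"
        using a m1.subspace_scale[OF sub1] by (simp add: algebraic_crossed_product_def)
    qed
  qed
  moreover have "?C \<subseteq> m2.span ?B"
  proof
    fix a assume a: "a \<in> ?C"
    have single: "(\<lambda>\<gamma>' g. if \<gamma>' = \<gamma> then f g else 0) \<in> m2.span ?B"
      if "f \<in> representative_functions" for \<gamma> :: 'g and f
      using that unfolding representative_functions_def
    proof (induction rule: m1.span_induct_alt)
      case base
      have "(\<lambda>\<gamma>' g. if \<gamma>' = \<gamma> then (0 :: 'h \<Rightarrow> complex) g else 0) = 0"
        by (auto simp: fun_eq_iff)
      then show ?case using m2.span_zero[of ?B] by (simp only:)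
    next
      case (step c x y)
      then obtain u n i j where *: "group_unitary_rep n u" "i < n" "j < n" and x: "x = u i j"
        by auto
      have "(\<lambda>\<gamma>' g. c * (if \<gamma>' = \<gamma> then x g else 0)) + (\<lambda>\<gamma>' g. if \<gamma>' = \<gamma> then y g else 0) \<in> m2.span ?B"
        unfolding x by (intro m2.span_add m2.span_scale orbit_rep_coefficient[OF *] step.IH)
      also have "(\<lambda>\<gamma>' g. c * (if \<gamma>' = \<gamma> then x g else 0)) + (\<lambda>\<gamma>' g. if \<gamma>' = \<gamma> then y g else 0)
          = (\<lambda>\<gamma>' g. if \<gamma>' = \<gamma> then ((\<lambda>g. c * x g) + y) g else 0)"
        by (auto simp: fun_eq_iff)
      finally show ?case .
    qed
    have "a = (\<Sum>\<gamma> | a \<gamma> \<noteq> 0. (\<lambda>\<gamma>' g. if \<gamma>' = \<gamma> then a \<gamma> g else 0))"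
    proof (intro ext)
      fix \<gamma>' g
      have "(\<Sum>\<gamma> | a \<gamma> \<noteq> 0. (\<lambda>\<gamma>' g. if \<gamma>' = \<gamma> then a \<gamma> g else 0)) \<gamma>' g
          = (\<Sum>\<gamma> | a \<gamma> \<noteq> 0. if \<gamma>' = \<gamma> then a \<gamma> g else 0)"
        by (simp add: sum_fun_apply)
      also have "\<dots> = a \<gamma>' g"
        using a by (auto simp: algebraic_crossed_product_def sum.delta')
      finally show "a \<gamma>' g = (\<Sum>\<gamma> | a \<gamma> \<noteq> 0. (\<lambda>\<gamma>' g. if \<gamma>' = \<gamma> then a \<gamma> g else 0)) \<gamma>' g" ..
    qed
    also have "\<dots> \<in> m2.span ?B"
      by (intro m2.span_sum single) (use a in \<open>simp add: algebraic_crossed_product_def\<close>)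
    finally show "a \<in> m2.span ?B" .
  qed
  ultimately show ?thesis
    by (auto simp: bicrossed_cqg_algebra_def)
qed

end

end

theory Submission
  imports Defs "HOL-Analysis.Analysis"
begin

text \<open>
  A finite-dimensional *-representation of $\mathcal{A}(G) \rtimes \Gamma$ restricts to
  $\mathcal{A}(G)$, and the common zeros in $G$ of the kernel $J$ of the restriction form a finite
  $\alpha$-invariant set $Z$. Conversely every function vanishing on $Z$ lies in $J$: the Haar mean
  shows that a state on $\mathcal{A}(G)$ is positive on strictly positive functions, so no passage to
  the spectrum of $\mathcal{A}(G)$ is required. Hence, if $\mathcal{A}(G) \rtimes \Gamma$ is RFD,
  representative functions are determined by their values on the set $F$ of points of finite orbit.
  The matching relations make $F$ a subgroup of $G$, so the invariant mean over $F$ agrees with the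
  Haar mean on $\mathcal{A}(G)$; as $\mathcal{A}(G)$ is uniformly dense in $C(G)$ by the Peter-Weyl
  theorem, $F$ is dense. In the other direction, $\mathcal{A}(G) \rtimes \Gamma$ is represented by
  matrices over $\mathbb{C}\Gamma$ indexed by a finite orbit.
\<close>

section \<open>Invariant means on subgroups of a compact group\<close>

text \<open>The obstacle is that RFD speaks of representative functions only, while density of
  \<open>F\<close> is about arbitrary continuous ones. A bump function that vanishes on
  \<open>F\<close> is a uniform limit of representative functions, but these need not vanish on
  \<open>F\<close>, so determination by the values on \<open>F\<close> says nothing about them one
  at a time. The mean survives the passage to the limit: it is Lipschitz for the supremum norm, so
  two means that agree on a uniformly dense subspace agree everywhere. As \<open>F\<close> is not
  known to be closed, there is no integral over \<open>F\<close> to start from. The mean is built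
  from finite averages of translates instead. What makes it exist is that the translates of a
  continuous function on the compact group form a totally bounded family, a property that passes to
  translations and points from any subgroup. With \<open>UNIV\<close> in place of \<open>F\<close>
  the same construction gives the Haar mean, and with it the inner product used for the Peter-Weyl
  theorem.\<close>

definition avg :: "'i list \<Rightarrow> ('i \<Rightarrow> real) \<Rightarrow> real" where
  "avg ts f = (\<Sum>t\<leftarrow>ts. f t) / real (length ts)"

definition lavg :: "'h::plus list \<Rightarrow> ('h \<Rightarrow> real) \<Rightarrow> 'h \<Rightarrow> real" where
  "lavg ts f x = avg ts (\<lambda>t. f (t + x))"

definition ravg :: "'h::plus list \<Rightarrow> ('h \<Rightarrow> real) \<Rightarrow> 'h \<Rightarrow> real" where
  "ravg ts f x = avg ts (\<lambda>t. f (x + t))"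

lemma avg_add: "avg ts (\<lambda>t. f t + g t) = avg ts f + avg ts g"
  by (simp add: avg_def sum_list_addf add_divide_distrib)

lemma avg_cmult: "avg ts (\<lambda>t. c * f t) = c * avg ts f"
  by (simp add: avg_def sum_list_const_mult)

lemma avg_const: "ts \<noteq> [] \<Longrightarrow> avg ts (\<lambda>t. c) = c"
  by (simp add: avg_def sum_list_triv)

lemma avg_mono: "(\<And>t. t \<in> set ts \<Longrightarrow> f t \<le> g t) \<Longrightarrow> avg ts f \<le> avg ts g"
  unfolding avg_def by (intro divide_right_mono sum_list_mono) auto

lemma avg_near:
  assumes "ts \<noteq> []" "\<And>t. t \<in> set ts \<Longrightarrow> \<bar>f t - m\<bar> \<le> e"
  shows "\<bar>avg ts f - m\<bar> \<le> e"
proof -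
  have "avg ts f \<le> avg ts (\<lambda>t. m + e)" "avg ts (\<lambda>t. m - e) \<le> avg ts f"
    by (rule avg_mono; use assms(2) in fastforce)+
  then show ?thesis
    using avg_const[OF assms(1)] by (simp add: abs_le_iff)
qed

lemma avg_swap: "avg ts (\<lambda>t. avg ss (\<lambda>s. h t s)) = avg ss (\<lambda>s. avg ts (\<lambda>t. h t s))"
proof -
  have "avg ts (\<lambda>t. avg ss (\<lambda>s. h t s)) = avg ss (\<lambda>s. avg ts (\<lambda>t. h t s))" if "ts \<noteq> []" "ss \<noteq> []"
  proof -
    have *: "(\<Sum>t\<leftarrow>ts. \<Sum>s\<leftarrow>ss. h t s) = (\<Sum>s\<leftarrow>ss. \<Sum>t\<leftarrow>ts. h t s)"
      by (induction ts) (auto simp: sum_list_addf)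
    have "avg ts (\<lambda>t. avg ss (\<lambda>s. h t s)) = (\<Sum>t\<leftarrow>ts. \<Sum>s\<leftarrow>ss. h t s) / real (length ss) / real (length ts)"
      unfolding avg_def using sum_list_mult_const[of _ "inverse (real (length ss))" ts]
      by (simp add: divide_inverse)
    moreover have "avg ss (\<lambda>s. avg ts (\<lambda>t. h t s)) = (\<Sum>s\<leftarrow>ss. \<Sum>t\<leftarrow>ts. h t s) / real (length ts) / real (length ss)"
      unfolding avg_def using sum_list_mult_const[of _ "inverse (real (length ts))" ss]
      by (simp add: divide_inverse)
    ultimately show ?thesis unfolding * by simp
  qed
  then show ?thesis
    by (cases "ts = []"; cases "ss = []") (auto simp: avg_def)
qed

text \<open>Associativity in the group. Uniqueness and the two-sided invariance of the mean rest on
  this exchange.\<close>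

lemma lavg_ravg: "lavg ts (ravg ss f) x = ravg ss (lavg ts f) (x :: 'h::semigroup_add)"
  unfolding lavg_def ravg_def by (subst avg_swap) (simp add: add.assoc)

lemma ravg_uminus: "ravg (map uminus ts) f (- x) = lavg ts (\<lambda>x. f (- x)) (x :: 'h::group_add)"
  by (simp add: ravg_def lavg_def avg_def comp_def minus_add)

text \<open>Lists keep multiplicities, so an average of averages is again an average. The inner
  translation stands on the left, hence the entries \<open>t + s\<close>.\<close>

lemma lavg_lavg:
  "lavg ss (lavg ts f) = lavg (concat (map (\<lambda>s. map (\<lambda>t. t + s) ts) ss)) (f :: 'h::semigroup_add \<Rightarrow> real)"
proof
  fix x
  have "(\<Sum>u\<leftarrow>concat (map (\<lambda>s. map (\<lambda>t. t + s) ts) ss). f (u + x)) = (\<Sum>s\<leftarrow>ss. \<Sum>t\<leftarrow>ts. f (t + (s + x)))"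
    by (induction ss) (auto simp: comp_def add.assoc)
  moreover have "length (concat (map (\<lambda>s. map (\<lambda>t. t + s) ts) ss)) = length ss * length ts"
    by (induction ss) auto
  moreover have "lavg ss (lavg ts f) x = (\<Sum>s\<leftarrow>ss. \<Sum>t\<leftarrow>ts. f (t + (s + x))) / real (length ts) / real (length ss)"
    unfolding lavg_def avg_def using sum_list_mult_const[of _ "inverse (real (length ts))" ss]
    by (simp add: divide_inverse)
  ultimately show "lavg ss (lavg ts f) x = lavg (concat (map (\<lambda>s. map (\<lambda>t. t + s) ts) ss)) f x"
    by (simp add: lavg_def avg_def mult.commute)
qed

lemma continuous_on_lavg:
  fixes f :: "'h::topological_group_add \<Rightarrow> real"
  assumes "continuous_on UNIV f"
  shows "continuous_on UNIV (lavg ts f)"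
proof -
  have "continuous_on UNIV (\<lambda>x. f (t + x))" for t
    by (rule continuous_on_compose2[OF assms]) (auto intro!: continuous_intros)
  then have "continuous_on UNIV (\<lambda>x. \<Sum>t\<leftarrow>ts. f (t + x))"
    by (induction ts) (auto intro!: continuous_intros)
  then show ?thesis
    unfolding lavg_def avg_def by (auto intro!: continuous_intros simp: divide_inverse)
qed

text \<open>One entry is kept and the other \<open>length xs - 1\<close> are replaced by the bound.
  This turns a single small value into a gain for the whole average.\<close>

lemma sum_list_le_except:
  fixes h :: "'i \<Rightarrow> real"
  assumes "x \<in> set xs" "\<And>y. y \<in> set xs \<Longrightarrow> h y \<le> b"
  shows "(\<Sum>y\<leftarrow>xs. h y) \<le> (real (length xs) - 1) * b + h x"
  using assms
proof (induction xs)
  case (Cons a xs)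
  show ?case
  proof (cases "x \<in> set xs")
    case True
    then have "(\<Sum>y\<leftarrow>xs. h y) \<le> (real (length xs) - 1) * b + h x"
      using Cons.IH Cons.prems(2) by simp
    then show ?thesis using Cons.prems(2)[of a]
      by (simp add: algebra_simps)
  next
    case False
    have "(\<Sum>y\<leftarrow>xs. h y) \<le> (\<Sum>y\<leftarrow>xs. b)"
      using Cons.prems(2) by (intro sum_list_mono) auto
    then show ?thesis using False Cons.prems(1) by (simp add: sum_list_triv)
  qed
qed simp

text \<open>Compactness in y gives each x0 a neighbourhood on which \<open>H\<close> moves by at
  most e/2, uniformly in y. The centres of a finite subcover need not lie in \<open>S\<close>, so
  each is exchanged for a point of \<open>S\<close> in its neighbourhood, which doubles the error.
  \<open>S\<close> can thus be a subgroup that is not closed.\<close>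

lemma jointly_continuous_net:
  fixes H :: "'a::topological_space \<Rightarrow> 'b::topological_space \<Rightarrow> 'c::metric_space"
  assumes H: "continuous_on UNIV (\<lambda>(x, y). H x y)" and c: "compact (UNIV :: 'b set)"
    and ca: "compact (UNIV :: 'a set)" and "e > 0"
  obtains X where "finite X" "X \<subseteq> S" "\<And>x. x \<in> S \<Longrightarrow> \<exists>x0\<in>X. \<forall>y. dist (H x y) (H x0 y) \<le> e"
proof -
  have "\<exists>V. x0 \<in> V \<and> open V \<and> (\<forall>x\<in>V. \<forall>y. dist (H x y) (H x0 y) \<le> e/2)" for x0
  proof -
    have cont: "continuous_on (UNIV \<times> UNIV) (\<lambda>(x, y). H x y)" using H by simp
    obtain V where "x0 \<in> V" "open V"
      "\<forall>x\<in>V \<inter> UNIV. \<forall>t\<in>UNIV. dist (case (x, t) of (x, y) \<Rightarrow> H x y) (case (x0, t) of (x, y) \<Rightarrow> H x y) \<le> e/2"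
      by (rule continuous_on_prod_compactE[OF cont c, of x0 "e/2"]) (use \<open>e > 0\<close> in \<open>auto\<close>)
    then show ?thesis by (intro exI[of _ V]) simp
  qed
  then have "\<exists>V. \<forall>x0. x0 \<in> V x0 \<and> open (V x0) \<and> (\<forall>x\<in>V x0. \<forall>y. dist (H x y) (H x0 y) \<le> e/2)"
    by (intro choice) blast
  then obtain V where V: "\<And>x0. x0 \<in> V x0" "\<And>x0. open (V x0)"
    "\<And>x0 x y. x \<in> V x0 \<Longrightarrow> dist (H x y) (H x0 y) \<le> e/2"
    by blast
  have cover: "UNIV \<subseteq> (\<Union>d\<in>UNIV. V d)" using V(1) by blast
  obtain D where D: "finite D" "UNIV \<subseteq> (\<Union>d\<in>D. V d)"
    by (rule compactE_image[OF ca V(2) cover]) auto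
  define pick where "pick d = (SOME x. x \<in> V d \<inter> S)" for d
  show thesis
  proof (rule that[of "pick ` {d \<in> D. V d \<inter> S \<noteq> {}}"])
    show "finite (pick ` {d \<in> D. V d \<inter> S \<noteq> {}})" using D by simp
    have pick: "pick d \<in> V d \<inter> S" if "V d \<inter> S \<noteq> {}" for d
      unfolding pick_def using that by (meson ex_in_conv someI_ex)
    then show "pick ` {d \<in> D. V d \<inter> S \<noteq> {}} \<subseteq> S" by blast
    fix x assume x: "x \<in> S"
    then obtain d where d: "d \<in> D" "x \<in> V d" using D by auto
    with x have ne: "V d \<inter> S \<noteq> {}" by auto
    have "dist (H x y) (H (pick d) y) \<le> e" for y
      using V(3)[OF d(2), of y] V(3)[of "pick d" d y] pick[OF ne]
        dist_triangle2[of "H x y" "H (pick d) y" "H d y"] by auto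
    then show "\<exists>x0\<in>pick ` {d \<in> D. V d \<inter> S \<noteq> {}}. \<forall>y. dist (H x y) (H x0 y) \<le> e"
      using d ne by blast
  qed
qed

text \<open>The constant that left averages of \<open>f\<close> by elements of \<open>F\<close>
  approach uniformly on \<open>F\<close>; for a compact group and \<open>F = UNIV\<close> it is the
  normalised Haar integral of a continuous \<open>f\<close>. Only the values of \<open>f\<close> on
  \<open>F\<close> enter, and no topology on \<open>F\<close> does.\<close>

definition mean :: "'h::plus set \<Rightarrow> ('h \<Rightarrow> real) \<Rightarrow> real" where
  "mean F f = (THE m. \<forall>e>0. \<exists>ts. ts \<noteq> [] \<and> set ts \<subseteq> F \<and> (\<forall>x\<in>F. \<bar>lavg ts f x - m\<bar> \<le> e))"

locale subgroup_of_compact =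
  fixes F :: "'h::{topological_group_add, t2_space} set"
  assumes compact_UNIV: "compact (UNIV :: 'h set)"
    and zero_mem: "0 \<in> F"
    and add_mem: "x \<in> F \<Longrightarrow> y \<in> F \<Longrightarrow> x + y \<in> F"
    and uminus_mem: "x \<in> F \<Longrightarrow> - x \<in> F"
begin

definition ok :: "'h list \<Rightarrow> bool" where "ok ts \<longleftrightarrow> ts \<noteq> [] \<and> set ts \<subseteq> F"

lemma ok_concat: "ok ss \<Longrightarrow> ok ts \<Longrightarrow> ok (concat (map (\<lambda>s. map (\<lambda>t. t + s) ts) ss))"
  unfolding ok_def using add_mem by (cases ss) auto

lemma ok_uminus: "ok ts \<Longrightarrow> ok (map uminus ts)"
  unfolding ok_def using uminus_mem by auto

lemma ok_zero: "ok [0]"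
  by (simp add: ok_def zero_mem)

lemma lavg_near:
  assumes "ok ts" "x \<in> F" "\<And>x. x \<in> F \<Longrightarrow> \<bar>f x - m\<bar> \<le> e"
  shows "\<bar>lavg ts f x - m\<bar> \<le> e"
  unfolding lavg_def by (rule avg_near) (use assms add_mem in \<open>auto simp: ok_def\<close>)

lemma ravg_near:
  assumes "ok ts" "x \<in> F" "\<And>x. x \<in> F \<Longrightarrow> \<bar>f x - m\<bar> \<le> e"
  shows "\<bar>ravg ts f x - m\<bar> \<le> e"
  unfolding ravg_def by (rule avg_near) (use assms add_mem in \<open>auto simp: ok_def\<close>)

lemma bounded_continuous:
  fixes f :: "'h \<Rightarrow> 'b::real_normed_vector"
  assumes "continuous_on UNIV f"
  obtains C where "C > 0" "\<And>x. norm (f x) \<le> C"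
proof -
  have "bounded (range f)"
    using compact_continuous_image[OF assms compact_UNIV] by (rule compact_imp_bounded)
  then show ?thesis
    using that unfolding bounded_pos by auto
qed

text \<open>
  The mean is the infimum \<open>s\<close> of the upper bounds of the averages of \<open>f\<close>. If an average \<open>g\<close> is
  almost optimal and small at some \<open>y\<close>, then averaging \<open>g\<close> further over the translations
  \<open>y - x\<^sub>i\<close>, for a finite net \<open>x\<^sub>1, \<dots>, x\<^sub>N\<close>, moves the small value everywhere and beats \<open>s\<close>.
\<close>

lemma lavg_converges:
  fixes f :: "'h \<Rightarrow> real"
  assumes f: "continuous_on UNIV f"
  shows "\<exists>m. \<forall>e>0. \<exists>ts. ok ts \<and> (\<forall>x\<in>F. \<bar>lavg ts f x - m\<bar> \<le> e)"
proof -
  define B where "B = {b. \<exists>ts. ok ts \<and> (\<forall>x\<in>F. lavg ts f x \<le> b)}"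
  obtain C where C: "\<And>x. norm (f x) \<le> C" using bounded_continuous[OF f] by metis
  have fC: "f x \<le> C" "- C \<le> f x" for x using C[of x] by (auto simp: abs_le_iff)
  have "C \<in> B"
    unfolding B_def using ok_zero by (auto intro!: exI[of _ "[0]"] simp: lavg_def avg_def fC)
  have "- C \<le> b" if "b \<in> B" for b
  proof -
    obtain ts where ts: "ok ts" "\<forall>x\<in>F. lavg ts f x \<le> b" using \<open>b \<in> B\<close> unfolding B_def by blast
    have "- C = avg ts (\<lambda>t. - C)" using ts by (simp add: avg_const ok_def)
    also have "\<dots> \<le> lavg ts f 0" unfolding lavg_def by (rule avg_mono) (rule fC)
    finally show ?thesis using ts zero_mem by force
  qed
  then have bdd: "bdd_below B" by (auto simp: bdd_below_def)
  define s where "s = Inf B"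
  have s_le: "s \<le> b" if "b \<in> B" for b unfolding s_def using that bdd by (rule cInf_lower)
  show ?thesis
  proof (rule exI[of _ s], intro allI impI)
    fix e :: real assume "e > 0"
    define d where "d = e / 2"
    have "d > 0" using \<open>e > 0\<close> by (simp add: d_def)
    have "continuous_on UNIV (\<lambda>(x, c). f (c + x))"
      unfolding case_prod_beta by (rule continuous_on_compose2[OF f]) (auto intro!: continuous_intros)
    then obtain X where X: "finite X" "X \<subseteq> F" "\<And>x. x \<in> F \<Longrightarrow> \<exists>x0\<in>X. \<forall>c. dist (f (c + x)) (f (c + x0)) \<le> d"
      using jointly_continuous_net[of "\<lambda>x c. f (c + x)" d F] compact_UNIV \<open>d > 0\<close> by metis
    obtain xs where xs: "set xs = X" using finite_list[OF X(1)] by auto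
    have "xs \<noteq> []" using X(3)[OF zero_mem] xs by auto
    define N where "N = real (length xs)"
    have "N > 0" using \<open>xs \<noteq> []\<close> by (simp add: N_def)
    then have "d / N > 0" using \<open>d > 0\<close> by simp
    \<comment> \<open>The slack d / N pays for the N - 1 entries that are only bounded by b:
      together they lose less than d. The error of the net is another d, whence d = e / 2.\<close>
    then have "Inf B < s + d / N" by (simp add: s_def)
    then obtain b where b: "b \<in> B" "b < s + d / N"
      using cInf_lessD[of B] \<open>C \<in> B\<close> by auto
    then obtain ts where ts: "ok ts" "\<And>x. x \<in> F \<Longrightarrow> lavg ts f x \<le> b" by (auto simp: B_def)
    define g where "g = lavg ts f"
    have lower: "s - e \<le> g y" if y: "y \<in> F" for y
    proof -
      define cs where "cs = map (\<lambda>x. y - x) xs"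
      have cs: "ok cs"
        using y xs X(2) \<open>xs \<noteq> []\<close> add_mem uminus_mem unfolding ok_def cs_def
        by (auto simp: diff_conv_add_uminus simp del: add_uminus_conv_diff)
      have "lavg cs g x \<le> ((N - 1) * b + g y + d) / N" if x: "x \<in> F" for x
      proof -
        obtain x0 where x0: "x0 \<in> X" "\<forall>c. dist (f (c + x)) (f (c + x0)) \<le> d" using X(3)[OF x] by auto
        have "\<bar>avg ts (\<lambda>t. f (t + (y - x0 + x)) + - 1 * f (t + y)) - 0\<bar> \<le> d"
        proof (rule avg_near)
          fix t
          have "t + (y - x0 + x) = (t + y - x0) + x" "t + y = (t + y - x0) + x0"
            by (simp_all add: add.assoc flip: add_diff_eq)
          then show "\<bar>f (t + (y - x0 + x)) + - 1 * f (t + y) - 0\<bar> \<le> d"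
            using x0(2)[rule_format, of "t + y - x0"] by (simp add: dist_real_def)
        qed (use ts in \<open>simp add: ok_def\<close>)
        then have near: "g (y - x0 + x) \<le> g y + d"
          unfolding avg_add avg_cmult g_def lavg_def by simp
        have "g (y - x1 + x) \<le> b" if "x1 \<in> set xs" for x1
          unfolding g_def
          by (rule ts(2)) (metis X(2) add_mem add_uminus_conv_diff subsetD that uminus_mem x xs y)
        then have "(\<Sum>x1\<leftarrow>xs. g (y - x1 + x)) \<le> (N - 1) * b + g (y - x0 + x)"
          using sum_list_le_except[of x0 xs "\<lambda>x1. g (y - x1 + x)" b] x0(1) xs by (simp add: N_def)
        also have "\<dots> \<le> (N - 1) * b + g y + d" using near by simp
        finally show ?thesis
          unfolding lavg_def avg_def cs_def by (simp add: N_def comp_def divide_right_mono)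
      qed
      then have "((N - 1) * b + g y + d) / N \<in> B"
        unfolding B_def g_def lavg_lavg using ok_concat[OF cs ts(1)] by blast
      then have "s \<le> ((N - 1) * b + g y + d) / N" by (rule s_le)
      then have "s * N \<le> (N - 1) * b + g y + d" using \<open>N > 0\<close> by (simp add: field_simps)
      moreover have "(N - 1) * b \<le> (N - 1) * (s + d / N)"
        using b(2) \<open>xs \<noteq> []\<close> by (intro mult_left_mono) (auto simp: N_def Suc_le_eq)
      moreover have "(N - 1) * (s + d / N) = s * N - s + d - d / N"
        using \<open>N > 0\<close> by (simp add: field_simps)
      moreover have "e = d + d" by (simp add: d_def)
      ultimately show ?thesis using \<open>d / N > 0\<close> by linarith
    qed
    have "d / N \<le> d / 1"
      using \<open>d > 0\<close> \<open>xs \<noteq> []\<close> by (intro divide_left_mono) (auto simp: N_def Suc_le_eq)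
    then have "\<bar>g y - s\<bar> \<le> e" if "y \<in> F" for y
      using lower[OF that] ts(2)[OF that] b(2) \<open>e > 0\<close>
      unfolding g_def[symmetric] d_def by (simp add: abs_le_iff)
    then show "\<exists>ts. ok ts \<and> (\<forall>x\<in>F. \<bar>lavg ts f x - s\<bar> \<le> e)"
      using ts g_def by blast
  qed
qed

lemma continuous_on_uminus_arg:
  fixes f :: "'h \<Rightarrow> 'b::topological_space"
  shows "continuous_on UNIV f \<Longrightarrow> continuous_on UNIV (\<lambda>x. f (- x))"
  by (erule continuous_on_compose2) (auto intro!: continuous_intros)

lemma ravg_converges:
  fixes f :: "'h \<Rightarrow> real"
  assumes f: "continuous_on UNIV f"
  shows "\<exists>m. \<forall>e>0. \<exists>ts. ok ts \<and> (\<forall>x\<in>F. \<bar>ravg ts f x - m\<bar> \<le> e)"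
proof -
  obtain m where m: "\<And>e. e > 0 \<Longrightarrow> \<exists>ts. ok ts \<and> (\<forall>x\<in>F. \<bar>lavg ts (\<lambda>x. f (- x)) x - m\<bar> \<le> e)"
    using lavg_converges[OF continuous_on_uminus_arg[OF f]] by blast
  have "\<exists>ts. ok ts \<and> (\<forall>x\<in>F. \<bar>ravg ts f x - m\<bar> \<le> e)" if e: "e > 0" for e
  proof -
    obtain ts where ts: "ok ts" "\<And>x. x \<in> F \<Longrightarrow> \<bar>lavg ts (\<lambda>x. f (- x)) x - m\<bar> \<le> e"
      using m[OF e] by auto
    have "\<bar>ravg (map uminus ts) f x - m\<bar> \<le> e" if "x \<in> F" for x
      using ts(2)[OF uminus_mem[OF that]] ravg_uminus[of ts f "- x"] by simp
    then show ?thesis using ok_uminus[OF ts(1)] by blast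
  qed
  then show ?thesis by blast
qed

text \<open>The double average \<open>lavg ts (ravg ss f)\<close> at 0 averages values close to n;
  after the exchange of the two averages it averages values close to m. Two errors of a third of the
  distance cannot bridge the distance.\<close>

lemma lavg_ravg_limit_eq:
  assumes m: "\<And>e. e > 0 \<Longrightarrow> \<exists>ts. ok ts \<and> (\<forall>x\<in>F. \<bar>lavg ts f x - m\<bar> \<le> e)"
    and n: "\<And>e. e > 0 \<Longrightarrow> \<exists>ts. ok ts \<and> (\<forall>x\<in>F. \<bar>ravg ts f x - n\<bar> \<le> e)"
  shows "m = n"
proof (rule ccontr)
  assume "m \<noteq> n"
  then have e: "\<bar>m - n\<bar> / 3 > 0" (is "?e > 0") by simp
  obtain ts ss where ts: "ok ts" "\<And>x. x \<in> F \<Longrightarrow> \<bar>lavg ts f x - m\<bar> \<le> ?e"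
    and ss: "ok ss" "\<And>x. x \<in> F \<Longrightarrow> \<bar>ravg ss f x - n\<bar> \<le> ?e"
    using m[OF e] n[OF e] by auto
  have "\<bar>lavg ts (ravg ss f) 0 - n\<bar> \<le> ?e" by (rule lavg_near[OF ts(1) zero_mem ss(2)])
  moreover have "\<bar>ravg ss (lavg ts f) 0 - m\<bar> \<le> ?e" by (rule ravg_near[OF ss(1) zero_mem ts(2)])
  moreover have "\<bar>m - n\<bar> \<le> \<bar>a - n\<bar> + \<bar>a - m\<bar>" for a by arith
  ultimately have "\<bar>m - n\<bar> \<le> ?e + ?e"
    unfolding lavg_ravg by (meson add_mono order_trans)
  then show False using e by simp
qed

text \<open>Left averages by two lists do not commute in general, so two left limits are compared
  through a right limit, which exists by \<open>ravg_converges\<close>.\<close>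

lemma mean_eqI_lavg:
  assumes f: "continuous_on UNIV f"
    and m: "\<And>e. e > 0 \<Longrightarrow> \<exists>ts. ok ts \<and> (\<forall>x\<in>F. \<bar>lavg ts f x - m\<bar> \<le> e)"
  shows "mean F f = m"
proof -
  obtain n where n: "\<And>e. e > 0 \<Longrightarrow> \<exists>ts. ok ts \<and> (\<forall>x\<in>F. \<bar>ravg ts f x - n\<bar> \<le> e)"
    using ravg_converges[OF f] by blast
  have unique: "m' = n" if "\<And>e. e > 0 \<Longrightarrow> \<exists>ts. ok ts \<and> (\<forall>x\<in>F. \<bar>lavg ts f x - m'\<bar> \<le> e)" for m'
    using lavg_ravg_limit_eq[OF that n] by blast
  have "m = n" by (rule unique) (rule m)
  show ?thesis
    unfolding mean_def
  proof (rule the_equality)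
    show "\<forall>e>0. \<exists>ts. ts \<noteq> [] \<and> set ts \<subseteq> F \<and> (\<forall>x\<in>F. \<bar>lavg ts f x - m\<bar> \<le> e)"
      using m unfolding ok_def by blast
    fix m' assume "\<forall>e>0. \<exists>ts. ts \<noteq> [] \<and> set ts \<subseteq> F \<and> (\<forall>x\<in>F. \<bar>lavg ts f x - m'\<bar> \<le> e)"
    then show "m' = m" using unique[of m'] \<open>m = n\<close> unfolding ok_def by blast
  qed
qed

lemma lavg_mean:
  assumes "continuous_on UNIV f" "e > 0"
  obtains ts where "ok ts" "\<And>x. x \<in> F \<Longrightarrow> \<bar>lavg ts f x - mean F f\<bar> \<le> e"
proof -
  obtain m where m: "\<And>e. e > 0 \<Longrightarrow> \<exists>ts. ok ts \<and> (\<forall>x\<in>F. \<bar>lavg ts f x - m\<bar> \<le> e)"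
    using lavg_converges[OF assms(1)] by blast
  show thesis using m[OF assms(2)] mean_eqI_lavg[OF assms(1) m] that by blast
qed

lemma mean_eqI_ravg:
  assumes f: "continuous_on UNIV f"
    and m: "\<And>e. e > 0 \<Longrightarrow> \<exists>ts. ok ts \<and> (\<forall>x\<in>F. \<bar>ravg ts f x - m\<bar> \<le> e)"
  shows "mean F f = m"
  by (rule lavg_ravg_limit_eq[OF _ m]) (metis lavg_mean[OF f])

lemma ravg_mean:
  assumes "continuous_on UNIV f" "e > 0"
  obtains ts where "ok ts" "\<And>x. x \<in> F \<Longrightarrow> \<bar>ravg ts f x - mean F f\<bar> \<le> e"
proof -
  obtain m where m: "\<And>e. e > 0 \<Longrightarrow> \<exists>ts. ok ts \<and> (\<forall>x\<in>F. \<bar>ravg ts f x - m\<bar> \<le> e)"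
    using ravg_converges[OF assms(1)] by blast
  show thesis using m[OF assms(2)] mean_eqI_ravg[OF assms(1) m] that by blast
qed

text \<open>The mean is computed by right averages here because they pass through the left average
  \<open>lavg ts\<close>.\<close>

lemma mean_lavg:
  assumes "continuous_on UNIV f" "ok ts"
  shows "mean F (lavg ts f) = mean F f"
proof (rule mean_eqI_ravg)
  show "continuous_on UNIV (lavg ts f)" by (rule continuous_on_lavg) fact
  fix e :: real assume "e > 0"
  then obtain ss where "ok ss" "\<And>x. x \<in> F \<Longrightarrow> \<bar>ravg ss f x - mean F f\<bar> \<le> e"
    using ravg_mean[OF assms(1)] by blast
  then show "\<exists>ss. ok ss \<and> (\<forall>x\<in>F. \<bar>ravg ss (lavg ts f) x - mean F f\<bar> \<le> e)"
    using lavg_near[OF assms(2)] unfolding lavg_ravg[symmetric] by blast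
qed

text \<open>Averaging further keeps a function that is already nearly constant on \<open>F\<close>
  nearly constant, so the functions can be treated one after the other. One list for several
  functions is what yields additivity and Fubini.\<close>

lemma common_lavg:
  assumes "finite \<F>" "\<And>f. f \<in> \<F> \<Longrightarrow> continuous_on UNIV f" "e > 0"
  shows "\<exists>ts. ok ts \<and> (\<forall>f\<in>\<F>. \<forall>x\<in>F. \<bar>lavg ts f x - mean F f\<bar> \<le> e)"
  using assms(1,2)
proof (induction \<F>)
  case empty
  then show ?case using ok_zero by auto
next
  case (insert g \<F>)
  then obtain ts where ts: "ok ts" "\<And>f x. f \<in> \<F> \<Longrightarrow> x \<in> F \<Longrightarrow> \<bar>lavg ts f x - mean F f\<bar> \<le> e"
    by auto
  have g: "continuous_on UNIV g" using insert.prems by simp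
  obtain ss where ss: "ok ss" "\<And>x. x \<in> F \<Longrightarrow> \<bar>lavg ss (lavg ts g) x - mean F g\<bar> \<le> e"
    using lavg_mean[OF continuous_on_lavg[OF g, of ts] \<open>e > 0\<close>] mean_lavg[OF g ts(1)] by metis
  have "\<bar>lavg ss (lavg ts f) x - mean F f\<bar> \<le> e" if "f \<in> insert g \<F>" "x \<in> F" for f x
    using that ss(2) lavg_near[OF ss(1) that(2) ts(2), of f] by auto
  then show ?case
    using ok_concat[OF ss(1) ts(1)] unfolding lavg_lavg by blast
qed

lemma mean_const: "mean F (\<lambda>x. c) = c"
  by (rule mean_eqI_lavg) (use ok_zero in \<open>auto intro!: exI[of _ "[0]"] simp: lavg_def avg_def\<close>)

lemma mean_add:
  assumes "continuous_on UNIV f" "continuous_on UNIV g"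
  shows "mean F (\<lambda>x. f x + g x) = mean F f + mean F g"
proof (rule mean_eqI_lavg)
  show "continuous_on UNIV (\<lambda>x. f x + g x)" using assms by (intro continuous_intros)
  fix e :: real assume "e > 0"
  then obtain ts where ts: "ok ts" "\<forall>h\<in>{f, g}. \<forall>x\<in>F. \<bar>lavg ts h x - mean F h\<bar> \<le> e / 2"
    using common_lavg[of "{f, g}" "e/2"] assms by auto
  have add: "lavg ts (\<lambda>x. f x + g x) x = lavg ts f x + lavg ts g x" for x
    by (simp add: lavg_def avg_add)
  show "\<exists>ts. ok ts \<and> (\<forall>x\<in>F. \<bar>lavg ts (\<lambda>x. f x + g x) x - (mean F f + mean F g)\<bar> \<le> e)"
  proof (intro exI[of _ ts] conjI ballI)
    fix x assume "x \<in> F"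
    then have "\<bar>lavg ts f x - mean F f\<bar> \<le> e / 2" "\<bar>lavg ts g x - mean F g\<bar> \<le> e / 2"
      using ts(2) by auto
    then show "\<bar>lavg ts (\<lambda>x. f x + g x) x - (mean F f + mean F g)\<bar> \<le> e"
      unfolding add by linarith
  qed (rule ts)
qed

lemma mean_cmult:
  assumes "continuous_on UNIV f"
  shows "mean F (\<lambda>x. c * f x) = c * mean F f"
proof (rule mean_eqI_lavg)
  show "continuous_on UNIV (\<lambda>x. c * f x)" using assms by (intro continuous_intros)
  fix e :: real assume "e > 0"
  then have "e / (\<bar>c\<bar> + 1) > 0" by simp
  then obtain ts where ts: "ok ts" "\<And>x. x \<in> F \<Longrightarrow> \<bar>lavg ts f x - mean F f\<bar> \<le> e / (\<bar>c\<bar> + 1)"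
    using lavg_mean[OF assms] by metis
  have "\<bar>c * lavg ts f x - c * mean F f\<bar> \<le> e" if "x \<in> F" for x
  proof -
    have "\<bar>c * lavg ts f x - c * mean F f\<bar> = \<bar>c\<bar> * \<bar>lavg ts f x - mean F f\<bar>"
      by (simp add: abs_mult flip: right_diff_distrib)
    also have "\<dots> \<le> (\<bar>c\<bar> + 1) * (e / (\<bar>c\<bar> + 1))"
      using ts(2)[OF that] by (intro mult_mono) auto
    finally show ?thesis by simp
  qed
  then show "\<exists>ts. ok ts \<and> (\<forall>x\<in>F. \<bar>lavg ts (\<lambda>x. c * f x) x - c * mean F f\<bar> \<le> e)"
    using ts(1) unfolding lavg_def avg_cmult by blast
qed

lemma mean_nonneg:
  assumes "continuous_on UNIV f" "\<And>x. x \<in> F \<Longrightarrow> f x \<ge> 0"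
  shows "mean F f \<ge> 0"
proof (rule ccontr)
  assume "\<not> mean F f \<ge> 0"
  then have e: "- mean F f / 2 > 0" by simp
  obtain ts where ts: "ok ts" "\<And>x. x \<in> F \<Longrightarrow> \<bar>lavg ts f x - mean F f\<bar> \<le> - mean F f / 2"
    using lavg_mean[OF assms(1) e] by blast
  have "lavg ts f 0 \<ge> avg ts (\<lambda>t. 0)"
    unfolding lavg_def using ts(1) assms(2) by (intro avg_mono) (auto simp: ok_def)
  then have "lavg ts f 0 \<ge> 0" by (simp add: avg_def)
  with ts(2)[OF zero_mem] e show False by (simp add: abs_le_iff)
qed

lemma mean_mono:
  assumes "continuous_on UNIV f" "continuous_on UNIV g" "\<And>x. x \<in> F \<Longrightarrow> f x \<le> g x"
  shows "mean F f \<le> mean F g"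
proof -
  have "mean F (\<lambda>x. g x + - 1 * f x) \<ge> 0"
    using assms by (intro mean_nonneg continuous_intros) auto
  moreover have "continuous_on UNIV (\<lambda>x. - 1 * f x)"
    using assms(1) by (intro continuous_intros)
  then have "mean F (\<lambda>x. g x + - 1 * f x) = mean F g + - 1 * mean F f"
    using assms by (simp only: mean_add mean_cmult)
  ultimately show ?thesis by simp
qed

lemma mean_dist_le:
  assumes "continuous_on UNIV f" "continuous_on UNIV g" "\<And>x. x \<in> F \<Longrightarrow> \<bar>f x - g x\<bar> \<le> e"
  shows "\<bar>mean F f - mean F g\<bar> \<le> e"
proof -
  have "mean F f \<le> mean F (\<lambda>x. g x + e)" "mean F g \<le> mean F (\<lambda>x. f x + e)"
    using assms by (intro mean_mono continuous_intros; fastforce simp: abs_le_iff)+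
  moreover have "mean F (\<lambda>x. g x + e) = mean F g + e" "mean F (\<lambda>x. f x + e) = mean F f + e"
    using assms by (simp_all add: mean_add mean_const)
  ultimately show ?thesis by (simp add: abs_le_iff)
qed

lemma mean_left_translate:
  assumes "continuous_on UNIV f" "a \<in> F"
  shows "mean F (\<lambda>x. f (a + x)) = mean F f"
proof -
  have "lavg [a] f = (\<lambda>x. f (a + x))" by (simp add: fun_eq_iff lavg_def avg_def)
  then show ?thesis using mean_lavg[OF assms(1), of "[a]"] assms(2) by (simp add: ok_def)
qed

lemma mean_uminus:
  assumes "continuous_on UNIV f"
  shows "mean F (\<lambda>x. f (- x)) = mean F f"
proof (rule mean_eqI_ravg)
  show "continuous_on UNIV (\<lambda>x. f (- x))" using assms by (rule continuous_on_uminus_arg)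
  fix e :: real assume "e > 0"
  then obtain ts where ts: "ok ts" "\<And>x. x \<in> F \<Longrightarrow> \<bar>lavg ts f x - mean F f\<bar> \<le> e"
    using lavg_mean[OF assms] by blast
  have "\<bar>ravg (map uminus ts) (\<lambda>x. f (- x)) x - mean F f\<bar> \<le> e" if "x \<in> F" for x
    using ts(2)[OF uminus_mem[OF that]] ravg_uminus[of ts "\<lambda>x. f (- x)" "- x"] by simp
  then show "\<exists>ts. ok ts \<and> (\<forall>x\<in>F. \<bar>ravg ts (\<lambda>x. f (- x)) x - mean F f\<bar> \<le> e)"
    using ok_uminus[OF ts(1)] by blast
qed

lemma mean_right_translate:
  assumes f: "continuous_on UNIV f" and "a \<in> F"
  shows "mean F (\<lambda>x. f (x + a)) = mean F f"
proof -
  have f': "continuous_on UNIV (\<lambda>x. f (- x))" by (rule continuous_on_uminus_arg) fact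
  have "continuous_on UNIV (\<lambda>x. f (x + a))"
    by (rule continuous_on_compose2[OF f]) (auto intro!: continuous_intros)
  then have "mean F (\<lambda>x. f (x + a)) = mean F (\<lambda>x. f (- x + a))"
    by (rule mean_uminus[symmetric])
  also have "\<dots> = mean F (\<lambda>x. f (- (- a + x)))" by (simp add: minus_add)
  also have "\<dots> = mean F f"
    using mean_left_translate[OF f' uminus_mem[OF assms(2)]] mean_uminus[OF f] by simp
  finally show ?thesis .
qed

lemma continuous_on_curry:
  fixes H :: "'a::topological_space \<Rightarrow> 'b::topological_space \<Rightarrow> 'c::topological_space"
  assumes "continuous_on UNIV (\<lambda>(x, y). H x y)"
  shows "continuous_on UNIV (H x)" "continuous_on UNIV (\<lambda>x. H x y)"
proof -
  have "continuous_on UNIV (\<lambda>y. case (x, y) of (x, y) \<Rightarrow> H x y)"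
    by (rule continuous_on_compose2[OF assms]) (auto intro!: continuous_intros)
  then show "continuous_on UNIV (H x)" by simp
  have "continuous_on UNIV (\<lambda>x. case (x, y) of (x, y) \<Rightarrow> H x y)"
    by (rule continuous_on_compose2[OF assms]) (auto intro!: continuous_intros)
  then show "continuous_on UNIV (\<lambda>x. H x y)" by simp
qed

lemma mean_avg:
  assumes "\<And>t. continuous_on UNIV (h t)"
  shows "mean F (\<lambda>x. avg ts (\<lambda>t. h t x)) = avg ts (\<lambda>t. mean F (h t))"
proof -
  have c: "continuous_on UNIV (\<lambda>x. \<Sum>t\<leftarrow>ts. h t x)" for ts
    by (induction ts) (auto intro!: continuous_intros assms)
  have "mean F (\<lambda>x. \<Sum>t\<leftarrow>ts. h t x) = (\<Sum>t\<leftarrow>ts. mean F (h t))"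
    by (induction ts) (simp_all add: mean_const mean_add assms c)
  then show ?thesis
    using mean_cmult[OF c, of "1 / real (length ts)" ts] by (simp add: avg_def)
qed

text \<open>By compactness \<open>H x\<close> tends to \<open>H x0\<close> uniformly in y, and the
  mean is Lipschitz for the supremum norm.\<close>

lemma continuous_on_mean:
  fixes H :: "'a::topological_space \<Rightarrow> 'h \<Rightarrow> real"
  assumes H: "continuous_on UNIV (\<lambda>(x, y). H x y)"
  shows "continuous_on UNIV (\<lambda>x. mean F (H x))"
  unfolding continuous_on_topological
proof (intro ballI allI impI)
  fix x0 :: 'a and B assume B: "open B" "mean F (H x0) \<in> B"
  then obtain e where e: "e > 0" "cball (mean F (H x0)) e \<subseteq> B"
    using open_contains_cball by blast
  have cont: "continuous_on (UNIV \<times> UNIV) (\<lambda>(x, y). H x y)" using H by simp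
  obtain V where V: "x0 \<in> V" "open V"
    "\<forall>x\<in>V \<inter> UNIV. \<forall>t\<in>UNIV. dist (case (x, t) of (x, y) \<Rightarrow> H x y) (case (x0, t) of (x, y) \<Rightarrow> H x y) \<le> e"
    by (rule continuous_on_prod_compactE[OF cont compact_UNIV, of x0 e]) (use e in auto)
  have "mean F (H x) \<in> B" if "x \<in> V" for x
  proof -
    have "\<bar>mean F (H x) - mean F (H x0)\<bar> \<le> e"
      by (rule mean_dist_le[OF continuous_on_curry(1)[OF H] continuous_on_curry(1)[OF H]])
        (use V(3) that in \<open>simp add: dist_real_def\<close>)
    then have "mean F (H x) \<in> cball (mean F (H x0)) e" by (simp add: dist_real_def abs_minus_commute)
    then show ?thesis using e by blast
  qed
  then show "\<exists>A. open A \<and> x0 \<in> A \<and> (\<forall>y\<in>UNIV. y \<in> A \<longrightarrow> mean F (H y) \<in> B)"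
    using V by blast
qed

end

section \<open>The Haar mean of the whole group: positivity and Fubini\<close>

locale compact_group =
  subgroup_of_compact "UNIV :: 'h::{topological_group_add, t2_space} set"
begin

text \<open>Finitely many translates of the set where \<open>f\<close> exceeds d cover the compact
  group, so some average of \<open>f\<close> is at least d divided by their number. The translations
  must come from the whole group: the mean over a proper subgroup can vanish on such an
  \<open>f\<close>.\<close>

lemma mean_pos:
  fixes f :: "'h \<Rightarrow> real"
  assumes f: "continuous_on UNIV f" and "\<And>x. f x \<ge> 0" and "f x0 > 0"
  shows "mean UNIV f > 0"
proof -
  define d where "d = f x0 / 2"
  have "d > 0" using assms(3) by (simp add: d_def)
  have op: "open {x. f (t + x) > d}" for t
  proof -
    have "continuous_on UNIV (\<lambda>x. f (t + x))"
      by (rule continuous_on_compose2[OF f]) (auto intro!: continuous_intros)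
    then show ?thesis by (intro open_Collect_less continuous_on_const)
  qed
  have cover: "UNIV \<subseteq> (\<Union>t\<in>UNIV. {x. f (t + x) > d})"
  proof
    fix x
    have "f (x0 - x + x) > d" using assms(3) by (simp add: d_def)
    then show "x \<in> (\<Union>t\<in>UNIV. {x. f (t + x) > d})" by blast
  qed
  obtain D where D: "finite D" "UNIV \<subseteq> (\<Union>t\<in>D. {x. f (t + x) > d})"
    by (rule compactE_image[OF compact_UNIV op cover]) auto
  obtain ts where ts: "set ts = D" using finite_list[OF D(1)] by auto
  have "ts \<noteq> []" using D(2) ts by auto
  then have ok: "ok ts" by (simp add: ok_def)
  have "lavg ts f x \<ge> d / length ts" for x
  proof -
    obtain t where t: "t \<in> set ts" "f (t + x) > d" using D(2) ts by auto
    have "f (t + x) \<le> (\<Sum>t\<leftarrow>ts. f (t + x))"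
      using t(1) assms(2) by (intro member_le_sum_list) auto
    then show ?thesis unfolding lavg_def avg_def using t(2) by (intro divide_right_mono) auto
  qed
  then have "mean UNIV (\<lambda>x :: 'h. d / length ts) \<le> mean UNIV (lavg ts f)"
    by (intro mean_mono continuous_intros continuous_on_lavg f) auto
  moreover have "d / length ts > 0" using \<open>d > 0\<close> \<open>ts \<noteq> []\<close> by simp
  ultimately show ?thesis unfolding mean_const mean_lavg[OF f ok] by linarith
qed

text \<open>The inner mean is replaced by one finite average that serves all x at once: it is chosen
  for the finitely many functions \<open>H x0\<close> of a net and for the partial mean over x. A
  finite average commutes with the outer mean. The net and the average cost 3 d, the partial mean
  one more d.\<close>

lemma mean_fubini:
  fixes H :: "'h \<Rightarrow> 'h \<Rightarrow> real"
  assumes H: "continuous_on UNIV (\<lambda>(x, y). H x y)"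
  shows "mean UNIV (\<lambda>x. mean UNIV (\<lambda>y. H x y)) = mean UNIV (\<lambda>y. mean UNIV (\<lambda>x. H x y))"
proof -
  have H': "continuous_on UNIV (\<lambda>(y, x). H x y)"
    unfolding case_prod_beta
    by (rule continuous_on_compose2[OF H[unfolded case_prod_beta], of UNIV "\<lambda>p. (snd p, fst p)", simplified])
      (auto intro!: continuous_intros)
  note c1 = continuous_on_curry(1)[OF H] and c2 = continuous_on_curry(2)[OF H]
  have c3: "continuous_on UNIV (\<lambda>x. mean UNIV (\<lambda>y. H x y))" by (rule continuous_on_mean[OF H])
  have c4: "continuous_on UNIV (\<lambda>y. mean UNIV (\<lambda>x. H x y))" by (rule continuous_on_mean[OF H'])
  have "\<bar>mean UNIV (\<lambda>x. mean UNIV (\<lambda>y. H x y)) - mean UNIV (\<lambda>y. mean UNIV (\<lambda>x. H x y))\<bar> \<le> 0 + e"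
    if "e > 0" for e
  proof -
    define d where "d = e / 4"
    have "d > 0" using that by (simp add: d_def)
    obtain X where X: "finite X" "\<And>x. \<exists>x0\<in>X. \<forall>y. dist (H x y) (H x0 y) \<le> d"
      using jointly_continuous_net[OF H compact_UNIV compact_UNIV \<open>d > 0\<close>, of UNIV] by auto
    obtain ts where ts: "ok ts" and tsX: "\<And>x0. x0 \<in> X \<Longrightarrow> \<bar>lavg ts (H x0) 0 - mean UNIV (H x0)\<bar> \<le> d"
      and tsM: "\<bar>lavg ts (\<lambda>y. mean UNIV (\<lambda>x. H x y)) 0 - mean UNIV (\<lambda>y. mean UNIV (\<lambda>x. H x y))\<bar> \<le> d"
    proof -
      have "\<exists>ts. ok ts \<and> (\<forall>f\<in>insert (\<lambda>y. mean UNIV (\<lambda>x. H x y)) (H ` X). \<forall>x\<in>UNIV. \<bar>lavg ts f x - mean UNIV f\<bar> \<le> d)"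
        by (rule common_lavg[OF _ _ \<open>d > 0\<close>]) (use X(1) c1 c4 in auto)
      then obtain ts where ts: "ok ts" "\<forall>f\<in>insert (\<lambda>y. mean UNIV (\<lambda>x. H x y)) (H ` X). \<forall>x\<in>UNIV. \<bar>lavg ts f x - mean UNIV f\<bar> \<le> d"
        by (elim exE conjE)
      show thesis
        by (rule that[OF ts(1) ts(2)[rule_format, OF insertI2 UNIV_I] ts(2)[rule_format, OF insertI1 UNIV_I]])
          (rule imageI)
    qed
    have near: "\<bar>mean UNIV (H x) - lavg ts (H x) 0\<bar> \<le> 3 * d" for x
    proof -
      obtain x0 where x0: "x0 \<in> X" "\<And>y. \<bar>H x y - H x0 y\<bar> \<le> d"
        using X(2)[of x] by (auto simp: dist_real_def)
      have "\<bar>mean UNIV (H x) - mean UNIV (H x0)\<bar> \<le> d"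
        by (rule mean_dist_le[OF c1 c1]) (rule x0)
      moreover have "\<bar>avg ts (\<lambda>t. H x (t + 0) + - 1 * H x0 (t + 0)) - 0\<bar> \<le> d"
        using ts x0(2) by (intro avg_near) (auto simp: ok_def)
      then have "\<bar>lavg ts (H x) 0 - lavg ts (H x0) 0\<bar> \<le> d"
        unfolding avg_add avg_cmult lavg_def by simp
      ultimately show ?thesis using tsX[OF x0(1)] by linarith
    qed
    have eq: "mean UNIV (\<lambda>x. lavg ts (H x) 0) = lavg ts (\<lambda>y. mean UNIV (\<lambda>x. H x y)) 0"
      unfolding lavg_def by (rule mean_avg) (rule c2)
    have "continuous_on UNIV (\<lambda>x. lavg ts (H x) 0)"
    proof -
      have "continuous_on UNIV (\<lambda>x. \<Sum>t\<leftarrow>ts. H x (t + 0))"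
        by (induction ts) (auto intro!: continuous_intros c2)
      then show ?thesis unfolding lavg_def avg_def divide_inverse by (intro continuous_intros)
    qed
    then have "\<bar>mean UNIV (\<lambda>x. mean UNIV (H x)) - mean UNIV (\<lambda>x. lavg ts (H x) 0)\<bar> \<le> 3 * d"
      by (intro mean_dist_le c3 near)
    then show ?thesis unfolding eq using tsM unfolding d_def by linarith
  qed
  then have "\<bar>mean UNIV (\<lambda>x. mean UNIV (\<lambda>y. H x y)) - mean UNIV (\<lambda>y. mean UNIV (\<lambda>x. H x y))\<bar> \<le> 0"
    by (rule field_le_epsilon)
  then show ?thesis by simp
qed

end

section \<open>Complex-valued means\<close>

definition cmean :: "'h::plus set \<Rightarrow> ('h \<Rightarrow> complex) \<Rightarrow> complex" where
  "cmean F f = Complex (mean F (\<lambda>x. Re (f x))) (mean F (\<lambda>x. Im (f x)))"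

context subgroup_of_compact
begin

lemma cmean_const: "cmean F (\<lambda>x. c) = c"
  by (simp add: cmean_def mean_const)

lemma cmean_of_real: "cmean F (\<lambda>x. of_real (f x)) = of_real (mean F f)"
  by (simp add: cmean_def mean_const complex_eq_iff)

lemma cmean_cmod: "cmean F (\<lambda>x. f x * cnj (f x)) = of_real (mean F (\<lambda>x. (cmod (f x))\<^sup>2))"
  unfolding cmean_of_real[symmetric] by (simp only: complex_norm_square)

lemma continuous_on_Re_Im:
  "continuous_on UNIV f \<Longrightarrow> continuous_on UNIV (\<lambda>x. Re (f x))"
  "continuous_on UNIV f \<Longrightarrow> continuous_on UNIV (\<lambda>x. Im (f x))"
  by (erule continuous_on_Re continuous_on_Im)+

lemma cmean_add:
  assumes "continuous_on UNIV f" "continuous_on UNIV g"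
  shows "cmean F (\<lambda>x. f x + g x) = cmean F f + cmean F g"
  using assms by (simp add: cmean_def mean_add continuous_on_Re_Im complex_eq_iff)

lemma cmean_cmult:
  assumes f: "continuous_on UNIV f"
  shows "cmean F (\<lambda>x. c * f x) = c * cmean F f"
proof -
  have *: "mean F (\<lambda>x. a * g x + b * h x) = a * mean F g + b * mean F h"
    if "continuous_on UNIV g" "continuous_on UNIV h" for a b g h
    using that by (simp only: mean_add mean_cmult continuous_on_mult_left)
  show ?thesis
    using *[OF continuous_on_Re_Im[OF f], of "Re c" "- Im c"] *[OF continuous_on_Re_Im(2,1)[OF f], of "Re c" "Im c"]
    by (simp add: cmean_def complex_eq_iff)
qed

lemma cmean_diff:
  assumes "continuous_on UNIV f" "continuous_on UNIV g"
  shows "cmean F (\<lambda>x. f x - g x) = cmean F f - cmean F g"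
proof -
  have "continuous_on UNIV (\<lambda>x. - 1 * g x)" using assms by (intro continuous_intros)
  then have "cmean F (\<lambda>x. f x + - 1 * g x) = cmean F f + - 1 * cmean F g"
    using assms by (simp only: cmean_add cmean_cmult)
  then show ?thesis by simp
qed

lemma cmean_sum:
  assumes "\<And>i. i \<in> I \<Longrightarrow> continuous_on UNIV (f i)"
  shows "cmean F (\<lambda>x. \<Sum>i\<in>I. f i x) = (\<Sum>i\<in>I. cmean F (f i))"
  using assms
proof (induction I rule: infinite_finite_induct)
  case (insert i I)
  then show ?case by (simp add: cmean_add continuous_on_sum)
qed (simp_all add: cmean_const)

lemma cmean_cnj:
  assumes f: "continuous_on UNIV f"
  shows "cmean F (\<lambda>x. cnj (f x)) = cnj (cmean F f)"
  using mean_cmult[OF continuous_on_Re_Im(2)[OF f], of "- 1"]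
  by (simp add: cmean_def complex_eq_iff)

lemma cmean_left_translate:
  "continuous_on UNIV f \<Longrightarrow> a \<in> F \<Longrightarrow> cmean F (\<lambda>x. f (a + x)) = cmean F f"
  unfolding cmean_def
  by (simp only: mean_left_translate[OF continuous_on_Re_Im(1)] mean_left_translate[OF continuous_on_Re_Im(2)])

lemma cmean_right_translate:
  "continuous_on UNIV f \<Longrightarrow> a \<in> F \<Longrightarrow> cmean F (\<lambda>x. f (x + a)) = cmean F f"
  unfolding cmean_def
  by (simp only: mean_right_translate[OF continuous_on_Re_Im(1)] mean_right_translate[OF continuous_on_Re_Im(2)])

lemma continuous_on_cmean:
  fixes H :: "'a::topological_space \<Rightarrow> 'h \<Rightarrow> complex"
  assumes H: "continuous_on UNIV (\<lambda>(x, y). H x y)"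
  shows "continuous_on UNIV (\<lambda>x. cmean F (H x))"
proof -
  have "continuous_on UNIV (\<lambda>(x, y). Re (H x y))" "continuous_on UNIV (\<lambda>(x, y). Im (H x y))"
    using continuous_on_Re[OF H] continuous_on_Im[OF H] by (simp_all add: case_prod_beta)
  then show ?thesis
    unfolding cmean_def Complex_eq
    by (intro continuous_intros continuous_on_mean)
qed

end

section \<open>The inner product given by the Haar mean, Bessel's inequality and orthonormal
  bases\<close>

context compact_group
begin

lemma cmean_fubini:
  fixes H :: "'h \<Rightarrow> 'h \<Rightarrow> complex"
  assumes H: "continuous_on UNIV (\<lambda>(x, y). H x y)"
  shows "cmean UNIV (\<lambda>x. cmean UNIV (\<lambda>y. H x y)) = cmean UNIV (\<lambda>y. cmean UNIV (\<lambda>x. H x y))"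
proof -
  have "continuous_on UNIV (\<lambda>(x, y). Re (H x y))" "continuous_on UNIV (\<lambda>(x, y). Im (H x y))"
    using continuous_on_Re[OF H] continuous_on_Im[OF H] by (simp_all add: case_prod_beta)
  then show ?thesis
    unfolding cmean_def by (simp add: mean_fubini)
qed

definition ip :: "('h \<Rightarrow> complex) \<Rightarrow> ('h \<Rightarrow> complex) \<Rightarrow> complex" where
  "ip f g = cmean UNIV (\<lambda>x. f x * cnj (g x))"

definition nsq :: "('h \<Rightarrow> complex) \<Rightarrow> real" where
  "nsq f = mean UNIV (\<lambda>x. (cmod (f x))\<^sup>2)"

lemma ip_self: "ip f f = of_real (nsq f)"
  by (simp add: ip_def nsq_def cmean_cmod)

lemma continuous_on_ip_arg:
  "continuous_on UNIV f \<Longrightarrow> continuous_on UNIV g \<Longrightarrow> continuous_on UNIV (\<lambda>x. f x * cnj (g x))"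
  by (intro continuous_intros)

lemma ip_commute:
  assumes "continuous_on UNIV f" "continuous_on UNIV g"
  shows "ip g f = cnj (ip f g)"
  unfolding ip_def cmean_cnj[OF continuous_on_ip_arg[OF assms], symmetric] by (simp add: mult.commute)

lemma ip_diff_left:
  assumes "continuous_on UNIV f" "continuous_on UNIV g" "continuous_on UNIV h"
  shows "ip (\<lambda>x. f x - g x) h = ip f h - ip g h"
  unfolding ip_def using assms by (simp add: left_diff_distrib cmean_diff continuous_on_ip_arg)

lemma ip_cmult_left:
  assumes "continuous_on UNIV f" "continuous_on UNIV h"
  shows "ip (\<lambda>x. c * f x) h = c * ip f h"
  unfolding ip_def using assms by (simp add: mult.assoc cmean_cmult continuous_on_ip_arg)

lemma ip_sum_left:
  assumes "\<And>i. i \<in> I \<Longrightarrow> continuous_on UNIV (f i)" "continuous_on UNIV h"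
  shows "ip (\<lambda>x. \<Sum>i\<in>I. f i x) h = (\<Sum>i\<in>I. ip (f i) h)"
  unfolding ip_def sum_distrib_right using assms by (intro cmean_sum continuous_on_ip_arg) auto

lemma nsq_nonneg: "continuous_on UNIV f \<Longrightarrow> nsq f \<ge> 0"
  unfolding nsq_def by (rule mean_nonneg) (auto intro!: continuous_intros)

lemma nsq_eq_0:
  assumes "continuous_on UNIV f" "nsq f = 0"
  shows "f x = 0"
proof (rule ccontr)
  assume "f x \<noteq> 0"
  then have "nsq f > 0"
    unfolding nsq_def by (intro mean_pos[of _ x] continuous_intros assms(1)) auto
  then show False using assms by simp
qed

lemma nsq_le:
  assumes f: "continuous_on UNIV f" and "\<And>x. cmod (f x) \<le> C"
  shows "nsq f \<le> C\<^sup>2"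
proof -
  have "continuous_on UNIV (\<lambda>x. (cmod (f x))\<^sup>2)" by (intro continuous_intros f)
  then have "nsq f \<le> mean UNIV (\<lambda>x :: 'h. C\<^sup>2)"
    unfolding nsq_def by (rule mean_mono[OF _ continuous_on_const]) (simp add: power_mono assms(2))
  then show ?thesis by (simp add: mean_const)
qed

lemma nsq_diff_cmult:
  assumes f: "continuous_on UNIV f" and g: "continuous_on UNIV g"
  shows "nsq (\<lambda>x. f x - c * g x) = nsq f - 2 * Re (cnj c * ip f g) + (cmod c)\<^sup>2 * nsq g"
proof -
  let ?h = "\<lambda>x. f x - c * g x"
  have h: "continuous_on UNIV ?h" and cg: "continuous_on UNIV (\<lambda>x. c * g x)"
    using f g by (auto intro!: continuous_intros)
  have "of_real (nsq ?h) = ip ?h ?h" by (simp add: ip_self)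
  also have "\<dots> = ip f ?h - c * ip g ?h"
    using f g h cg by (simp add: ip_diff_left ip_cmult_left)
  also have "ip f ?h = cnj (ip ?h f)" using ip_commute[OF h f] .
  also have "ip ?h f = ip f f - c * ip g f"
    using f g cg by (simp add: ip_diff_left ip_cmult_left)
  also have "ip g ?h = cnj (ip ?h g)" using ip_commute[OF h g] .
  also have "ip ?h g = ip f g - c * ip g g"
    using f g cg by (simp add: ip_diff_left ip_cmult_left)
  finally have "of_real (nsq ?h) =
      cnj (of_real (nsq f) - c * cnj (ip f g)) - c * cnj (ip f g - c * of_real (nsq g))"
    by (simp add: ip_self ip_commute[OF f g])
  then have "Re (of_real (nsq ?h)) =
      Re (cnj (of_real (nsq f) - c * cnj (ip f g)) - c * cnj (ip f g - c * of_real (nsq g)))"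
    by simp
  then show ?thesis
    by (simp add: cmod_def power2_eq_square algebra_simps flip: real_sqrt_mult)
qed

lemma ip_cauchy_schwarz:
  assumes f: "continuous_on UNIV f" and g: "continuous_on UNIV g"
  shows "(cmod (ip f g))\<^sup>2 \<le> nsq f * nsq g"
proof (cases "nsq g = 0")
  case True
  then have "g = (\<lambda>x. 0)" using nsq_eq_0[OF g] by auto
  then show ?thesis by (simp add: ip_def cmean_const nsq_def mean_const)
next
  case False
  then have pos: "nsq g > 0" using nsq_nonneg[OF g] by simp
  define c where "c = ip f g / of_real (nsq g)"
  have "0 \<le> nsq (\<lambda>x. f x - c * g x)"
    by (intro nsq_nonneg continuous_intros f g)
  also have "\<dots> = nsq f - 2 * Re (cnj c * ip f g) + (cmod c)\<^sup>2 * nsq g"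
    by (rule nsq_diff_cmult[OF f g])
  also have "cnj c * ip f g = of_real ((cmod (ip f g))\<^sup>2 / nsq g)"
    by (simp only: of_real_divide complex_norm_square) (simp add: c_def mult.commute)
  also have "(cmod c)\<^sup>2 * nsq g = (cmod (ip f g))\<^sup>2 / nsq g"
    using pos by (simp add: c_def norm_divide power_divide power2_eq_square)
  finally have "(cmod (ip f g))\<^sup>2 / nsq g \<le> nsq f" by simp
  then show ?thesis using pos by (simp add: field_simps)
qed

definition orthonormal :: "nat \<Rightarrow> (nat \<Rightarrow> 'h \<Rightarrow> complex) \<Rightarrow> bool" where
  "orthonormal n e \<longleftrightarrow> (\<forall>i<n. continuous_on UNIV (e i)) \<and>
     (\<forall>i<n. \<forall>j<n. ip (e i) (e j) = (if i = j then 1 else 0))"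

text \<open>The sum may stop before n because vectors are split off one at a time in
  \<open>bessel\<close>: a partial sum of length i has coefficient 0 at \<open>e i\<close>.\<close>

lemma ip_expansion:
  assumes e: "orthonormal n e" and "m \<le> n" "i < n"
  shows "ip (\<lambda>x. \<Sum>j<m. c j * e j x) (e i) = (if i < m then c i else 0)"
proof -
  have "ip (\<lambda>x. \<Sum>j<m. c j * e j x) (e i) = (\<Sum>j<m. c j * ip (e j) (e i))"
    using assms by (subst ip_sum_left) (auto simp: orthonormal_def ip_cmult_left intro!: continuous_intros)
  also have "\<dots> = (\<Sum>j<m. if j = i then c i else 0)"
    using assms by (intro sum.cong) (auto simp: orthonormal_def)
  also have "\<dots> = (if i < m then c i else 0)" by (simp add: sum.delta)
  finally show ?thesis .
qed

lemma continuous_on_expansion: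
  "orthonormal n e \<Longrightarrow> m \<le> n \<Longrightarrow> continuous_on UNIV (\<lambda>x. \<Sum>j<m. c j * e j x)"
  by (auto simp: orthonormal_def intro!: continuous_intros)

lemma bessel:
  assumes e: "orthonormal n e" and f: "continuous_on UNIV f"
  shows "(\<Sum>i<n. (cmod (ip f (e i)))\<^sup>2) \<le> nsq f"
proof -
  have *: "nsq (\<lambda>x. f x - (\<Sum>i<m. ip f (e i) * e i x)) = nsq f - (\<Sum>i<m. (cmod (ip f (e i)))\<^sup>2)"
    if "m \<le> n" for m
    using that
  proof (induction m)
    case (Suc m)
    have em: "continuous_on UNIV (e m)" and em1: "nsq (e m) = 1"
      using e Suc.prems ip_self[of "e m"] by (auto simp: orthonormal_def)
    let ?s = "\<lambda>x. \<Sum>i<m. ip f (e i) * e i x"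
    have s: "continuous_on UNIV ?s" using continuous_on_expansion[OF e] Suc.prems by simp
    have "nsq (\<lambda>x. f x - (\<Sum>i<Suc m. ip f (e i) * e i x)) = nsq (\<lambda>x. (f x - ?s x) - ip f (e m) * e m x)"
      by (simp add: diff_diff_eq)
    also have "\<dots> = nsq (\<lambda>x. f x - ?s x) - 2 * Re (cnj (ip f (e m)) * ip (\<lambda>x. f x - ?s x) (e m))
        + (cmod (ip f (e m)))\<^sup>2 * nsq (e m)"
      by (intro nsq_diff_cmult continuous_intros f s em)
    also have "ip (\<lambda>x. f x - ?s x) (e m) = ip f (e m)"
      using ip_diff_left[OF f s em] ip_expansion[OF e, of m m] Suc.prems by simp
    also have "Re (cnj (ip f (e m)) * ip f (e m)) = (cmod (ip f (e m)))\<^sup>2"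
      unfolding cmod_power2 by (simp add: power2_eq_square)
    finally show ?case using Suc by (simp add: em1)
  qed simp
  have "0 \<le> nsq (\<lambda>x. f x - (\<Sum>i<n. ip f (e i) * e i x))"
    by (intro nsq_nonneg continuous_on_diff f continuous_on_expansion[OF e]) simp
  then show ?thesis using *[of n] by simp
qed

text \<open>The bound gives an orthonormal system in \<open>E\<close> of maximal length; a non-zero
  remainder of some f, once normalised, would extend it. Closure under f - c g covers both the
  subtraction of projections and scaling, since d r = r - (1 - d) r.\<close>

lemma orthonormal_basis_exists:
  assumes cont: "\<And>f. f \<in> E \<Longrightarrow> continuous_on UNIV f"
    and lin: "\<And>f g c. f \<in> E \<Longrightarrow> g \<in> E \<Longrightarrow> (\<lambda>x. f x - c * g x) \<in> E"
    and bound: "\<And>n e. orthonormal n e \<Longrightarrow> (\<And>i. i < n \<Longrightarrow> e i \<in> E) \<Longrightarrow> n \<le> N"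
  obtains n e where "orthonormal n e" "\<And>i. i < n \<Longrightarrow> e i \<in> E"
    "\<And>f x. f \<in> E \<Longrightarrow> f x = (\<Sum>i<n. ip f (e i) * e i x)"
proof -
  define P where "P n \<longleftrightarrow> (\<exists>e. orthonormal n e \<and> (\<forall>i<n. e i \<in> E))" for n
  have "P 0" by (simp add: P_def orthonormal_def)
  moreover have "\<And>n. P n \<Longrightarrow> n \<le> N" using bound unfolding P_def by blast
  ultimately obtain n where n: "P n" "\<And>m. P m \<Longrightarrow> m \<le> n"
    using GreatestI_nat[of P 0 N] Greatest_le_nat[of P _ N] by blast
  then obtain e where e: "orthonormal n e" "\<And>i. i < n \<Longrightarrow> e i \<in> E" by (auto simp: P_def)
  have "f x = (\<Sum>i<n. ip f (e i) * e i x)" if fE: "f \<in> E" for f x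
  proof -
    let ?r = "\<lambda>x. f x - (\<Sum>i<n. ip f (e i) * e i x)"
    have f: "continuous_on UNIV f" using cont fE .
    have rm: "(\<lambda>x. f x - (\<Sum>i<m. ip f (e i) * e i x)) \<in> E" if "m \<le> n" for m
      using that
    proof (induction m)
      case (Suc m)
      then show ?case using lin[OF Suc.IH e(2)[of m], of "ip f (e m)"] by (simp add: diff_diff_eq)
    qed (use fE in simp)
    have rE: "?r \<in> E" by (rule rm) simp
    have r: "continuous_on UNIV ?r" using cont[OF rE] .
    have orth: "ip ?r (e i) = 0" if "i < n" for i
      using that ip_diff_left[OF f continuous_on_expansion[OF e(1)], of n "e i"] ip_expansion[OF e(1), of n i] e
      by (simp add: orthonormal_def)
    have "nsq ?r = 0"
    proof (rule ccontr)
      assume "nsq ?r \<noteq> 0"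
      then have pos: "nsq ?r > 0" using nsq_nonneg[OF r] by simp
      define d where "d = complex_of_real (1 / sqrt (nsq ?r))"
      define e' where "e' = e(n := (\<lambda>x. d * ?r x))"
      have drE: "(\<lambda>x. d * ?r x) \<in> E"
        using lin[OF rE rE, of "1 - d"] by (simp add: left_diff_distrib)
      have "ip (\<lambda>x. d * ?r x) (\<lambda>x. d * ?r x) = d * cnj (d * ip ?r ?r)"
        using r cont[OF drE] ip_cmult_left[OF r cont[OF drE], of d] ip_commute[OF cont[OF drE] r]
          ip_cmult_left[OF r r, of d] by simp
      also have "\<dots> = of_real (1 / sqrt (nsq ?r) * (1 / sqrt (nsq ?r)) * nsq ?r)"
        by (simp only: ip_self d_def complex_cnj_mult complex_cnj_complex_of_real of_real_mult mult.assoc)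
      also have "\<dots> = 1" using pos by simp
      finally have 1: "ip (\<lambda>x. d * ?r x) (\<lambda>x. d * ?r x) = 1" .
      have 2: "ip (\<lambda>x. d * ?r x) (e i) = 0" "ip (e i) (\<lambda>x. d * ?r x) = 0" if "i < n" for i
        using that orth[OF that] ip_cmult_left[OF r, of "e i" d] e(1) ip_commute[OF cont[OF drE], of "e i"]
        by (auto simp: orthonormal_def)
      have "orthonormal (Suc n) e'"
        using e cont[OF drE] 1 2 unfolding orthonormal_def e'_def less_Suc_eq by auto
      moreover have "\<forall>i<Suc n. e' i \<in> E" using e(2) drE by (auto simp: e'_def less_Suc_eq)
      ultimately have "Suc n \<le> n" using n(2) unfolding P_def by blast
      then show False by simp
    qed
    then have "?r x = 0" by (rule nsq_eq_0[OF r])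
    then show ?thesis by simp
  qed
  with e show thesis by (rule that)
qed

end

section \<open>Representative functions\<close>

interpretation fs: vector_space "\<lambda>c (f :: 'x \<Rightarrow> complex) x. c * f x"
  by unfold_locales (auto simp: fun_eq_iff algebra_simps)

lemma fs_sum_apply: "(\<Sum>i\<in>I. (\<lambda>x. c i * f i x)) = (\<lambda>x. \<Sum>i\<in>I. c i * f i (x :: 'x) :: complex)"
  by (simp add: fun_eq_iff sum_fun_apply)

lemma fs_span_lincomb:
  assumes "\<And>i. i \<in> I \<Longrightarrow> f i \<in> B"
  shows "(\<lambda>x. \<Sum>i\<in>I. c i * f i x) \<in> fs.span (B :: ('x \<Rightarrow> complex) set)"
  unfolding fs_sum_apply[symmetric]
  by (intro fs.span_sum fs.span_scale fs.span_base assms)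

lemma representative_functions_subspace:
  "fs.subspace (representative_functions :: ('h::topological_group_add \<Rightarrow> complex) set)"
  unfolding representative_functions_def by (rule fs.subspace_span)

lemma rep_coefficient:
  "group_unitary_rep n u \<Longrightarrow> i < n \<Longrightarrow> j < n \<Longrightarrow> u i j \<in> representative_functions"
  unfolding representative_functions_def by (rule fs.span_base) blast

lemma rep_add: "f \<in> representative_functions \<Longrightarrow> g \<in> representative_functions \<Longrightarrow> (\<lambda>x. f x + g x) \<in> representative_functions"
  using fs.subspace_add[OF representative_functions_subspace, of f g] by (simp add: plus_fun_def)

lemma rep_cmult: "f \<in> representative_functions \<Longrightarrow> (\<lambda>x. c * f x) \<in> representative_functions"
  by (rule fs.subspace_scale[OF representative_functions_subspace])

lemma rep_diff: "f \<in> representative_functions \<Longrightarrow> g \<in> representative_functions \<Longrightarrow> (\<lambda>x. f x - g x) \<in> representative_functions"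
  using fs.subspace_diff[OF representative_functions_subspace, of f g] by (simp add: fun_diff_def)

lemma rep_const: "(\<lambda>x. c) \<in> representative_functions"
proof -
  have "group_unitary_rep 1 (\<lambda>i j x. 1)" by (simp add: group_unitary_rep_def)
  then have "(\<lambda>i j x. 1) 0 0 \<in> representative_functions" by (rule rep_coefficient) simp_all
  then show ?thesis using rep_cmult[of "\<lambda>x. 1" c] by simp
qed

lemma rep_sum: "(\<And>i. i \<in> I \<Longrightarrow> f i \<in> representative_functions) \<Longrightarrow> (\<lambda>x. \<Sum>i\<in>I. f i x) \<in> representative_functions"
proof (induction I rule: infinite_finite_induct)
  case (insert i I)
  then show ?case using rep_add[of "f i" "\<lambda>x. \<Sum>i\<in>I. f i x"] by simp
qed (simp_all add: rep_const)

lemma rep_continuous: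
  assumes "f \<in> representative_functions"
  shows "continuous_on UNIV f"
  using assms unfolding representative_functions_def
proof (induction rule: fs.span_induct)
  case base
  show ?case
    by (rule fs.subspaceI) (auto simp: plus_fun_def zero_fun_def intro!: continuous_intros)
next
  case (step f)
  then show ?case by (auto simp: group_unitary_rep_def)
qed

text \<open>The coproduct of \<open>f\<close> as a finite sum of tensors. It places all translates
  of \<open>f\<close> in a finite-dimensional space and lets means and states act on one variable at
  a time.\<close>

lemma rep_expansion:
  fixes f :: "'h::topological_group_add \<Rightarrow> complex"
  assumes "f \<in> representative_functions"
  obtains n :: nat and a b where
    "\<And>i. i < n \<Longrightarrow> a i \<in> representative_functions" "\<And>i. i < n \<Longrightarrow> b i \<in> representative_functions"
    "\<And>x y. f (x + y) = (\<Sum>i<n. a i x * b i y)"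
proof -
  have "\<exists>ps. set ps \<subseteq> representative_functions \<times> representative_functions \<and>
      (\<forall>x y. f (x + y) = (\<Sum>p\<leftarrow>ps. fst p x * snd p y))"
    using assms unfolding representative_functions_def
  proof (induction rule: fs.span_induct_alt)
    case base
    show ?case by (rule exI[of _ "[]"]) simp
  next
    case (step c f g)
    then obtain u n i j where u: "group_unitary_rep n u" "i < n" "j < n" "f = u i j" by auto
    from step.IH obtain ps where ps:
      "set ps \<subseteq> representative_functions \<times> representative_functions"
      "\<And>x y. g (x + y) = (\<Sum>p\<leftarrow>ps. fst p x * snd p y)"
      unfolding representative_functions_def by blast
    have "f (x + y) = (\<Sum>k<n. u i k x * u k j y)" for x y
      using u unfolding group_unitary_rep_def by blast
    then have "c * f (x + y) = (\<Sum>p\<leftarrow>map (\<lambda>k. ((\<lambda>x. c * u i k x), u k j)) [0..<n]. fst p x * snd p y)" for x y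
      by (simp add: comp_def sum_distrib_left mult.assoc interv_sum_list_conv_sum_set_nat atLeast0LessThan)
    moreover have "set (map (\<lambda>k. ((\<lambda>x. c * u i k x), u k j)) [0..<n]) \<subseteq> representative_functions \<times> representative_functions"
      using u by (auto intro!: rep_cmult rep_coefficient)
    ultimately show ?case
      using ps unfolding representative_functions_def[symmetric]
      by (intro exI[of _ "map (\<lambda>k. ((\<lambda>x. c * u i k x), u k j)) [0..<n] @ ps"]) simp
  qed
  then obtain ps where ps: "set ps \<subseteq> representative_functions \<times> representative_functions"
    "\<And>x y. f (x + y) = (\<Sum>p\<leftarrow>ps. fst p x * snd p y)" by blast
  show thesis
  proof (rule that[of "length ps" "\<lambda>i. fst (ps ! i)" "\<lambda>i. snd (ps ! i)"])
    fix i assume "i < length ps"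
    then have "ps ! i \<in> representative_functions \<times> representative_functions"
      using ps(1) nth_mem by blast
    then show "fst (ps ! i) \<in> representative_functions" "snd (ps ! i) \<in> representative_functions"
      by (auto simp: mem_Times_iff)
  next
    fix x y
    show "f (x + y) = (\<Sum>i<length ps. fst (ps ! i) x * snd (ps ! i) y)"
      unfolding ps(2) by (simp add: sum_list_sum_nth atLeast0LessThan)
  qed
qed

section \<open>Closure properties of the representative functions\<close>

context compact_group
begin

lemma orthonormal_le_card:
  assumes e: "orthonormal n e" and "\<And>i. i < n \<Longrightarrow> e i \<in> fs.span B" "finite B"
  shows "n \<le> card B"
proof -
  have inj: "inj_on e {..<n}"
  proof (rule inj_onI)
    fix i j assume ij: "i \<in> {..<n}" "j \<in> {..<n}" "e i = e j"
    have o: "ip (e i) (e j) = (if i = j then 1 else 0)" if "i < n" "j < n" for i j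
      using e that unfolding orthonormal_def by blast
    show "i = j"
      using o[of i i] o[of i j] ij by (auto split: if_splits)
  qed
  have "fs.independent (e ` {..<n})"
  proof (rule fs.independent_if_scalars_zero)
    fix c w assume 0: "(\<Sum>x\<in>e ` {..<n}. (\<lambda>y. c x * x y)) = 0" and "w \<in> e ` {..<n}"
    then obtain j where j: "w = e j" "j < n" by auto
    have "(\<lambda>y. \<Sum>i<n. c (e i) * e i y) = (\<lambda>y. 0)"
      using 0 by (simp add: sum.reindex[OF inj] fun_eq_iff sum_fun_apply)
    then have "ip (\<lambda>y. \<Sum>i<n. c (e i) * e i y) (e j) = 0"
      by (simp add: ip_def cmean_const)
    then show "c w = 0"
      using ip_expansion[OF e, of n j "\<lambda>i. c (e i)"] j by simp
  qed simp
  moreover have "e ` {..<n} \<subseteq> fs.span B" using assms(2) by auto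
  ultimately have "card (e ` {..<n}) \<le> card B"
    using fs.independent_span_bound[OF \<open>finite B\<close>] by blast
  then show ?thesis by (simp add: card_image[OF inj])
qed

lemma continuous_on_translate:
  fixes f :: "'h \<Rightarrow> 'b::topological_space"
  assumes "continuous_on UNIV f"
  shows "continuous_on UNIV (\<lambda>x. f (x + g))" "continuous_on UNIV (\<lambda>x. f (g + x))"
  by (auto intro!: continuous_on_compose2[OF assms] continuous_on_add continuous_on_id continuous_on_const)

text \<open>
  Translations act unitarily for the inner product given by the Haar mean, so an orthonormal basis
  of a translation invariant space turns them into a unitary representation.
\<close>

lemma translation_invariant_representative:
  fixes E :: "('h \<Rightarrow> complex) set"
  assumes cont: "\<And>f. f \<in> E \<Longrightarrow> continuous_on UNIV f"
    and lin: "\<And>f g c. f \<in> E \<Longrightarrow> g \<in> E \<Longrightarrow> (\<lambda>x. f x - c * g x) \<in> E"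
    and trans: "\<And>f g. f \<in> E \<Longrightarrow> (\<lambda>x. f (x + g)) \<in> E"
    and bound: "\<And>n e. orthonormal n e \<Longrightarrow> (\<And>i. i < n \<Longrightarrow> e i \<in> E) \<Longrightarrow> n \<le> N"
    and "f \<in> E"
  shows "f \<in> representative_functions"
proof -
  obtain n e where e: "orthonormal n e" "\<And>i. i < n \<Longrightarrow> e i \<in> E"
    and ex: "\<And>f x. f \<in> E \<Longrightarrow> f x = (\<Sum>i<n. ip f (e i) * e i x)"
    by (rule orthonormal_basis_exists[of E N])
      ((erule cont) | (erule (1) lin) | (rule bound; assumption) | (rule that; assumption))+
  \<comment> \<open>Column j holds the coordinates of the right translate of \<open>e j\<close> by
    g. With this index order the matrices multiply in the order of the group.\<close>
  define u where "u i j g = ip (\<lambda>x. e j (x + g)) (e i)" for i j g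
  have ec: "continuous_on UNIV (e i)" if "i < n" for i using e that by (simp add: orthonormal_def)
  have ecg: "continuous_on UNIV (\<lambda>x. e i (x + g))" if "i < n" for i g
    by (rule continuous_on_translate[OF ec[OF that]])
  have u_ex: "e j (x + g) = (\<Sum>i<n. u i j g * e i x)" if "j < n" for j x g
    unfolding u_def by (rule ex[OF trans[OF e(2)[OF that]]])
  have mult: "u i j (g + h) = (\<Sum>k<n. u i k g * u k j h)" if "i < n" "j < n" for i j g h
  proof -
    have "(\<lambda>x. e j (x + (g + h))) = (\<lambda>x. \<Sum>k<n. u k j h * e k (x + g))"
      using u_ex[OF that(2)] by (simp flip: add.assoc)
    then have "u i j (g + h) = ip (\<lambda>x. \<Sum>k<n. u k j h * e k (x + g)) (e i)"
      by (simp add: u_def)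
    also have "\<dots> = (\<Sum>k<n. u k j h * u i k g)"
      unfolding u_def[of i _ g] using that ec ecg
      by (subst ip_sum_left) (auto intro!: continuous_intros simp: ip_cmult_left)
    finally show ?thesis by (simp add: mult.commute)
  qed
  have inv: "u i j (- g) = cnj (u j i g)" if "i < n" "j < n" for i j g
  proof -
    have "u i j (- g) = cmean UNIV (\<lambda>x. e j (x + - g) * cnj (e i x))"
      by (simp add: u_def ip_def)
    also have "\<dots> = cmean UNIV (\<lambda>x. e j (x + g + - g) * cnj (e i (x + g)))"
      using cmean_right_translate[OF continuous_on_ip_arg[OF ecg[OF that(2), of "- g"] ec[OF that(1)]], of g]
      by simp
    also have "\<dots> = ip (e j) (\<lambda>x. e i (x + g))" by (simp add: ip_def add.assoc)
    also have "\<dots> = cnj (u j i g)" unfolding u_def by (rule ip_commute[OF ecg[OF that(1)] ec[OF that(2)]])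
    finally show ?thesis .
  qed
  have unit: "u i j 0 = (if i = j then 1 else 0)" if "i < n" "j < n" for i j
    using e that by (auto simp: u_def orthonormal_def)
  have rep: "group_unitary_rep n u"
    unfolding group_unitary_rep_def
  proof (intro allI impI conjI)
    fix i j g assume ij: "i < n" "j < n"
    show "(\<Sum>k<n. u i k g * cnj (u j k g)) = (if i = j then 1 else 0)"
      using mult[OF ij, of g "- g"] unit[OF ij] inv ij by simp
    show "(\<Sum>k<n. cnj (u k i g) * u k j g) = (if i = j then 1 else 0)"
      using mult[OF ij, of "- g" g] unit[OF ij] inv ij by simp
    have "continuous_on UNIV (\<lambda>(g, x). e j (x + g) * cnj (e i x))"
      unfolding case_prod_beta
      by (intro continuous_on_mult continuous_on_cnj continuous_on_compose2[OF ec[OF ij(2)]]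
          continuous_on_compose2[OF ec[OF ij(1)]]) (auto intro!: continuous_intros)
    then show "continuous_on UNIV (u i j)"
      unfolding u_def ip_def by (rule continuous_on_cmean)
  qed (rule mult)
  have er: "e j \<in> representative_functions" if "j < n" for j
  proof -
    \<comment> \<open>The expansion of the translate of \<open>e j\<close> by g, evaluated at 0,
      recovers \<open>e j\<close> from matrix coefficients.\<close>
    have "e j = (\<lambda>g. \<Sum>i<n. e i 0 * u i j g)"
      using u_ex[OF that, of 0] by (simp add: fun_eq_iff mult.commute)
    also have "\<dots> \<in> representative_functions"
      using rep_coefficient[OF rep] that by (intro rep_sum rep_cmult) auto
    finally show ?thesis .
  qed
  have "f = (\<lambda>x. \<Sum>i<n. ip f (e i) * e i x)" using ex[OF \<open>f \<in> E\<close>] by auto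
  also have "\<dots> \<in> representative_functions"
    using er by (intro rep_sum rep_cmult) auto
  finally show ?thesis .
qed

text \<open>The span of \<open>B\<close> need not be translation invariant, but the span of the
  right translates of \<open>f\<close> is, and it inherits the dimension bound. This converse to
  \<open>rep_expansion\<close> takes the place of tensor products and conjugates of representations
  in the closure proofs that follow.\<close>

lemma representative_if_translates_in_span:
  fixes f :: "'h \<Rightarrow> complex"
  assumes f: "continuous_on UNIV f" and B: "finite B" "\<And>g. (\<lambda>x. f (x + g)) \<in> fs.span B"
  shows "f \<in> representative_functions"
proof (rule translation_invariant_representative)
  let ?E = "fs.span (range (\<lambda>g x. f (x + g)))"
  have EB: "?E \<subseteq> fs.span B" using B(2) by (intro fs.span_minimal) auto
  show "f \<in> ?E" by (rule fs.span_base) (auto intro: range_eqI[of _ _ 0])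
  show "continuous_on UNIV h" if "h \<in> ?E" for h
    using that
  proof (induction rule: fs.span_induct)
    case base
    show ?case by (rule fs.subspaceI) (auto simp: plus_fun_def zero_fun_def intro!: continuous_intros)
  qed (auto intro: continuous_on_translate[OF f])
  show "(\<lambda>x. h x - c * k x) \<in> ?E" if "h \<in> ?E" "k \<in> ?E" for h k c
    using fs.span_diff[OF that(1) fs.span_scale[OF that(2), of c]] by (simp add: fun_diff_def)
  show "(\<lambda>x. h (x + g)) \<in> ?E" if "h \<in> ?E" for h g
    using that
  proof (induction rule: fs.span_induct)
    case base
    show ?case
    proof (rule fs.subspaceI)
      show "0 \<in> {h. (\<lambda>x. h (x + g)) \<in> ?E}" using fs.span_zero by (simp add: zero_fun_def)
    qed (use fs.span_add fs.span_scale in \<open>fastforce simp: plus_fun_def\<close>)+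
  next
    case (step h)
    then obtain g' where "h = (\<lambda>x. f (x + g'))" by auto
    then have "(\<lambda>x. h (x + g)) = (\<lambda>x. f (x + (g + g')))" by (simp add: add.assoc)
    then show ?case by (auto intro: fs.span_base)
  qed
  show "n \<le> card B" if "orthonormal n e" "\<And>i. i < n \<Longrightarrow> e i \<in> ?E" for n e
    using orthonormal_le_card[OF that(1) _ B(1)] that(2) EB by blast
qed

lemma rep_mult:
  fixes f :: "'h \<Rightarrow> complex"
  assumes f: "f \<in> representative_functions" and f': "f' \<in> representative_functions"
  shows "(\<lambda>x. f x * f' x) \<in> representative_functions"
proof -
  obtain n :: nat and a b where ab: "\<And>x y. f (x + y) = (\<Sum>i<n. a i x * b i y)"
    using rep_expansion[OF f] by metis
  obtain n' :: nat and a' b' where ab': "\<And>x y. f' (x + y) = (\<Sum>i<n'. a' i x * b' i y)"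
    using rep_expansion[OF f'] by metis
  show ?thesis
  proof (rule representative_if_translates_in_span)
    show "continuous_on UNIV (\<lambda>x. f x * f' x)" by (intro continuous_intros rep_continuous f f')
    show "finite ((\<lambda>(i, j) x. a i x * a' j x) ` ({..<n} \<times> {..<n'}))" by simp
    fix g
    have "(\<lambda>x. f (x + g) * f' (x + g)) =
        (\<lambda>x. \<Sum>(i, j)\<in>{..<n} \<times> {..<n'}. (b i g * b' j g) * (a i x * a' j x))"
      unfolding ab ab' sum_product sum.cartesian_product by (auto intro!: sum.cong simp: fun_eq_iff)
    also have "\<dots> \<in> fs.span ((\<lambda>(i, j) x. a i x * a' j x) ` ({..<n} \<times> {..<n'}))"
      unfolding case_prod_beta
      by (rule fs_span_lincomb[where f = "\<lambda>p x. a (fst p) x * a' (snd p) x"]) auto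
    finally show "(\<lambda>x. f (x + g) * f' (x + g)) \<in> fs.span ((\<lambda>(i, j) x. a i x * a' j x) ` ({..<n} \<times> {..<n'}))" .
  qed
qed

lemma rep_cnj:
  fixes f :: "'h \<Rightarrow> complex"
  assumes f: "f \<in> representative_functions"
  shows "(\<lambda>x. cnj (f x)) \<in> representative_functions"
proof -
  obtain n :: nat and a b where ab: "\<And>x y. f (x + y) = (\<Sum>i<n. a i x * b i y)"
    using rep_expansion[OF f] by metis
  show ?thesis
  proof (rule representative_if_translates_in_span)
    show "continuous_on UNIV (\<lambda>x. cnj (f x))" by (intro continuous_intros rep_continuous f)
    show "finite ((\<lambda>i x. cnj (a i x)) ` {..<n})" by simp
    show "(\<lambda>x. cnj (f (x + g))) \<in> fs.span ((\<lambda>i x. cnj (a i x)) ` {..<n})" for g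
      using fs_span_lincomb[where f = "\<lambda>i x. cnj (a i x)" and I = "{..<n}" and c = "\<lambda>i. cnj (b i g)"
          and B = "(\<lambda>i x. cnj (a i x)) ` {..<n}"]
      by (simp add: ab mult.commute)
  qed
qed

lemma rep_power:
  fixes f :: "'h \<Rightarrow> complex"
  shows "f \<in> representative_functions \<Longrightarrow> (\<lambda>x. f x ^ k) \<in> representative_functions"
proof (induction k)
  case (Suc k)
  then show ?case using rep_mult[OF Suc.prems Suc.IH] by simp
qed (simp add: rep_const)

lemma rep_left_translate:
  fixes f :: "'h \<Rightarrow> complex"
  assumes f: "f \<in> representative_functions"
  shows "(\<lambda>x. f (g + x)) \<in> representative_functions"
proof -
  obtain n :: nat and a b where "\<And>i. i < n \<Longrightarrow> b i \<in> representative_functions"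
    "\<And>x y. f (x + y) = (\<Sum>i<n. a i x * b i y)"
    using rep_expansion[OF f] by metis
  then show ?thesis by (auto intro!: rep_sum rep_cmult)
qed

lemma rep_right_translate:
  fixes f :: "'h \<Rightarrow> complex"
  assumes f: "f \<in> representative_functions"
  shows "(\<lambda>x. f (x + g)) \<in> representative_functions"
proof -
  obtain n :: nat and a b where "\<And>i. i < n \<Longrightarrow> a i \<in> representative_functions"
    "\<And>x y. f (x + y) = (\<Sum>i<n. a i x * b i y)"
    using rep_expansion[OF f] by metis
  then show ?thesis by (auto intro!: rep_sum rep_mult rep_const)
qed

end

context matched_pair
begin

sublocale G: compact_group
  by unfold_locales (simp_all add: compact_group)

text \<open>By \<open>\<alpha>_matched\<close> a translate involves
  \<open>\<alpha> (\<beta> x \<gamma>) g\<close>, and \<open>\<beta> x \<gamma>\<close> runs through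
  a finite orbit. The translates therefore lie in the span of the functions a_i o \<alpha>_\<gamma>,
  each cut down to one of the finitely many fibres of x \<mapsto> \<beta>_x(\<gamma>).\<close>

lemma rep_\<alpha>:
  assumes f: "f \<in> representative_functions"
  shows "(\<lambda>x. f (\<alpha> \<gamma> x)) \<in> representative_functions"
proof -
  obtain n :: nat and a b where ab: "\<And>x y. f (x + y) = (\<Sum>i<n. a i x * b i y)"
    using rep_expansion[OF f] by metis
  define S where "S = range (\<lambda>x. \<beta> x \<gamma>)"
  have S: "finite S" unfolding S_def by (rule finite_\<beta>_orbit)
  define e where "e p x = a (fst p) (\<alpha> \<gamma> x) * (if \<beta> x \<gamma> = snd p then 1 else 0)" for p x
  show ?thesis
  proof (rule G.representative_if_translates_in_span)
    show "continuous_on UNIV (\<lambda>x. f (\<alpha> \<gamma> x))"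
      by (rule continuous_on_compose2[OF rep_continuous[OF f] \<alpha>_continuous]) simp
    show "finite (e ` ({..<n} \<times> S))" using S by simp
    fix g
    have "f (\<alpha> \<gamma> (x + g)) = (\<Sum>p\<in>{..<n} \<times> S. b (fst p) (\<alpha> (snd p) g) * e p x)" for x
    proof -
      have "f (\<alpha> \<gamma> (x + g)) = (\<Sum>i<n. a i (\<alpha> \<gamma> x) * b i (\<alpha> (\<beta> x \<gamma>) g))"
        by (simp add: \<alpha>_matched ab)
      also have "\<dots> = (\<Sum>i<n. \<Sum>s\<in>S. if \<beta> x \<gamma> = s then a i (\<alpha> \<gamma> x) * b i (\<alpha> s g) else 0)"
        using S by (simp add: sum.delta' S_def)
      also have "\<dots> = (\<Sum>i<n. \<Sum>s\<in>S. b i (\<alpha> s g) * e (i, s) x)"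
        by (intro sum.cong) (auto simp: e_def)
      finally show ?thesis by (simp add: sum.cartesian_product case_prod_beta)
    qed
    then show "(\<lambda>x. f (\<alpha> \<gamma> (x + g))) \<in> fs.span (e ` ({..<n} \<times> S))"
      by (simp add: fs_span_lincomb)
  qed
qed

end

section \<open>The Peter-Weyl theorem\<close>

lemma totally_bounded_Cauchy_subsequence:
  fixes s :: "nat \<Rightarrow> 'a::metric_space"
  assumes "\<And>e. e > 0 \<Longrightarrow> \<exists>N. finite N \<and> (\<forall>n. \<exists>m\<in>N. dist (s m) (s n) < e)"
  obtains r where "strict_mono r" "Cauchy (s \<circ> r)"
proof -
  have "Met_TC.mtotally_bounded (range s)"
    unfolding Met_TC.mtotally_bounded_def
  proof (intro allI impI)
    fix e :: real assume "e > 0"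
    then obtain N where N: "finite N" "\<forall>n. \<exists>m\<in>N. dist (s m) (s n) < e" using assms by blast
    have "finite (s ` N) \<and> s ` N \<subseteq> range s \<and> range s \<subseteq> (\<Union>x\<in>s ` N. Met_TC.mball x e)"
      using N by auto
    then show "\<exists>K. finite K \<and> K \<subseteq> range s \<and> range s \<subseteq> (\<Union>x\<in>K. Met_TC.mball x e)" by blast
  qed
  then have "\<exists>r. strict_mono r \<and> Met_TC.MCauchy (s \<circ> r)"
    unfolding Met_TC.mtotally_bounded_sequentially by blast
  then show thesis using that by auto
qed

text \<open>Arzela-Ascoli on a space without a metric, with equicontinuity phrased by finite nets.
  Values on the net \<open>X\<close> are rounded to a finite set \<open>Y\<close>; functions with
  the same rounding differ by at most 4 d < e, and there are finitely many roundings.\<close>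

lemma ascoli_subsequence:
  fixes f :: "nat \<Rightarrow> 'a::topological_space \<Rightarrow> complex"
  assumes cont: "\<And>n. continuous_on UNIV (f n)" and bound: "\<And>n x. cmod (f n x) \<le> R"
    and equi: "\<And>e. e > 0 \<Longrightarrow> \<exists>X. finite X \<and> (\<forall>x. \<exists>x0\<in>X. \<forall>n. dist (f n x) (f n x0) \<le> e)"
  obtains r w where "strict_mono r" "continuous_on UNIV w" "uniform_limit UNIV (\<lambda>n. f (r n)) w sequentially"
proof -
  have bc: "f n \<in> bcontfun" for n
    unfolding bcontfun_def using cont bound by (auto simp: bounded_iff)
  have app: "apply_bcontfun (Bcontfun (f n)) = f n" for n using Bcontfun_inverse[OF bc] .
  obtain r where r: "strict_mono r" and l: "Cauchy ((\<lambda>n. Bcontfun (f n)) \<circ> r)"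
  proof (rule totally_bounded_Cauchy_subsequence[of "\<lambda>n. Bcontfun (f n)"])
    fix e :: real assume "e > 0"
    define d where "d = e / 5"
    have "d > 0" using \<open>e > 0\<close> by (simp add: d_def)
    obtain X where X: "finite X" "\<And>x. \<exists>x0\<in>X. \<forall>n. dist (f n x) (f n x0) \<le> d"
      using equi[OF \<open>d > 0\<close>] by auto
    obtain Y where Y: "finite Y" "cball (0 :: complex) R \<subseteq> (\<Union>y\<in>Y. ball y d)"
      using compact_cball[of "0 :: complex" R] \<open>d > 0\<close> unfolding compact_eq_totally_bounded by blast
    have "\<exists>y\<in>Y. dist (f n x) y < d" for n x
    proof -
      have "f n x \<in> cball 0 R" using bound by simp
      then have "f n x \<in> (\<Union>y\<in>Y. ball y d)" using Y(2) by blast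
      then show ?thesis by (auto simp: dist_commute)
    qed
    then have "\<exists>\<phi>. \<forall>n x. \<phi> n x \<in> Y \<and> dist (f n x) (\<phi> n x) < d" by metis
    then obtain \<phi> where \<phi>: "\<And>n x. \<phi> n x \<in> Y" "\<And>n x. dist (f n x) (\<phi> n x) < d" by blast
    have "finite (X \<rightarrow>\<^sub>E Y)" using X(1) Y(1) by (simp add: finite_PiE)
    then have "finite (range (\<lambda>n. restrict (\<phi> n) X))"
      by (rule finite_subset[rotated]) (use \<phi>(1) in auto)
    then obtain N where N: "finite N" "range (\<lambda>n. restrict (\<phi> n) X) = (\<lambda>n. restrict (\<phi> n) X) ` N"
      using finite_subset_image[of "range (\<lambda>n. restrict (\<phi> n) X)" "\<lambda>n. restrict (\<phi> n) X" UNIV] by blast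
    have "\<exists>m\<in>N. dist (Bcontfun (f m)) (Bcontfun (f n)) < e" for n
    proof -
      obtain m where m: "m \<in> N" "restrict (\<phi> n) X = restrict (\<phi> m) X" using N(2) by blast
      have "dist (Bcontfun (f m)) (Bcontfun (f n)) \<le> 4 * d"
      proof (rule dist_bound)
        fix x
        obtain x0 where x0: "x0 \<in> X" "\<And>n. dist (f n x) (f n x0) \<le> d" using X(2) by blast
        have eq: "\<phi> n x0 = \<phi> m x0" using m(2) x0(1) by (metis restrict_apply')
        have "dist (f m x) (f n x) \<le> dist (f m x) (f m x0) + dist (f m x0) (f n x)"
          by (rule dist_triangle)
        also have "dist (f m x0) (f n x) \<le> dist (f m x0) (f n x0) + dist (f n x0) (f n x)"
          by (rule dist_triangle)
        also have "dist (f m x0) (f n x0) \<le> dist (f m x0) (\<phi> m x0) + dist (\<phi> m x0) (f n x0)"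
          by (rule dist_triangle)
        finally show "dist (apply_bcontfun (Bcontfun (f m)) x) (apply_bcontfun (Bcontfun (f n)) x) \<le> 4 * d"
          unfolding app using x0(2)[of m] x0(2)[of n] \<phi>(2)[of m x0] \<phi>(2)[of n x0] eq
          by (simp add: dist_commute)
      qed
      then show ?thesis using m(1) \<open>e > 0\<close> by (intro bexI[of _ m]) (simp_all add: d_def)
    qed
    then show "\<exists>N. finite N \<and> (\<forall>n. \<exists>m\<in>N. dist (Bcontfun (f m)) (Bcontfun (f n)) < e)"
      using N(1) by blast
  qed
  have "uniformly_Cauchy_on UNIV (\<lambda>n. f (r n))"
    unfolding uniformly_Cauchy_on_def
  proof (intro allI impI)
    fix e :: real assume "e > 0"
    then obtain M where M: "\<And>m n. m \<ge> M \<Longrightarrow> n \<ge> M \<Longrightarrow> dist (Bcontfun (f (r m))) (Bcontfun (f (r n))) < e"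
      using l unfolding Cauchy_def o_def by blast
    have "dist (f (r m) x) (f (r n) x) < e" if "m \<ge> M" "n \<ge> M" for m n x
      using dist_fun_lt_imp_dist_val_lt[OF M[OF that], of x] by (simp add: app)
    then show "\<exists>M. \<forall>x\<in>UNIV. \<forall>m\<ge>M. \<forall>n\<ge>M. dist (f (r m) x) (f (r n) x) < e" by blast
  qed
  then obtain w where w: "uniform_limit UNIV (\<lambda>n. f (r n)) w sequentially"
    using Cauchy_uniformly_convergent uniformly_convergent_on_def by metis
  moreover have "continuous_on UNIV w"
    by (rule uniform_limit_theorem[OF _ w]) (use cont in auto)
  ultimately show thesis using that r by blast
qed

section \<open>Self-adjoint compact integral operators and their eigenfunctions\<close>

context compact_group
begin

definition intop :: "('h \<Rightarrow> 'h \<Rightarrow> real) \<Rightarrow> ('h \<Rightarrow> complex) \<Rightarrow> 'h \<Rightarrow> complex" where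
  "intop k f x = cmean UNIV (\<lambda>y. of_real (k x y) * f y)"

definition sym_kernel :: "('h \<Rightarrow> 'h \<Rightarrow> real) \<Rightarrow> bool" where
  "sym_kernel k \<longleftrightarrow> continuous_on UNIV (\<lambda>(x, y). k x y) \<and> (\<forall>x y. k x y = k y x)"

lemma continuous_on_kernel_mult:
  assumes k: "sym_kernel k" and f: "continuous_on UNIV f"
  shows "continuous_on UNIV (\<lambda>(x, y). of_real (k x y) * f y :: complex)"
    and "continuous_on UNIV (\<lambda>y. of_real (k x y) * f y)"
    and "continuous_on UNIV (\<lambda>y. complex_of_real (k x y))"
proof -
  have k2: "continuous_on UNIV (\<lambda>(x, y). k x y)" using k by (simp add: sym_kernel_def)
  note kx = continuous_on_curry(1)[OF this, of x]
  have fs: "continuous_on UNIV (\<lambda>p :: 'h \<times> 'h. f (snd p))"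
    by (rule continuous_on_compose2[OF f]) (auto intro!: continuous_intros)
  show "continuous_on UNIV (\<lambda>(x, y). of_real (k x y) * f y :: complex)"
    unfolding case_prod_beta
    by (rule continuous_on_mult[OF continuous_on_of_real[OF k2[unfolded case_prod_beta]] fs])
  show "continuous_on UNIV (\<lambda>y. of_real (k x y) * f y)" "continuous_on UNIV (\<lambda>y. complex_of_real (k x y))"
    using kx f by (auto intro!: continuous_intros)
qed

lemma continuous_on_intop:
  "sym_kernel k \<Longrightarrow> continuous_on UNIV f \<Longrightarrow> continuous_on UNIV (intop k f)"
  unfolding intop_def[abs_def] by (intro continuous_on_cmean continuous_on_kernel_mult(1))

lemma intop_diff_cmult:
  assumes "sym_kernel k" "continuous_on UNIV f" "continuous_on UNIV g"
  shows "intop k (\<lambda>x. f x - c * g x) x = intop k f x - c * intop k g x"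
proof -
  have c: "continuous_on UNIV (\<lambda>y. c * (of_real (k x y) * g y))"
    by (intro continuous_on_mult_left continuous_on_kernel_mult(2) assms)
  have "intop k (\<lambda>x. f x - c * g x) x = cmean UNIV (\<lambda>y. of_real (k x y) * f y - c * (of_real (k x y) * g y))"
    by (simp add: intop_def algebra_simps)
  also have "\<dots> = intop k f x - c * intop k g x"
    unfolding intop_def cmean_diff[OF continuous_on_kernel_mult(2)[OF assms(1,2)] c]
      cmean_cmult[OF continuous_on_kernel_mult(2)[OF assms(1,3)]] ..
  finally show ?thesis .
qed

lemma intop_cmult:
  assumes "sym_kernel k" "continuous_on UNIV f"
  shows "intop k (\<lambda>x. c * f x) x = c * intop k f x"
  using cmean_cmult[OF continuous_on_kernel_mult(2)[OF assms], of c x]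
  by (simp add: intop_def mult.left_commute)

lemma intop_self_adjoint:
  assumes k: "sym_kernel k" and f: "continuous_on UNIV f" and g: "continuous_on UNIV g"
  shows "ip (intop k f) g = ip f (intop k g)"
proof -
  have c: "continuous_on UNIV (\<lambda>(x, y). cnj (g x) * (of_real (k x y) * f y))"
    unfolding case_prod_beta
    by (intro continuous_on_mult[OF _ continuous_on_kernel_mult(1)[OF k f, unfolded case_prod_beta]]
        continuous_on_cnj continuous_on_compose2[OF g]) (auto intro!: continuous_intros)
  have "ip (intop k f) g = cmean UNIV (\<lambda>x. cmean UNIV (\<lambda>y. cnj (g x) * (of_real (k x y) * f y)))"
    unfolding ip_def intop_def cmean_cmult[OF continuous_on_kernel_mult(2)[OF k f]]
    by (simp add: mult.commute)
  also have "\<dots> = cmean UNIV (\<lambda>y. cmean UNIV (\<lambda>x. cnj (g x) * (of_real (k x y) * f y)))"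
    by (rule cmean_fubini[OF c])
  also have "\<dots> = cmean UNIV (\<lambda>y. f y * cnj (intop k g y))"
  proof (rule arg_cong[of _ _ "cmean UNIV"], rule ext)
    fix y
    note kg = continuous_on_kernel_mult(2)[OF k g, of y]
    have "f y * cnj (intop k g y) = cmean UNIV (\<lambda>x. f y * cnj (of_real (k y x) * g x))"
      unfolding intop_def cmean_cnj[OF kg, symmetric]
      by (rule cmean_cmult[symmetric]) (rule continuous_on_cnj[OF kg])
    moreover have "k y x = k x y" for x using k by (simp add: sym_kernel_def)
    ultimately show "cmean UNIV (\<lambda>x. cnj (g x) * (of_real (k x y) * f y)) = f y * cnj (intop k g y)"
      by (simp add: mult_ac)
  qed
  finally show ?thesis by (simp add: ip_def)
qed

lemma intop_eq_ip: "intop k f x = ip f (\<lambda>y. of_real (k x y))"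
  by (simp add: intop_def ip_def mult.commute)

lemma kernel_nsq_bound:
  assumes k: "sym_kernel k"
  obtains K where "K > 0" "\<And>x. nsq (\<lambda>y. of_real (k x y)) \<le> K"
proof -
  have k2: "continuous_on UNIV (\<lambda>(x, y). k x y)" using k by (simp add: sym_kernel_def)
  then have "continuous_on UNIV (\<lambda>(x, y). (cmod (of_real (k x y)))\<^sup>2)"
    unfolding case_prod_beta by (intro continuous_intros)
  then have "continuous_on UNIV (\<lambda>x. nsq (\<lambda>y. of_real (k x y)))"
    unfolding nsq_def by (rule continuous_on_mean)
  from bounded_continuous[OF this] obtain K where K: "K > 0" "\<And>x. norm (nsq (\<lambda>y. of_real (k x y))) \<le> K"
    by metis
  have "nsq (\<lambda>y. of_real (k x y)) \<le> K" for x using K(2)[of x] by simp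
  then show thesis using that K(1) by blast
qed

lemma intop_bound:
  assumes k: "sym_kernel k" and f: "continuous_on UNIV f" and K: "K > 0" "\<And>x. nsq (\<lambda>y. of_real (k x y)) \<le> K"
  shows "(cmod (intop k f x))\<^sup>2 \<le> K * nsq f" "nsq (intop k f) \<le> K * nsq f"
proof -
  have *: "(cmod (intop k f x))\<^sup>2 \<le> K * nsq f" for x
  proof -
    have "(cmod (intop k f x))\<^sup>2 \<le> nsq f * nsq (\<lambda>y. of_real (k x y))"
      unfolding intop_eq_ip by (intro ip_cauchy_schwarz f continuous_on_kernel_mult(3)[OF k f])
    also have "\<dots> \<le> nsq f * K" by (intro mult_left_mono K nsq_nonneg f)
    finally show ?thesis by (simp add: mult.commute)
  qed
  then show "(cmod (intop k f x))\<^sup>2 \<le> K * nsq f" .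
  have "cmod (intop k f x) \<le> sqrt (K * nsq f)" for x
    using * real_le_rsqrt by blast
  then have "nsq (intop k f) \<le> (sqrt (K * nsq f))\<^sup>2"
    by (intro nsq_le continuous_on_intop k f)
  also have "\<dots> = K * nsq f" using K nsq_nonneg[OF f] by simp
  finally show "nsq (intop k f) \<le> K * nsq f" .
qed

text \<open>By Cauchy-Schwarz, \<open>nsq (f n) \<le> 1\<close> bounds the values of
  \<open>intop k (f n)\<close> and their variation in x through the kernel alone, uniformly in n.
  The limit is uniform, hence again continuous, although the continuous functions are in general not
  complete for \<open>nsq\<close>.\<close>

lemma intop_compact:
  fixes f :: "nat \<Rightarrow> 'h \<Rightarrow> complex"
  assumes k: "sym_kernel k" and f: "\<And>n. continuous_on UNIV (f n)" "\<And>n. nsq (f n) \<le> 1"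
  obtains r w where "strict_mono r" "continuous_on UNIV w"
    "uniform_limit UNIV (\<lambda>n. intop k (f (r n))) w sequentially"
proof -
  obtain K where K: "K > 0" "\<And>x. nsq (\<lambda>y. of_real (k x y)) \<le> K" using kernel_nsq_bound[OF k] by metis
  have k2: "continuous_on UNIV (\<lambda>(x, y). k x y)" using k by (simp add: sym_kernel_def)
  show thesis
  proof (rule ascoli_subsequence[of "\<lambda>n. intop k (f n)" "sqrt K"])
    show "continuous_on UNIV (intop k (f n))" for n by (intro continuous_on_intop k f)
    show "cmod (intop k (f n) x) \<le> sqrt K" for n x
    proof (rule real_le_rsqrt)
      have "(cmod (intop k (f n) x))\<^sup>2 \<le> K * nsq (f n)" by (rule intop_bound[OF k f(1) K])
      also have "\<dots> \<le> K * 1" by (intro mult_left_mono f) (use K in simp)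
      finally show "(cmod (intop k (f n) x))\<^sup>2 \<le> K" by simp
    qed
    fix e :: real assume "e > 0"
    obtain X where X: "finite X" "\<And>x. \<exists>x0\<in>X. \<forall>y. dist (k x y) (k x0 y) \<le> e"
      using jointly_continuous_net[OF k2 compact_UNIV compact_UNIV \<open>e > 0\<close>, of UNIV] by auto
    have "dist (intop k (f n) x) (intop k (f n) x0) \<le> e" if "\<forall>y. dist (k x y) (k x0 y) \<le> e" for n x x0
    proof -
      note c = continuous_on_kernel_mult(3)[OF k f(1)]
      let ?d = "\<lambda>y. complex_of_real (k x y) - of_real (k x0 y)"
      have d: "continuous_on UNIV ?d" by (intro continuous_on_diff c)
      have "intop k (f n) x - intop k (f n) x0 = cmean UNIV (\<lambda>y. of_real (k x y) * f n y - of_real (k x0 y) * f n y)"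
        unfolding intop_def by (rule cmean_diff[symmetric]) (rule continuous_on_kernel_mult(2)[OF k f(1)])+
      also have "\<dots> = ip (f n) ?d" by (simp add: ip_def algebra_simps)
      finally have "(cmod (intop k (f n) x - intop k (f n) x0))\<^sup>2 \<le> nsq (f n) * nsq ?d"
        using ip_cauchy_schwarz[OF f(1) d] by simp
      also have "\<dots> \<le> 1 * e\<^sup>2"
      proof (intro mult_mono f nsq_le d nsq_nonneg)
        show "cmod (?d y) \<le> e" for y
          using that[rule_format, of y] by (simp add: dist_real_def flip: of_real_diff)
      qed simp_all
      finally have "(dist (intop k (f n) x) (intop k (f n) x0))\<^sup>2 \<le> e\<^sup>2" by (simp only: dist_norm mult_1)
      then show ?thesis using \<open>e > 0\<close> by (rule power2_le_imp_le[OF _ less_imp_le])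
    qed
    then show "\<exists>X. finite X \<and> (\<forall>x. \<exists>x0\<in>X. \<forall>n. dist (intop k (f n) x) (intop k (f n) x0) \<le> e)"
      using X by meson
  qed (rule that)
qed

lemma nsq_cmult:
  assumes "continuous_on UNIV f"
  shows "nsq (\<lambda>x. c * f x) = (cmod c)\<^sup>2 * nsq f"
  unfolding nsq_def norm_mult power_mult_distrib
  by (rule mean_cmult) (intro continuous_intros assms)

lemma uniform_limit_nsq:
  assumes "uniform_limit UNIV v w sequentially" "\<And>n. continuous_on UNIV (v n)" "continuous_on UNIV w"
  shows "(\<lambda>n. nsq (\<lambda>x. v n x - w x)) \<longlonglongrightarrow> 0"
proof (rule LIMSEQ_I)
  fix e :: real assume "e > 0"
  then have "sqrt (e / 2) > 0" by simp
  from uniform_limitD[OF assms(1) this]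
  obtain N where N: "\<And>n x. n \<ge> N \<Longrightarrow> dist (v n x) (w x) < sqrt (e / 2)"
    unfolding eventually_sequentially by auto
  have "norm (nsq (\<lambda>x. v n x - w x) - 0) < e" if "n \<ge> N" for n
  proof -
    have c: "continuous_on UNIV (\<lambda>x. v n x - w x)" by (intro continuous_intros assms)
    have "nsq (\<lambda>x. v n x - w x) \<le> (sqrt (e / 2))\<^sup>2"
      by (rule nsq_le[OF c]) (use N[OF that] in \<open>simp add: dist_norm less_imp_le\<close>)
    then show ?thesis using nsq_nonneg[OF c] \<open>e > 0\<close> by simp
  qed
  then show "\<exists>N. \<forall>n\<ge>N. norm (nsq (\<lambda>x. v n x - w x) - 0) < e" by blast
qed

text \<open>The orthogonal complement of the eigenvectors of the squared operator. The square is
  positive, so the extremal argument produces an eigenvalue without a choice of sign.\<close>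

definition eigen_complement :: "('h \<Rightarrow> 'h \<Rightarrow> real) \<Rightarrow> ('h \<Rightarrow> complex) set" where
  "eigen_complement k = {f. continuous_on UNIV f \<and>
     (\<forall>w c. continuous_on UNIV w \<longrightarrow> c \<noteq> 0 \<longrightarrow> intop k (intop k w) = (\<lambda>x. c * w x) \<longrightarrow> ip f w = 0)}"

text \<open>The operator commutes with its square, so it maps eigenvectors of the square to
  eigenvectors for the same c (or to 0); self-adjointness carries this over to the
  complement.\<close>

lemma eigen_complement_intop:
  assumes k: "sym_kernel k" and f: "f \<in> eigen_complement k"
  shows "intop k f \<in> eigen_complement k"
  unfolding eigen_complement_def
proof (intro CollectI conjI allI impI)
  have fc: "continuous_on UNIV f" using f by (simp add: eigen_complement_def)
  show "continuous_on UNIV (intop k f)" by (intro continuous_on_intop k fc)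
  fix w and c :: complex
  assume w: "continuous_on UNIV w" "c \<noteq> 0" "intop k (intop k w) = (\<lambda>x. c * w x)"
  have "intop k (intop k (intop k w)) = (\<lambda>x. c * intop k w x)"
    unfolding w(3) using intop_cmult[OF k w(1)] by auto
  then have "ip f (intop k w) = 0"
    using f w(2) continuous_on_intop[OF k w(1)] unfolding eigen_complement_def by blast
  then show "ip (intop k f) w = 0" by (simp add: intop_self_adjoint[OF k fc w(1)])
qed

text \<open>
  Otherwise the squared operator, restricted to the complement, attains its norm at an eigenvector
  that lies in the complement and is therefore orthogonal to itself.
\<close>

lemma intop_eigen_complement_eq_0:
  assumes k: "sym_kernel k" and f0: "f0 \<in> eigen_complement k"
  shows "intop k f0 x = 0"
proof (rule ccontr)
  assume nz: "intop k f0 x \<noteq> 0"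
  obtain K where K: "K > 0" "\<And>x. nsq (\<lambda>y. of_real (k x y)) \<le> K" using kernel_nsq_bound[OF k] by metis
  let ?E = "eigen_complement k"
  have Ec: "continuous_on UNIV f" if "f \<in> ?E" for f using that by (simp add: eigen_complement_def)
  note Tc = continuous_on_intop[OF k]
  have Ecm: "(\<lambda>x. c * f x) \<in> ?E" if "f \<in> ?E" for f c
    using that by (auto simp: eigen_complement_def ip_cmult_left intro!: continuous_intros)
  define S where "S = {nsq (intop k f) | f. f \<in> ?E \<and> nsq f = 1}"
  define \<mu> where "\<mu> = Sup S"
  have "s \<le> K" if s: "s \<in> S" for s
  proof -
    obtain f where f: "s = nsq (intop k f)" "f \<in> ?E" "nsq f = 1" using s unfolding S_def by blast
    show ?thesis using intop_bound(2)[OF k Ec[OF f(2)] K] f by simp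
  qed
  then have bdd: "bdd_above S" by (auto simp: bdd_above_def)
  have upper: "nsq (intop k f) \<le> \<mu> * nsq f" if f: "f \<in> ?E" for f
  proof (cases "nsq f = 0")
    case True
    then show ?thesis using intop_bound(2)[OF k Ec[OF f] K] by simp
  next
    case False
    then have pos: "nsq f > 0" using nsq_nonneg[OF Ec[OF f]] by simp
    define c where "c = complex_of_real (1 / sqrt (nsq f))"
    have c: "(cmod c)\<^sup>2 = 1 / nsq f" using pos by (simp add: c_def power_divide norm_divide)
    have "nsq (\<lambda>x. c * f x) = 1" using pos by (simp add: nsq_cmult[OF Ec[OF f]] c)
    then have "nsq (intop k (\<lambda>x. c * f x)) \<in> S" unfolding S_def using Ecm[OF f, of c] by blast
    then have "nsq (intop k (\<lambda>x. c * f x)) \<le> \<mu>" unfolding \<mu>_def using bdd by (rule cSup_upper)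
    moreover have "nsq (intop k (\<lambda>x. c * f x)) = nsq (intop k f) / nsq f"
    proof -
      have "intop k (\<lambda>x. c * f x) = (\<lambda>x. c * intop k f x)"
        by (rule ext) (rule intop_cmult[OF k Ec[OF f]])
      then show ?thesis using nsq_cmult[OF Tc[OF Ec[OF f]], of c] by (simp add: c)
    qed
    ultimately show ?thesis using pos by (simp add: field_simps)
  qed
  have "nsq (intop k f0) \<noteq> 0" using nsq_eq_0[OF Tc[OF Ec[OF f0]]] nz by blast
  then have T0: "nsq (intop k f0) > 0" using nsq_nonneg[OF Tc[OF Ec[OF f0]]] by simp
  then have \<mu>: "\<mu> > 0" using upper[OF f0] nsq_nonneg[OF Ec[OF f0]]
    by (metis mult_nonpos_nonneg not_le order.trans)
  have "S \<noteq> {}"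
  proof
    assume "S = {}"
    define c where "c = complex_of_real (1 / sqrt (nsq f0))"
    have "nsq f0 > 0"
      using T0 upper[OF f0] \<mu> nsq_nonneg[OF Ec[OF f0]] by (metis less_le mult_zero_right not_le)
    then have "nsq (\<lambda>x. c * f0 x) = 1"
      unfolding nsq_cmult[OF Ec[OF f0]] by (simp add: c_def power_divide norm_divide)
    then show False using \<open>S = {}\<close> Ecm[OF f0, of c] unfolding S_def by blast
  qed
  have "\<exists>f. f \<in> ?E \<and> nsq f = 1 \<and> nsq (intop k f) > \<mu> - 1 / real (Suc n)" for n
  proof -
    have "\<mu> - 1 / real (Suc n) < Sup S" by (simp add: \<mu>_def)
    then obtain s where "s \<in> S" "\<mu> - 1 / real (Suc n) < s"
      using less_cSup_iff[OF \<open>S \<noteq> {}\<close> bdd] by blast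
    then show ?thesis unfolding S_def by blast
  qed
  then obtain f where f: "\<And>n. f n \<in> ?E" "\<And>n. nsq (f n) = 1"
    "\<And>n. nsq (intop k (f n)) > \<mu> - 1 / real (Suc n)" by metis
  obtain r w where r: "strict_mono r" and w: "continuous_on UNIV w"
    and lim: "uniform_limit UNIV (\<lambda>n. intop k (f (r n))) w sequentially"
    by (rule intop_compact[OF k Ec[OF f(1)] eq_refl[OF f(2)]])
  define v where "v n = intop k (f (r n))" for n
  define a where "a n = nsq (v n)" for n
  have vE: "v n \<in> ?E" for n unfolding v_def by (intro eigen_complement_intop k f)
  note vc = Ec[OF vE] and fc = Ec[OF f(1)]
  have limv: "uniform_limit UNIV v w sequentially" using lim by (simp add: v_def[abs_def])
  have a_le: "a n \<le> \<mu>" for n using upper[OF f(1), of "r n"] f(2) by (simp add: a_def v_def)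
  have a_ge: "a n \<ge> \<mu> - 1 / real (Suc n)" for n
  proof -
    have "n \<le> r n" using r by (rule seq_suble)
    then have "1 / real (Suc (r n)) \<le> 1 / real (Suc n)" by (intro divide_left_mono) auto
    then show ?thesis using f(3)[of "r n"] by (simp add: a_def v_def)
  qed
  have a_lim: "a \<longlonglongrightarrow> \<mu>"
  proof (rule tendsto_sandwich)
    show "(\<lambda>n. \<mu> - 1 / real (Suc n)) \<longlonglongrightarrow> \<mu>"
      using tendsto_diff[OF tendsto_const LIMSEQ_inverse_real_of_nat, of \<mu>] by (simp add: inverse_eq_divide)
  qed (use a_le a_ge in auto)
  \<comment> \<open>The defect of \<open>f (r n)\<close> as an eigenvector for \<open>\<mu>\<close>.
    Expanding its square, the term \<open>nsq (intop k (v n))\<close> is at most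
    \<open>\<mu> * a n\<close> because \<open>v n\<close> lies in the complement again, which leaves
    \<open>\<mu> * (\<mu> - a n)\<close>, and this tends to 0.\<close>
  define d where "d n = (\<lambda>x. intop k (v n) x - of_real \<mu> * f (r n) x)" for n
  have dc: "continuous_on UNIV (d n)" for n unfolding d_def by (intro continuous_intros Tc vc fc)
  have d_le: "nsq (d n) \<le> \<mu> * (\<mu> - a n)" for n
  proof -
    have "ip (intop k (v n)) (f (r n)) = of_real (a n)"
      unfolding intop_self_adjoint[OF k vc fc] a_def by (simp add: ip_self flip: v_def)
    then have "nsq (d n) = nsq (intop k (v n)) - 2 * (\<mu> * a n) + \<mu>\<^sup>2"
      unfolding d_def nsq_diff_cmult[OF Tc[OF vc] fc] using \<mu> f(2) by simp
    also have "nsq (intop k (v n)) \<le> \<mu> * a n" unfolding a_def by (rule upper[OF vE])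
    finally show ?thesis by (simp add: algebra_simps power2_eq_square)
  qed
  have d_lim: "(\<lambda>n. nsq (d n)) \<longlonglongrightarrow> 0"
  proof (rule tendsto_sandwich[OF _ _ tendsto_const])
    show "(\<lambda>n. \<mu> * (\<mu> - a n)) \<longlonglongrightarrow> 0"
      using tendsto_mult_left[OF tendsto_diff[OF tendsto_const a_lim], of \<mu> \<mu>] by simp
  qed (use d_le nsq_nonneg[OF dc] in auto)
  have T_lim: "(\<lambda>n. intop k (u n) x) \<longlonglongrightarrow> 0" if "\<And>n. continuous_on UNIV (u n)" "(\<lambda>n. nsq (u n)) \<longlonglongrightarrow> 0" for u x
  proof -
    have "(\<lambda>n. (cmod (intop k (u n) x))\<^sup>2) \<longlonglongrightarrow> 0"
    proof (rule tendsto_sandwich[OF _ _ tendsto_const])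
      show "(\<lambda>n. K * nsq (u n)) \<longlonglongrightarrow> 0" using tendsto_mult_left[OF that(2), of K] by simp
    qed (use intop_bound(1)[OF k that(1) K] in auto)
    then have "(\<lambda>n. sqrt ((cmod (intop k (u n) x))\<^sup>2)) \<longlonglongrightarrow> sqrt 0" by (rule tendsto_real_sqrt)
    then show ?thesis by (simp add: tendsto_norm_zero_iff)
  qed
  have vw: "(\<lambda>n. nsq (\<lambda>x. v n x - w x)) \<longlonglongrightarrow> 0" by (rule uniform_limit_nsq[OF limv vc w])
  have vwc: "continuous_on UNIV (\<lambda>x. v n x - w x)" for n by (intro continuous_intros vc w)
  have eig: "intop k (intop k w) x = of_real \<mu> * w x" for x
  proof -
    have T1: "(\<lambda>n. nsq (intop k (\<lambda>x. v n x - w x))) \<longlonglongrightarrow> 0"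
    proof (rule tendsto_sandwich[OF _ _ tendsto_const])
      show "(\<lambda>n. K * nsq (\<lambda>x. v n x - w x)) \<longlonglongrightarrow> 0" using tendsto_mult_left[OF vw, of K] by simp
    qed (use intop_bound(2)[OF k vwc K] nsq_nonneg[OF Tc[OF vwc]] in auto)
    have "intop k (intop k (\<lambda>x. v n x - w x)) x = intop k (intop k (v n)) x - intop k (intop k w) x" for n
    proof -
      have "intop k (\<lambda>x. v n x - w x) = (\<lambda>x. intop k (v n) x - intop k w x)"
        using intop_diff_cmult[OF k vc w, of n 1] by (intro ext) simp
      then show ?thesis using intop_diff_cmult[OF k Tc[OF vc] Tc[OF w], of n 1 x] by simp
    qed
    then have l1: "(\<lambda>n. intop k (intop k (v n)) x - intop k (intop k w) x) \<longlonglongrightarrow> 0"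
      using T_lim[OF Tc[OF vwc] T1, of x] by simp
    have "intop k (d n) x = intop k (intop k (v n)) x - of_real \<mu> * v n x" for n
      unfolding d_def intop_diff_cmult[OF k Tc[OF vc] fc] by (simp add: v_def)
    then have l2: "(\<lambda>n. intop k (intop k (v n)) x - of_real \<mu> * v n x) \<longlonglongrightarrow> 0"
      using T_lim[OF dc d_lim, of x] by simp
    have "(\<lambda>n. v n x) \<longlonglongrightarrow> w x" using tendsto_uniform_limitI[OF limv, of x] by simp
    then have l3: "(\<lambda>n. of_real \<mu> * v n x) \<longlonglongrightarrow> of_real \<mu> * w x" by (rule tendsto_mult_left)
    \<comment> \<open>The sequence is constant, equal to \<open>intop k (intop k w) x\<close>; the
      three limits identify this constant.\<close>
    have "(\<lambda>n. (intop k (intop k (v n)) x - of_real \<mu> * v n x) + of_real \<mu> * v n x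
        - (intop k (intop k (v n)) x - intop k (intop k w) x)) \<longlonglongrightarrow> 0 + of_real \<mu> * w x - 0"
      by (intro tendsto_add tendsto_diff l1 l2 l3)
    then show ?thesis by (simp add: LIMSEQ_const_iff)
  qed
  \<comment> \<open>The eigenvector \<open>w\<close> is orthogonal to every \<open>v n\<close>, and
    \<open>v n\<close> tends to \<open>w\<close>, so \<open>w\<close> vanishes. Then
    \<open>a\<close> tends to 0 and not to \<open>\<mu>\<close>.\<close>
  have "ip (v n) w = 0" for n
  proof -
    have "intop k (intop k w) = (\<lambda>x. of_real \<mu> * w x)" using eig by auto
    moreover have "complex_of_real \<mu> \<noteq> 0" using \<mu> by simp
    ultimately show ?thesis using vE[of n] w unfolding eigen_complement_def by blast
  qed
  then have "ip (\<lambda>x. v n x - w x) w = - of_real (nsq w)" for n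
    by (simp add: ip_diff_left[OF vc w w] ip_self)
  then have "(nsq w)\<^sup>2 \<le> nsq (\<lambda>x. v n x - w x) * nsq w" for n
    using ip_cauchy_schwarz[OF vwc w, of n] by simp
  moreover have "(\<lambda>n. nsq (\<lambda>x. v n x - w x) * nsq w) \<longlonglongrightarrow> 0"
    using tendsto_mult_right[OF vw, of "nsq w"] by simp
  ultimately have "(nsq w)\<^sup>2 \<le> 0" by (intro LIMSEQ_le_const) auto
  then have "w = (\<lambda>x. 0)" using nsq_eq_0[OF w] by auto
  then have "a \<longlonglongrightarrow> 0" using vw by (simp add: a_def[abs_def])
  then show False using LIMSEQ_unique[OF a_lim] \<mu> by simp
qed

lemma mean_sum:
  fixes f :: "'i \<Rightarrow> 'h \<Rightarrow> real"
  assumes "\<And>i. i \<in> I \<Longrightarrow> continuous_on UNIV (f i)"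
  shows "mean UNIV (\<lambda>x. \<Sum>i\<in>I. f i x) = (\<Sum>i\<in>I. mean UNIV (f i))"
  using assms
proof (induction I rule: infinite_finite_induct)
  case (insert i I)
  have "continuous_on UNIV (\<lambda>x. \<Sum>i\<in>I. f i x)" using insert.prems by (intro continuous_on_sum) auto
  then show ?case using insert by (simp add: mean_add)
qed (simp_all add: mean_const)

lemma intop_translate:
  assumes k: "sym_kernel k" and inv: "\<And>g x y. k (x + g) (y + g) = k x y" and f: "continuous_on UNIV f"
  shows "intop k (\<lambda>x. f (x + g)) x = intop k f (x + g)"
  using cmean_right_translate[OF continuous_on_kernel_mult(2)[OF k f], of g "x + g"]
  by (simp add: intop_def inv)

text \<open>Right invariance of the kernel makes the eigenspace translation invariant. For an
  orthonormal system in it, c e_i(x) is up to conjugation the coefficient of T k_x at e_i, where T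
  is the operator and k_x = \<open>k x\<close>. Bessel bounds the sum of their squares by K * K for
  each x, and taking the mean over x gives n |c|^2 <= K * K.\<close>

lemma eigenfunction_representative:
  assumes k: "sym_kernel k" and inv: "\<And>g x y. k (x + g) (y + g) = k x y"
    and w: "continuous_on UNIV w" and c: "c \<noteq> 0" "\<And>x. intop k (intop k w) x = c * w x"
  shows "w \<in> representative_functions"
proof -
  obtain K where K: "K > 0" "\<And>x. nsq (\<lambda>y. of_real (k x y)) \<le> K" using kernel_nsq_bound[OF k] by metis
  define E where "E = {w. continuous_on UNIV w \<and> (\<forall>x. intop k (intop k w) x = c * w x)}"
  have Tc: "continuous_on UNIV (intop k f)" if "continuous_on UNIV f" for f
    using continuous_on_intop[OF k that] .
  show ?thesis
  proof (rule translation_invariant_representative)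
    show "w \<in> E" using w c by (simp add: E_def)
    show "continuous_on UNIV f" if "f \<in> E" for f using that by (simp add: E_def)
    show "(\<lambda>x. f x - d * g x) \<in> E" if "f \<in> E" "g \<in> E" for f g d
    proof -
      have fg: "continuous_on UNIV f" "continuous_on UNIV g" using that by (auto simp: E_def)
      have "intop k (\<lambda>x. f x - d * g x) = (\<lambda>x. intop k f x - d * intop k g x)"
        by (rule ext) (rule intop_diff_cmult[OF k fg])
      then have "intop k (intop k (\<lambda>x. f x - d * g x)) x = c * (f x - d * g x)" for x
        using that by (simp add: intop_diff_cmult[OF k Tc[OF fg(1)] Tc[OF fg(2)]] E_def algebra_simps)
      then show ?thesis using fg by (auto simp: E_def intro!: continuous_intros)
    qed
    show "(\<lambda>x. f (x + g)) \<in> E" if "f \<in> E" for f g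
    proof -
      have f: "continuous_on UNIV f" using that by (auto simp: E_def)
      have "intop k (\<lambda>x. f (x + g)) = (\<lambda>x. intop k f (x + g))"
        by (rule ext) (rule intop_translate[OF k inv f])
      then have "intop k (intop k (\<lambda>x. f (x + g))) x = c * f (x + g)" for x
        using that by (simp add: intop_translate[OF k inv Tc[OF f]] E_def)
      then show ?thesis using continuous_on_translate[OF f] by (auto simp: E_def)
    qed
    show "n \<le> nat \<lfloor>K * K / (cmod c)\<^sup>2\<rfloor>" if e: "orthonormal n e" and eE: "\<And>i. i < n \<Longrightarrow> e i \<in> E" for n e
    proof -
      have ec: "continuous_on UNIV (e i)" if "i < n" for i using eE[OF that] by (simp add: E_def)
      have "(\<Sum>i<n. (cmod (c * e i x))\<^sup>2) \<le> K * K" for x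
      proof -
        let ?k = "\<lambda>y. complex_of_real (k x y)"
        have kc: "continuous_on UNIV ?k" by (rule continuous_on_kernel_mult(3)[OF k w])
        have "cmod (c * e i x) = cmod (ip (intop k ?k) (e i))" if "i < n" for i
        proof -
          have "c * e i x = ip (intop k (e i)) ?k"
            using eE[OF that] intop_eq_ip[of k "intop k (e i)" x] by (simp add: E_def)
          also have "\<dots> = ip (e i) (intop k ?k)" by (rule intop_self_adjoint[OF k ec[OF that] kc])
          also have "\<dots> = cnj (ip (intop k ?k) (e i))" by (rule ip_commute[OF Tc[OF kc] ec[OF that]])
          finally show ?thesis by simp
        qed
        then have "(\<Sum>i<n. (cmod (c * e i x))\<^sup>2) = (\<Sum>i<n. (cmod (ip (intop k ?k) (e i)))\<^sup>2)"
          by (intro sum.cong) auto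
        also have "\<dots> \<le> nsq (intop k ?k)" by (rule bessel[OF e Tc[OF kc]])
        also have "\<dots> \<le> K * nsq ?k" by (rule intop_bound(2)[OF k kc K])
        also have "\<dots> \<le> K * K" using K by (intro mult_left_mono) auto
        finally show ?thesis .
      qed
      moreover have c': "continuous_on UNIV (\<lambda>x. (cmod (c * e i x))\<^sup>2)" if "i < n" for i
        by (intro continuous_intros ec that)
      ultimately have "mean UNIV (\<lambda>x. \<Sum>i<n. (cmod (c * e i x))\<^sup>2) \<le> mean UNIV (\<lambda>x :: 'h. K * K)"
        by (intro mean_mono continuous_on_sum continuous_on_const) auto
      then have "(\<Sum>i<n. nsq (\<lambda>x. c * e i x)) \<le> K * K"
        using mean_sum[of "{..<n}" "\<lambda>i x. (cmod (c * e i x))\<^sup>2"] c' by (simp add: mean_const nsq_def)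
      moreover have "nsq (\<lambda>x. c * e i x) = (cmod c)\<^sup>2" if "i < n" for i
        unfolding nsq_cmult[OF ec[OF that]] using e ip_self[of "e i"] that by (simp add: orthonormal_def)
      ultimately have "real n * (cmod c)\<^sup>2 \<le> K * K" by simp
      then have "real n \<le> K * K / (cmod c)\<^sup>2" using c(1) by (simp add: field_simps)
      then show ?thesis by linarith
    qed
  qed
qed

section \<open>Separation of points and uniform density\<close>

lemma bump_function:
  fixes S :: "'h set"
  assumes "closed S" "x0 \<notin> S"
  obtains \<phi> :: "'h \<Rightarrow> real" where "continuous_on UNIV \<phi>" "\<And>x. 0 \<le> \<phi> x" "\<And>x. \<phi> x \<le> 1"
    "\<And>x. x \<in> S \<Longrightarrow> \<phi> x = 0" "\<phi> x0 = 1"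
proof -
  have "Hausdorff_space (euclidean :: 'h topology)"
    unfolding Hausdorff_space_def disjnt_def using hausdorff by auto
  moreover have "compact_space (euclidean :: 'h topology)"
    using compact_UNIV by (simp add: compact_space_def)
  ultimately have "normal_space (euclidean :: 'h topology)"
    by (simp add: compact_Hausdorff_or_regular_imp_normal_space)
  then obtain \<phi> where \<phi>: "continuous_map euclidean (top_of_set {0..1 :: real}) \<phi>" "\<phi> ` S \<subseteq> {0}" "\<phi> ` {x0} \<subseteq> {1}"
    by (rule Urysohn_lemma[of _ S "{x0}" 0 1]) (use assms in \<open>auto simp: disjnt_def\<close>)
  have "continuous_on UNIV \<phi>" and r: "\<And>x. \<phi> x \<in> {0..1}"
    using \<phi>(1) by (auto simp: continuous_map_in_subtopology image_subset_iff)
  then show thesis using that[of \<phi>] \<phi>(2,3) by auto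
qed

text \<open>If no representative function separates g from 0, then all of them, in particular all
  eigenfunctions of a right invariant kernel, are invariant under translation by g. Hence h minus
  its translate is orthogonal to the eigenfunctions and is killed by the operator, so the image of
  every continuous h takes equal values at 0 and g. A kernel that tells 0 from g contradicts
  this.\<close>

lemma representative_separate_zero:
  fixes g :: 'h
  assumes "g \<noteq> 0"
  shows "\<exists>f\<in>representative_functions. f g \<noteq> f 0"
proof (rule ccontr)
  assume "\<not> ?thesis"
  then have g0: "f g = f 0" if "f \<in> representative_functions" for f using that by auto
  have fix_g: "f (x + g) = f x" if "f \<in> representative_functions" for f x
    using g0[OF rep_left_translate[OF that, of x]] by simp
  obtain \<phi> :: "'h \<Rightarrow> real" where \<phi>: "continuous_on UNIV \<phi>" "\<phi> g = 0" "\<phi> 0 = 1"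
    by (rule bump_function[of "{g}" 0]) (use assms in auto)
  \<comment> \<open>The product is invariant under inversion, which makes the kernel symmetric, and
    it still takes the values 1 at 0 and 0 at g. The difference \<open>y - x\<close> makes the
    kernel right invariant.\<close>
  define k0 where "k0 x = \<phi> x * \<phi> (- x)" for x
  define k where "k x y = k0 (y - x)" for x y
  have k0c: "continuous_on UNIV k0"
    unfolding k0_def by (intro continuous_on_mult \<phi> continuous_on_uminus_arg)
  have k: "sym_kernel k"
    unfolding sym_kernel_def
  proof (intro conjI allI)
    show "continuous_on UNIV (\<lambda>(x, y). k x y)"
      unfolding k_def case_prod_beta
      by (rule continuous_on_compose2[OF k0c]) (auto intro!: continuous_intros)
    show "k x y = k y x" for x y
      by (simp add: k_def k0_def mult.commute)
  qed
  have inv: "k (x + g) (y + g) = k x y" for x y g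
    by (simp add: k_def diff_conv_add_uminus minus_add add.assoc del: add_uminus_conv_diff)
  have T_fix: "intop k h 0 = intop k h g" if h: "continuous_on UNIV h" for h
  proof -
    note hg = continuous_on_translate(1)[OF h, of g]
    have hgc: "continuous_on UNIV (\<lambda>x. h x - h (x + g))" by (intro continuous_on_diff h hg)
    have "(\<lambda>x. h x - h (x + g)) \<in> eigen_complement k"
      unfolding eigen_complement_def
    proof (intro CollectI conjI allI impI hgc)
      fix w and c :: complex
      assume w: "continuous_on UNIV w" "c \<noteq> 0" "intop k (intop k w) = (\<lambda>x. c * w x)"
      have "w \<in> representative_functions"
        by (rule eigenfunction_representative[OF k inv w(1,2)]) (simp add: w(3))
      then have wg: "w (x + g) = w x" for x by (rule fix_g)
      have "ip (\<lambda>x. h (x + g)) w = cmean UNIV (\<lambda>x. h (x + g) * cnj (w (x + g)))"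
        by (simp add: ip_def wg)
      also have "\<dots> = ip h w"
        unfolding ip_def by (rule cmean_right_translate[OF continuous_on_ip_arg[OF h w(1)]]) simp
      finally show "ip (\<lambda>x. h x - h (x + g)) w = 0"
        by (simp add: ip_diff_left[OF h hg w(1)])
    qed
    then have "intop k (\<lambda>x. h x - h (x + g)) 0 = 0" by (rule intop_eigen_complement_eq_0[OF k])
    then have "intop k h 0 = intop k (\<lambda>x. h (x + g)) 0"
      using intop_diff_cmult[OF k h hg, of 1 0] by simp
    then show ?thesis by (simp add: intop_translate[OF k inv h])
  qed
  \<comment> \<open>With this h the squared norm of h is itself the difference of the values of
    \<open>intop k h\<close> at 0 and g.\<close>
  define h where "h y = complex_of_real (k 0 y - k g y)" for y
  have k2: "continuous_on UNIV (\<lambda>(x, y). k x y)" using k by (simp add: sym_kernel_def)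
  have h: "continuous_on UNIV h"
    unfolding h_def by (intro continuous_on_of_real continuous_on_diff continuous_on_curry(1)[OF k2])
  have "of_real (nsq h) = cmean UNIV (\<lambda>y. of_real (k 0 y) * h y - of_real (k g y) * h y)"
    unfolding ip_self[symmetric] ip_def by (simp add: h_def algebra_simps)
  also have "\<dots> = intop k h 0 - intop k h g"
    unfolding intop_def by (rule cmean_diff) (rule continuous_on_kernel_mult(2)[OF k h])+
  also have "\<dots> = 0" using T_fix[OF h] by simp
  finally have "nsq h = 0" by simp
  then have "h g = 0" by (rule nsq_eq_0[OF h])
  then show False using \<phi> by (simp add: h_def k_def k0_def)
qed

lemma representative_separate:
  fixes x y :: 'h
  assumes "x \<noteq> y"
  obtains f where "f \<in> representative_functions" "f x \<noteq> f y"
proof -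
  have "- y + x \<noteq> 0" using assms by (metis add_left_cancel add.right_neutral add_minus_cancel)
  then obtain f where f: "f \<in> representative_functions" "f (- y + x) \<noteq> f 0"
    using representative_separate_zero by blast
  show thesis
    by (rule that[OF rep_left_translate[OF f(1), of "- y"]]) (use f(2) in simp)
qed

text \<open>Stone-Weierstrass for the real-valued representative functions. Closure under
  conjugation provides real and imaginary parts, one of which separates two points whenever the
  complex function does.\<close>

lemma representative_dense:
  fixes \<phi> :: "'h \<Rightarrow> real"
  assumes \<phi>: "continuous_on UNIV \<phi>" and "e > 0"
  obtains f :: "'h \<Rightarrow> real" where "(\<lambda>x. complex_of_real (f x)) \<in> representative_functions"
    "\<And>x. \<bar>\<phi> x - f x\<bar> < e"
proof -
  let ?P = "\<lambda>f :: 'h \<Rightarrow> real. (\<lambda>x. complex_of_real (f x)) \<in> representative_functions"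
  have "\<exists>g. ?P g \<and> (\<forall>x\<in>UNIV. \<bar>\<phi> x - g x\<bar> < e)"
  proof (rule Stone_Weierstrass_HOL[OF compact_UNIV, of ?P])
    show "?P (\<lambda>x. c)" for c by (rule rep_const)
    show "continuous_on UNIV f" if "?P f" for f
      using continuous_on_Re[OF rep_continuous[OF that]] by simp
    show "?P (\<lambda>x. f x + g x)" if "?P f \<and> ?P g" for f g
      using rep_add[of "\<lambda>x. of_real (f x)" "\<lambda>x. of_real (g x)"] that by simp
    show "?P (\<lambda>x. f x * g x)" if "?P f \<and> ?P g" for f g
      using rep_mult[of "\<lambda>x. of_real (f x)" "\<lambda>x. of_real (g x)"] that by simp
    show "\<exists>f. ?P f \<and> f x \<noteq> f y" if xy: "x \<in> UNIV \<and> y \<in> UNIV \<and> x \<noteq> y" for x y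
    proof -
      obtain f where f: "f \<in> representative_functions" "f x \<noteq> f y"
        by (rule representative_separate[of x y]) (use xy in auto)
      have re: "?P (\<lambda>x. Re (f x))" if "f \<in> representative_functions" for f
        using rep_cmult[OF rep_add[OF that rep_cnj[OF that]], of "1/2"] by (simp add: complex_add_cnj)
      show ?thesis
      proof (cases "Re (f x) = Re (f y)")
        case True
        then have "Im (f x) \<noteq> Im (f y)" using f(2) by (simp add: complex_eq_iff)
        moreover have "?P (\<lambda>x. Im (f x))" using re[OF rep_cmult[OF f(1), of "- \<i>"]] by simp
        ultimately show ?thesis by (intro exI[of _ "\<lambda>x. Im (f x)"]) simp
      next
        case False
        then show ?thesis using re[OF f(1)] by (intro exI[of _ "\<lambda>x. Re (f x)"]) simp
      qed
    qed
  qed (use assms in auto)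
  then show thesis using that by blast
qed

end

section \<open>States on the algebra of representative functions\<close>

text \<open>A state in the algebraic sense: positivity refers to the elements f f^*, not to
  functions with non-negative values. The link to the pointwise order is
  \<open>rep_state_positive\<close>.\<close>

definition rep_state :: "(('h::topological_group_add \<Rightarrow> complex) \<Rightarrow> complex) \<Rightarrow> bool" where
  "rep_state \<omega> \<longleftrightarrow>
     (\<forall>f\<in>representative_functions. \<forall>g\<in>representative_functions. \<omega> (\<lambda>x. f x + g x) = \<omega> f + \<omega> g) \<and>
     (\<forall>c. \<forall>f\<in>representative_functions. \<omega> (\<lambda>x. c * f x) = c * \<omega> f) \<and>
     (\<forall>f\<in>representative_functions. 0 \<le> Re (\<omega> (\<lambda>x. f x * cnj (f x)))) \<and>
     \<omega> (\<lambda>x. 1) = 1"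

lemma rep_state_add:
  "rep_state \<omega> \<Longrightarrow> f \<in> representative_functions \<Longrightarrow> g \<in> representative_functions \<Longrightarrow>
    \<omega> (\<lambda>x. f x + g x) = \<omega> f + \<omega> g"
  by (simp add: rep_state_def)

lemma rep_state_cmult:
  "rep_state \<omega> \<Longrightarrow> f \<in> representative_functions \<Longrightarrow> \<omega> (\<lambda>x. c * f x) = c * \<omega> f"
  by (simp add: rep_state_def)

lemma rep_state_nonneg:
  "rep_state \<omega> \<Longrightarrow> f \<in> representative_functions \<Longrightarrow> 0 \<le> Re (\<omega> (\<lambda>x. f x * cnj (f x)))"
  by (simp add: rep_state_def)

lemma rep_state_const:
  assumes "rep_state \<omega>"
  shows "\<omega> (\<lambda>x. c) = c"
proof -
  have "\<omega> (\<lambda>x. c * 1) = c * \<omega> (\<lambda>x. 1)"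
    by (rule rep_state_cmult[OF assms rep_const])
  then show ?thesis using assms by (simp add: rep_state_def)
qed

lemma rep_state_diff:
  assumes \<omega>: "rep_state \<omega>" and f: "f \<in> representative_functions" and g: "g \<in> representative_functions"
  shows "\<omega> (\<lambda>x. f x - g x) = \<omega> f - \<omega> g"
proof -
  have "(\<lambda>x. - 1 * g x) \<in> representative_functions" by (rule rep_cmult[OF g])
  then show ?thesis
    using rep_state_add[OF \<omega> f, of "\<lambda>x. - 1 * g x"] rep_state_cmult[OF \<omega> g, of "- 1"] by simp
qed

lemma rep_state_lincomb:
  assumes \<omega>: "rep_state \<omega>" and "\<And>i. i \<in> I \<Longrightarrow> f i \<in> representative_functions"
  shows "\<omega> (\<lambda>x. \<Sum>i\<in>I. c i * f i x) = (\<Sum>i\<in>I. c i * \<omega> (f i))"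
  using assms(2)
proof (induction I rule: infinite_finite_induct)
  case (insert i I)
  have 1: "(\<lambda>x. c i * f i x) \<in> representative_functions" using insert.prems by (intro rep_cmult) simp
  have 2: "(\<lambda>x. \<Sum>i\<in>I. c i * f i x) \<in> representative_functions"
    using insert.prems by (intro rep_sum rep_cmult) simp
  have "\<omega> (\<lambda>x. c i * f i x + (\<Sum>i\<in>I. c i * f i x)) = \<omega> (\<lambda>x. c i * f i x) + \<omega> (\<lambda>x. \<Sum>i\<in>I. c i * f i x)"
    by (rule rep_state_add[OF \<omega> 1 2])
  also have "\<omega> (\<lambda>x. c i * f i x) = c i * \<omega> (f i)"
    using insert.prems by (intro rep_state_cmult[OF \<omega>]) simp
  finally show ?case using insert by simp
qed (simp_all add: rep_state_const[OF \<omega>])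

text \<open>The variance of \<open>f\<close> under the state is non-negative; t is the
  expectation.\<close>

lemma rep_state_power2:
  fixes f :: "'h::topological_group_add \<Rightarrow> real"
  assumes \<omega>: "rep_state \<omega>" and f: "(\<lambda>x. complex_of_real (f x)) \<in> representative_functions"
    and f2: "(\<lambda>x. complex_of_real ((f x)\<^sup>2)) \<in> representative_functions"
  shows "(Re (\<omega> (\<lambda>x. of_real (f x))))\<^sup>2 \<le> Re (\<omega> (\<lambda>x. of_real ((f x)\<^sup>2)))"
proof -
  define t where "t = Re (\<omega> (\<lambda>x. of_real (f x)))"
  have "(\<lambda>x. complex_of_real (f x) - of_real t) \<in> representative_functions"
    by (intro rep_diff f rep_const)
  then have "0 \<le> Re (\<omega> (\<lambda>x. (complex_of_real (f x) - of_real t) * cnj (complex_of_real (f x) - of_real t)))"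
    by (rule rep_state_nonneg[OF \<omega>])
  also have "(\<lambda>x. (complex_of_real (f x) - of_real t) * cnj (complex_of_real (f x) - of_real t)) =
      (\<lambda>x. (of_real ((f x)\<^sup>2) - of_real (2 * t) * of_real (f x)) - of_real (- t\<^sup>2))"
    by (simp add: power2_eq_square algebra_simps)
  also have "\<omega> \<dots> = \<omega> (\<lambda>x. of_real ((f x)\<^sup>2)) - of_real (2 * t) * \<omega> (\<lambda>x. of_real (f x)) - of_real (- t\<^sup>2)"
  proof -
    have 1: "(\<lambda>x. of_real (2 * t) * complex_of_real (f x)) \<in> representative_functions"
      by (rule rep_cmult[OF f])
    show ?thesis
      by (simp only: rep_state_diff[OF \<omega> rep_diff[OF f2 1] rep_const] rep_state_diff[OF \<omega> f2 1]
          rep_state_const[OF \<omega>] rep_state_cmult[OF \<omega> f])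
  qed
  finally show ?thesis by (simp add: t_def power2_eq_square)
qed

context compact_group
begin

text \<open>The convolution of a state with the Haar mean is the Haar mean. In the expansion of f (x
  + g) the state acts on x and the mean on g; taking the mean first gives a constant function of x
  by left invariance.\<close>

lemma rep_state_translates:
  assumes \<omega>: "rep_state \<omega>" and f: "(f :: 'h \<Rightarrow> complex) \<in> representative_functions"
  shows "continuous_on UNIV (\<lambda>g. \<omega> (\<lambda>x. f (x + g)))"
    and "cmean UNIV (\<lambda>g. \<omega> (\<lambda>x. f (x + g))) = cmean UNIV f"
proof -
  obtain n :: nat and a b where ab: "\<And>i. i < n \<Longrightarrow> a i \<in> representative_functions"
      "\<And>i. i < n \<Longrightarrow> b i \<in> representative_functions"
    and ex: "\<And>x y. f (x + y) = (\<Sum>i<n. a i x * b i y)"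
    using rep_expansion[OF f] by metis
  have bc: "continuous_on UNIV (b i)" if "i < n" for i using ab(2)[OF that] by (rule rep_continuous)
  have eq: "\<omega> (\<lambda>x. f (x + g)) = (\<Sum>i<n. \<omega> (a i) * b i g)" for g
    using rep_state_lincomb[OF \<omega>, of "{..<n}" a "\<lambda>i. b i g"] ab(1) by (simp add: ex mult.commute)
  show "continuous_on UNIV (\<lambda>g. \<omega> (\<lambda>x. f (x + g)))"
    unfolding eq by (intro continuous_on_sum continuous_on_mult_left bc) simp
  have "cmean UNIV (\<lambda>g. \<omega> (\<lambda>x. f (x + g))) = (\<Sum>i<n. \<omega> (a i) * cmean UNIV (b i))"
    unfolding eq using bc by (subst cmean_sum) (auto intro!: continuous_on_mult_left cmean_cmult sum.cong)
  also have "\<dots> = \<omega> (\<lambda>x. \<Sum>i<n. cmean UNIV (b i) * a i x)"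
    using rep_state_lincomb[OF \<omega>, of "{..<n}" a "\<lambda>i. cmean UNIV (b i)"] ab(1) by (simp add: mult.commute)
  also have "(\<lambda>x. \<Sum>i<n. cmean UNIV (b i) * a i x) = (\<lambda>x. cmean UNIV f)"
  proof
    fix x
    have "cmean UNIV f = cmean UNIV (\<lambda>g. f (x + g))"
      by (rule cmean_left_translate[symmetric, OF rep_continuous[OF f]]) simp
    also have "\<dots> = (\<Sum>i<n. a i x * cmean UNIV (b i))"
      unfolding ex using bc by (subst cmean_sum) (auto intro!: continuous_on_mult_left cmean_cmult sum.cong)
    finally show "(\<Sum>i<n. cmean UNIV (b i) * a i x) = cmean UNIV f" by (simp add: mult.commute)
  qed
  finally show "cmean UNIV (\<lambda>g. \<omega> (\<lambda>x. f (x + g))) = cmean UNIV f"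
    by (simp add: rep_state_const[OF \<omega>])
qed

text \<open>
  If \<open>\<omega> h \<le> 0\<close>, then \<open>k = 1 - h / C\<close> satisfies \<open>0 \<le> k \<le> q < 1\<close> and \<open>\<omega> k \<ge> 1\<close>. The Haar mean over \<open>g\<close> of
  \<open>\<omega>\<close> at the translate of \<open>k ^ (2 ^ j)\<close> by \<open>g\<close> is the Haar mean of \<open>k ^ (2 ^ j)\<close>, at most \<open>q ^ (2 ^ j)\<close>;
  but near \<open>g = 0\<close> the integrand is at least \<open>r ^ (2 ^ j)\<close> with \<open>q < r < 1\<close>.
\<close>

lemma rep_state_positive:
  fixes h :: "'h \<Rightarrow> real"
  assumes \<omega>: "rep_state \<omega>" and h: "(\<lambda>x. complex_of_real (h x)) \<in> representative_functions"
    and pos: "\<And>x. h x > 0"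
  shows "Re (\<omega> (\<lambda>x. of_real (h x))) > 0"
proof (rule ccontr)
  assume neg: "\<not> ?thesis"
  have hc: "continuous_on UNIV h" using continuous_on_Re[OF rep_continuous[OF h]] by simp
  obtain x0 where x0: "\<And>x. h x0 \<le> h x"
    using continuous_attains_inf[OF compact_UNIV _ hc] by auto
  obtain C where C: "C > 0" "\<And>x. norm (h x) \<le> C" using bounded_continuous[OF hc] by metis
  define k where "k x = 1 - h x / C" for x
  define q where "q = 1 - h x0 / C"
  have hC: "h x \<le> C" for x using C(2)[of x] by simp
  have k: "0 \<le> k x" "k x \<le> q" for x
    using hC[of x] x0[of x] C(1) by (auto simp: k_def q_def divide_right_mono)
  have q: "0 \<le> q" "q < 1" using hC[of x0] pos[of x0] C(1) by (auto simp: q_def)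
  have kA: "(\<lambda>x. complex_of_real (k x)) \<in> representative_functions"
    using rep_diff[OF rep_const[of 1] rep_cmult[OF h, of "1 / of_real C"]] by (simp add: k_def)
  have kpA: "(\<lambda>x. complex_of_real (k x ^ m)) \<in> representative_functions" for m
    using rep_power[OF kA, of m] by simp
  define \<theta> where "\<theta> j g = Re (\<omega> (\<lambda>x. complex_of_real (k (x + g) ^ (2 ^ j))))" for j :: nat and g
  have \<theta>c: "continuous_on UNIV (\<theta> j)" for j
    unfolding \<theta>_def by (rule continuous_on_Re[OF rep_state_translates(1)[OF \<omega> kpA]])
  have "\<omega> (\<lambda>x. complex_of_real (k x)) = 1 - \<omega> (\<lambda>x. of_real (h x)) / of_real C"
  proof -
    have "\<omega> (\<lambda>x. (1 / of_real C) * complex_of_real (h x)) = (1 / of_real C) * \<omega> (\<lambda>x. of_real (h x))"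
      by (rule rep_state_cmult[OF \<omega> h])
    then show ?thesis
      using rep_state_diff[OF \<omega> rep_const[of 1] rep_cmult[OF h, of "1 / of_real C"]] rep_state_const[OF \<omega>]
      by (simp add: k_def)
  qed
  moreover have "Re (\<omega> (\<lambda>x. of_real (h x)) / of_real C) = Re (\<omega> (\<lambda>x. of_real (h x))) / C"
    by (rule Re_divide_of_real)
  ultimately have \<theta>0: "\<theta> 0 0 \<ge> 1" using neg C(1) by (simp add: \<theta>_def divide_nonpos_pos)
  \<comment> \<open>The inequality available for powers is the variance bound, which doubles the
    exponent; hence the exponents \<open>2 ^ j\<close>.\<close>
  have step: "(\<theta> j g)\<^sup>2 \<le> \<theta> (Suc j) g" for j g
  proof -
    have "(\<lambda>x. complex_of_real (k (x + g) ^ m)) \<in> representative_functions" for m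
      using rep_right_translate[OF kpA[of m], of g] .
    then have "(\<theta> j g)\<^sup>2 \<le> Re (\<omega> (\<lambda>x. of_real ((k (x + g) ^ (2 ^ j))\<^sup>2)))"
      unfolding \<theta>_def by (intro rep_state_power2[OF \<omega>]) (simp_all only: power_mult[symmetric])
    then show ?thesis by (simp add: \<theta>_def mult.commute flip: power_mult)
  qed
  define r where "r = (1 + q) / 2"
  have r: "0 < r" "r < 1" "q < r" using q by (auto simp: r_def)
  have lower: "r ^ (2 ^ j) \<le> \<theta> j g" if "r \<le> \<theta> 0 g" for j g
  proof (induction j)
    case (Suc j)
    have "r ^ (2 ^ Suc j) = (r ^ (2 ^ j))\<^sup>2" by (simp add: mult.commute flip: power_mult)
    also have "\<dots> \<le> (\<theta> j g)\<^sup>2" using Suc r by (intro power_mono) auto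
    also have "\<dots> \<le> \<theta> (Suc j) g" by (rule step)
    finally show ?case .
  qed (use that in simp)
  \<comment> \<open>A continuous cutoff below 1, supported where \<open>lower\<close> applies. Its
    mean is positive because \<open>\<theta> 0 0 \<ge> 1 > r\<close>.\<close>
  define \<psi> where "\<psi> g = min 1 (max 0 (\<theta> 0 g - r))" for g
  have \<psi>c: "continuous_on UNIV \<psi>" unfolding \<psi>_def by (intro continuous_intros \<theta>c)
  have "mean UNIV \<psi> > 0"
    by (rule mean_pos[OF \<psi>c, of 0]) (use \<theta>0 r in \<open>auto simp: \<psi>_def\<close>)
  \<comment> \<open>\<open>Suc j\<close> because \<open>\<theta> (Suc j)\<close> dominates a square
    and is therefore non-negative also where \<open>\<psi>\<close> vanishes.\<close>
  have "mean UNIV \<psi> \<le> (q / r) ^ (2 ^ Suc j)" for j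
  proof -
    have "r ^ (2 ^ Suc j) * \<psi> g \<le> \<theta> (Suc j) g" for g
    proof (cases "r \<le> \<theta> 0 g")
      case True
      have "r ^ (2 ^ Suc j) * \<psi> g \<le> r ^ (2 ^ Suc j) * 1"
        using r by (intro mult_left_mono) (auto simp: \<psi>_def)
      then show ?thesis using lower[OF True, of "Suc j"] by simp
    next
      case False
      then have "\<psi> g = 0" by (simp add: \<psi>_def)
      moreover have "0 \<le> \<theta> (Suc j) g" using step[of j g] by (meson order_trans zero_le_power2)
      ultimately show ?thesis by simp
    qed
    then have "mean UNIV (\<lambda>g. r ^ (2 ^ Suc j) * \<psi> g) \<le> mean UNIV (\<theta> (Suc j))"
      by (intro mean_mono continuous_on_mult_left \<psi>c \<theta>c)
    then have "r ^ (2 ^ Suc j) * mean UNIV \<psi> \<le> mean UNIV (\<theta> (Suc j))"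
      unfolding mean_cmult[OF \<psi>c] .
    also have "mean UNIV (\<theta> (Suc j)) = Re (cmean UNIV (\<lambda>g. \<omega> (\<lambda>x. complex_of_real (k (x + g) ^ (2 ^ Suc j)))))"
      unfolding \<theta>_def[abs_def] cmean_def by simp
    also have "\<dots> = mean UNIV (\<lambda>x. k x ^ (2 ^ Suc j))"
      unfolding rep_state_translates(2)[OF \<omega> kpA] cmean_of_real by simp
    also have "\<dots> \<le> mean UNIV (\<lambda>x :: 'h. q ^ (2 ^ Suc j))"
    proof (rule mean_mono)
      show "continuous_on UNIV (\<lambda>x. k x ^ (2 ^ Suc j))"
        using continuous_on_Re[OF rep_continuous[OF kpA]] by simp
    qed (use k in \<open>auto intro: power_mono\<close>)
    finally have "r ^ (2 ^ Suc j) * mean UNIV \<psi> \<le> q ^ (2 ^ Suc j)" by (simp only: mean_const)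
    then show ?thesis using r by (simp add: power_divide pos_le_divide_eq mult.commute)
  qed
  moreover obtain n where "(q / r) ^ n < mean UNIV \<psi>"
    using real_arch_pow_inv[OF \<open>mean UNIV \<psi> > 0\<close>, of "q / r"] r by auto
  moreover have "(q / r) ^ (2 ^ Suc n) \<le> (q / r) ^ n"
  proof (rule power_decreasing)
    show "n \<le> 2 ^ Suc n" by (meson Suc_leD less_exp less_imp_le lessI order_trans)
  qed (use q r in auto)
  ultimately show False by (meson leD order_trans)
qed

text \<open>On the compact set \<open>K\<close> where |f|^2 >= d, finitely many elements of
  \<open>J\<close> have no common zero, so the sum p of their squared moduli is at least some m > 0
  there, while the state kills p. With B a bound for |f|^2, the function 2 d - |f|^2 + (B / m) p is
  strictly positive: on \<open>K\<close> the last term outweighs |f|^2, off \<open>K\<close> the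
  first one does. \<open>rep_state_positive\<close> then bounds the value of the state at |f|^2 by 2
  d = e.\<close>

lemma rep_state_eq_0_if_zeros:
  fixes f :: "'h \<Rightarrow> complex"
  assumes \<omega>: "rep_state \<omega>" and f: "f \<in> representative_functions" and J: "J \<subseteq> representative_functions"
    and J0: "\<And>j. j \<in> J \<Longrightarrow> \<omega> (\<lambda>x. j x * cnj (j x)) = 0"
    and zeros: "\<And>x. f x \<noteq> 0 \<Longrightarrow> \<exists>j\<in>J. j x \<noteq> 0"
  shows "Re (\<omega> (\<lambda>x. f x * cnj (f x))) \<le> 0"
proof -
  have ff: "(\<lambda>x. f x * cnj (f x)) \<in> representative_functions" by (intro rep_mult rep_cnj f)
  have fc: "continuous_on UNIV (\<lambda>x. (cmod (f x))\<^sup>2)" by (intro continuous_intros rep_continuous f)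
  have "Re (\<omega> (\<lambda>x. f x * cnj (f x))) \<le> 0 + e" if "e > 0" for e
  proof -
    define d where "d = e / 2"
    have d: "d > 0" using that by (simp add: d_def)
    define K where "K = {x. d \<le> (cmod (f x))\<^sup>2}"
    have "closed K" unfolding K_def by (rule closed_Collect_le[OF continuous_on_const fc])
    then have K: "compact K" using compact_Int_closed[OF compact_UNIV, of K] by simp
    have "\<exists>j\<in>J. j x \<noteq> 0" if "x \<in> K" for x
      using that d by (intro zeros) (auto simp: K_def)
    then obtain j where j: "\<And>x. x \<in> K \<Longrightarrow> j x \<in> J" "\<And>x. x \<in> K \<Longrightarrow> j x x \<noteq> 0" by metis
    have op: "open {y. j x y \<noteq> 0}" if "x \<in> K" for x
      by (rule open_Collect_neq[OF rep_continuous continuous_on_const]) (use j(1)[OF that] J in auto)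
    obtain D where D: "D \<subseteq> K" "finite D" "K \<subseteq> (\<Union>x\<in>D. {y. j x y \<noteq> 0})"
      by (rule compactE_image[OF K op]) (use j(2) in auto)
    define p where "p y = (\<Sum>x\<in>D. (cmod (j x y))\<^sup>2)" for y
    have jA: "j x \<in> representative_functions" if "x \<in> D" for x using j(1) J D(1) that by auto
    have pc: "continuous_on UNIV p"
      unfolding p_def by (intro continuous_on_sum continuous_on_power continuous_on_norm rep_continuous jA)
    have p_eq: "complex_of_real (p y) = (\<Sum>x\<in>D. 1 * (j x y * cnj (j x y)))" for y
      unfolding p_def of_real_sum complex_norm_square by simp
    have jj: "(\<lambda>y. j x y * cnj (j x y)) \<in> representative_functions" if "x \<in> D" for x
      by (intro rep_mult rep_cnj jA that)
    have pA: "(\<lambda>y. complex_of_real (p y)) \<in> representative_functions"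
      unfolding p_eq by (intro rep_sum rep_cmult jj)
    have "\<omega> (\<lambda>y. complex_of_real (p y)) = (\<Sum>x\<in>D. 1 * \<omega> (\<lambda>y. j x y * cnj (j x y)))"
      unfolding p_eq by (rule rep_state_lincomb[OF \<omega>]) (rule jj)
    also have "\<dots> = 0" using J0 j(1) D(1) by (intro sum.neutral) auto
    finally have \<omega>p: "\<omega> (\<lambda>y. complex_of_real (p y)) = 0" .
    have p0: "p y \<ge> 0" for y unfolding p_def by (intro sum_nonneg) simp
    have ppos: "p y > 0" if "y \<in> K" for y
    proof -
      obtain x where x: "x \<in> D" "j x y \<noteq> 0" using D(3) \<open>y \<in> K\<close> by auto
      then have "0 < (cmod (j x y))\<^sup>2" by simp
      also have "\<dots> \<le> p y"
        unfolding p_def using x(1) D(2) by (intro member_le_sum) auto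
      finally show ?thesis .
    qed
    obtain m where m: "m > 0" "\<And>y. y \<in> K \<Longrightarrow> m \<le> p y"
    proof (cases "K = {}")
      case True
      then show thesis using that[of 1] by simp
    next
      case False
      obtain y0 where "y0 \<in> K" "\<forall>y\<in>K. p y0 \<le> p y"
        using continuous_attains_inf[OF K False continuous_on_subset[OF pc subset_UNIV]] by blast
      then show thesis using that[of "p y0"] ppos by blast
    qed
    obtain B where B: "B > 0" "\<And>y. norm ((cmod (f y))\<^sup>2) \<le> B" using bounded_continuous[OF fc] by metis
    have fB: "(cmod (f y))\<^sup>2 \<le> B" for y using B(2)[of y] by simp
    define h where "h y = 2 * d - (cmod (f y))\<^sup>2 + B / m * p y" for y
    have hpos: "h y > 0" for y
    proof (cases "y \<in> K")
      case True
      have "B = B / m * m" using m(1) by simp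
      also have "\<dots> \<le> B / m * p y" using m(2)[OF True] m(1) B(1) by (intro mult_left_mono) auto
      finally show ?thesis using fB[of y] d by (simp add: h_def)
    next
      case False
      have "0 \<le> B / m * p y" using B(1) m(1) p0 by simp
      then show ?thesis using False d by (simp add: h_def K_def)
    qed
    have h_eq: "(\<lambda>y. complex_of_real (h y)) =
        (\<lambda>y. (of_real (2 * d) - f y * cnj (f y)) + of_real (B / m) * of_real (p y))"
      by (simp add: h_def flip: complex_norm_square)
    have 1: "(\<lambda>y. of_real (2 * d) - f y * cnj (f y)) \<in> representative_functions"
      by (rule rep_diff[OF rep_const ff])
    have 2: "(\<lambda>y. of_real (B / m) * complex_of_real (p y)) \<in> representative_functions"
      by (rule rep_cmult[OF pA])
    have hA: "(\<lambda>y. complex_of_real (h y)) \<in> representative_functions"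
      unfolding h_eq by (rule rep_add[OF 1 2])
    have "\<omega> (\<lambda>y. complex_of_real (h y)) = of_real (2 * d) - \<omega> (\<lambda>x. f x * cnj (f x))"
      unfolding h_eq rep_state_add[OF \<omega> 1 2] rep_state_diff[OF \<omega> rep_const ff] rep_state_cmult[OF \<omega> pA]
        rep_state_const[OF \<omega>] \<omega>p by simp
    then show ?thesis using rep_state_positive[OF \<omega> hA hpos] by (simp add: d_def)
  qed
  then show ?thesis by (rule field_le_epsilon)
qed

lemma interpolation:
  fixes x :: 'h
  assumes "finite Y" "x \<notin> Y"
  shows "\<exists>f\<in>representative_functions. f x = 1 \<and> (\<forall>y\<in>Y. f y = 0)"
  using assms
proof (induction Y)
  case empty
  show ?case by (rule bexI[OF _ rep_const[of 1]]) simp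
next
  case (insert y Y)
  then obtain f where f: "f \<in> representative_functions" "f x = 1" "\<forall>y\<in>Y. f y = 0" by auto
  obtain g where g: "g \<in> representative_functions" "g x \<noteq> g y"
    by (rule representative_separate[of x y]) (use insert.prems in auto)
  let ?h = "\<lambda>z. f z * ((1 / (g x - g y)) * (g z - g y))"
  have "?h \<in> representative_functions"
    by (intro rep_mult f rep_cmult rep_diff g rep_const)
  moreover have "?h x = 1" "\<forall>z\<in>insert y Y. ?h z = 0" using f g(2) by auto
  ultimately show ?case by (intro bexI[of _ ?h]) auto
qed

end

section \<open>Finite-dimensional representations of the algebra of representative functions\<close>

definition matrix_rep :: "nat \<Rightarrow> (('h::topological_group_add \<Rightarrow> complex) \<Rightarrow> nat \<Rightarrow> nat \<Rightarrow> complex) \<Rightarrow> bool" where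
  "matrix_rep n r \<longleftrightarrow> (\<forall>f\<in>representative_functions. \<forall>g\<in>representative_functions. \<forall>i<n. \<forall>j<n. \<forall>c.
     r (\<lambda>x. f x + g x) i j = r f i j + r g i j \<and>
     r (\<lambda>x. c * f x) i j = c * r f i j \<and>
     r (\<lambda>x. f x * g x) i j = (\<Sum>k<n. r f i k * r g k j) \<and>
     r (\<lambda>x. cnj (f x)) i j = cnj (r f j i))"

lemma matrix_repD:
  assumes "matrix_rep n r" "f \<in> representative_functions" "i < n" "j < n"
  shows "g \<in> representative_functions \<Longrightarrow> r (\<lambda>x. f x + g x) i j = r f i j + r g i j"
    and "r (\<lambda>x. c * f x) i j = c * r f i j"
    and "g \<in> representative_functions \<Longrightarrow> r (\<lambda>x. f x * g x) i j = (\<Sum>k<n. r f i k * r g k j)"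
    and "r (\<lambda>x. cnj (f x)) i j = cnj (r f j i)"
  using assms unfolding matrix_rep_def by (auto simp del: of_nat_Suc)

lemma matrix_rep_lincomb:
  assumes r: "matrix_rep n r" and "\<And>i. i \<in> I \<Longrightarrow> f i \<in> representative_functions" and ab: "a < n" "b < n"
  shows "r (\<lambda>x. \<Sum>i\<in>I. c i * f i x) a b = (\<Sum>i\<in>I. c i * r (f i) a b)"
  using assms(2)
proof (induction I rule: infinite_finite_induct)
  case (insert i I)
  have 1: "(\<lambda>x. c i * f i x) \<in> representative_functions" using insert.prems by (intro rep_cmult) simp
  have 2: "(\<lambda>x. \<Sum>i\<in>I. c i * f i x) \<in> representative_functions"
    using insert.prems by (intro rep_sum rep_cmult) simp
  show ?case
    using insert matrix_repD(1)[OF r 1 ab 2] matrix_repD(2)[OF r _ ab, of "f i" "c i"] by simp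
qed (use matrix_repD(2)[OF r rep_const[of 0] ab, of 0] in simp_all)

text \<open>The hull in the group of the kernel of \<open>r\<close>.\<close>

definition matrix_rep_zeros :: "nat \<Rightarrow> (('h::topological_group_add \<Rightarrow> complex) \<Rightarrow> nat \<Rightarrow> nat \<Rightarrow> complex) \<Rightarrow> 'h set" where
  "matrix_rep_zeros n r =
     {x. \<forall>f\<in>representative_functions. (\<forall>i<n. \<forall>j<n. r f i j = 0) \<longrightarrow> f x = 0}"

context compact_group
begin

text \<open>
  Functions separating the points of a finite set of common zeros of the kernel are mapped to
  linearly independent matrices.
\<close>

lemma finite_matrix_rep_zeros:
  fixes r :: "('h \<Rightarrow> complex) \<Rightarrow> nat \<Rightarrow> nat \<Rightarrow> complex"
  assumes r: "matrix_rep n r"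
  shows "finite (matrix_rep_zeros n r)"
proof (rule ccontr)
  let ?Z = "matrix_rep_zeros n r"
  assume "infinite ?Z"
  then obtain X where X: "finite X" "card X = Suc (n * n)" "X \<subseteq> ?Z"
    using infinite_arbitrarily_large by blast
  have "\<exists>f\<in>representative_functions. f x = 1 \<and> (\<forall>y\<in>X - {x}. f y = 0)" for x
    by (rule interpolation) (use X in auto)
  then obtain f where f: "\<And>x. f x \<in> representative_functions" "\<And>x. f x x = (1 :: complex)"
    "\<And>x y. y \<in> X \<Longrightarrow> y \<noteq> x \<Longrightarrow> f x y = 0" by (metis DiffI empty_iff insert_iff)
  define P where "P = {..<n} \<times> {..<n}"
  \<comment> \<open>Extending the entries by 0 outside \<open>P\<close> puts every
    \<open>v x\<close> into the span of n * n indicator functions, one fewer than the points of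
    \<open>X\<close>.\<close>
  define v where "v x p = (if p \<in> P then r (f x) (fst p) (snd p) else 0)" for x p
  have indep: "c y = 0" if c: "(\<lambda>p. \<Sum>x\<in>X. c x * v x p) = (\<lambda>p. 0)" and y: "y \<in> X" for c y
  proof -
    let ?g = "\<lambda>z. \<Sum>x\<in>X. c x * f x z"
    have g: "?g \<in> representative_functions" by (intro rep_sum rep_cmult f)
    have "r ?g i j = 0" if "i < n" "j < n" for i j
      using fun_cong[OF c, of "(i, j)"] that by (simp add: matrix_rep_lincomb[OF r f(1) that] v_def P_def)
    then have "?g y = 0" using g y X(3) unfolding matrix_rep_zeros_def by blast
    moreover have "?g y = (\<Sum>x\<in>X. if x = y then c y else 0)"
      using y f by (intro sum.cong) auto
    ultimately show ?thesis using X(1) y by simp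
  qed
  \<comment> \<open>Independence concerns the image of \<open>X\<close> as a set; injectivity
    ensures that this image has as many elements as \<open>X\<close>.\<close>
  have inj: "inj_on v X"
  proof (rule inj_onI, rule ccontr)
    fix x y assume xy: "x \<in> X" "y \<in> X" "v x = v y" "x \<noteq> y"
    define c where "c z = (if z = x then 1 else if z = y then -1 else 0 :: complex)" for z
    have "(\<Sum>z\<in>X. c z * v z p) = 0" for p
    proof -
      have "(\<Sum>z\<in>X. c z * v z p) = (\<Sum>z\<in>{x, y}. c z * v z p)"
        using xy X(1) by (intro sum.mono_neutral_right) (auto simp: c_def)
      also have "\<dots> = 0" using xy by (simp add: c_def)
      finally show ?thesis .
    qed
    then have "c x = 0" using indep[of c x] xy(1) by auto
    then show False by (simp add: c_def)
  qed
  have "fs.independent (v ` X)"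
  proof (rule fs.independent_if_scalars_zero)
    fix c w assume 0: "(\<Sum>x\<in>v ` X. (\<lambda>p. c x * x p)) = 0" and "w \<in> v ` X"
    then obtain y where y: "w = v y" "y \<in> X" by auto
    have "(\<Sum>x\<in>X. c (v x) * v x p) = 0" for p
      using fun_cong[OF 0, of p] unfolding sum_fun_apply sum.reindex[OF inj] by simp
    then have "(\<lambda>p. \<Sum>x\<in>X. c (v x) * v x p) = (\<lambda>p. 0)" by (rule ext)
    then have "c (v y) = 0" using y(2) by (rule indep)
    then show "c w = 0" unfolding y(1) .
  qed (use X in simp)
  moreover have "v ` X \<subseteq> fs.span ((\<lambda>p q. if q = p then 1 else 0) ` P)"
  proof
    fix w assume "w \<in> v ` X"
    then obtain x where x: "w = v x" by auto
    have "w = (\<lambda>q. \<Sum>p\<in>P. r (f x) (fst p) (snd p) * (if q = p then 1 else 0))"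
      unfolding x v_def
      by (auto simp: fun_eq_iff P_def if_distrib[where f = "\<lambda>z. _ * z"] sum.delta' cong: if_cong)
    also have "\<dots> \<in> fs.span ((\<lambda>p q. if q = p then 1 else 0) ` P)"
      by (rule fs_span_lincomb) auto
    finally show "w \<in> fs.span ((\<lambda>p q. if q = p then 1 else 0) ` P)" .
  qed
  moreover have "finite P" by (simp add: P_def)
  ultimately have "card (v ` X) \<le> card ((\<lambda>p q. if q = p then 1 else 0 :: complex) ` P)"
    using fs.independent_span_bound[of "(\<lambda>p q. if q = p then 1 else 0) ` P" "v ` X"] by blast
  also have "\<dots> \<le> card P" by (rule card_image_le) fact
  finally show False using X(2) by (simp add: card_image[OF inj] P_def)
qed

text \<open>The trace T of the matrix of f f^* is the squared Hilbert-Schmidt norm of the matrix of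
  f, so T is positive and vanishes at f f^* only if \<open>r f\<close> does. As \<open>r\<close> may
  be non-unital, T is normalised by its value at 1, which is positive unless \<open>r\<close> kills
  1; in that case \<open>r f\<close>, the product of the matrices of 1 and f, is zero.\<close>

lemma matrix_rep_eq_0_if_zeros:
  fixes r :: "('h \<Rightarrow> complex) \<Rightarrow> nat \<Rightarrow> nat \<Rightarrow> complex"
  assumes r: "matrix_rep n r" and f: "f \<in> representative_functions"
    and zero: "\<And>x. x \<in> matrix_rep_zeros n r \<Longrightarrow> f x = 0" and ij: "i < n" "j < n"
  shows "r f i j = 0"
proof (cases "\<forall>a<n. \<forall>b<n. r (\<lambda>x. 1) a b = 0")
  case True
  have "r (\<lambda>x. 1 * f x) i j = (\<Sum>k<n. r (\<lambda>x. 1) i k * r f k j)"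
    by (rule matrix_repD(3)[OF r rep_const ij f])
  then show ?thesis using True ij by simp
next
  case False
  define T where "T h = (\<Sum>a<n. r h a a)" for h
  have T_sq: "T (\<lambda>x. h x * cnj (h x)) = of_real (\<Sum>a<n. \<Sum>b<n. (cmod (r h a b))\<^sup>2)"
    if h: "h \<in> representative_functions" for h
    unfolding T_def of_real_sum complex_norm_square
    by (intro sum.cong refl)
      (simp add: matrix_repD(3)[OF r h _ _ rep_cnj[OF h]] matrix_repD(4)[OF r h])
  define t where "t = (\<Sum>a<n. \<Sum>b<n. (cmod (r (\<lambda>x. 1) a b))\<^sup>2)"
  have T1: "T (\<lambda>x. 1) = of_real t"
    using T_sq[OF rep_const[of 1]] by (simp add: t_def)
  have "t > 0"
  proof -
    obtain a b where ab: "a < n" "b < n" "r (\<lambda>x. 1) a b \<noteq> 0" using False by auto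
    then have "0 < (cmod (r (\<lambda>x. 1) a b))\<^sup>2" by simp
    also have "\<dots> \<le> (\<Sum>b<n. (cmod (r (\<lambda>x. 1) a b))\<^sup>2)" using ab by (intro member_le_sum) auto
    also have "\<dots> \<le> t" unfolding t_def using ab by (intro member_le_sum) (auto intro: sum_nonneg)
    finally show ?thesis .
  qed
  define \<omega> where "\<omega> h = T h / of_real t" for h
  have \<omega>: "rep_state \<omega>"
    unfolding rep_state_def
  proof (intro conjI ballI allI)
    fix h g :: "'h \<Rightarrow> complex" assume h: "h \<in> representative_functions" and g: "g \<in> representative_functions"
    show "\<omega> (\<lambda>x. h x + g x) = \<omega> h + \<omega> g"
      unfolding \<omega>_def T_def by (simp add: matrix_repD(1)[OF r h _ _ g] sum.distrib add_divide_distrib)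
  next
    fix c and h :: "'h \<Rightarrow> complex" assume h: "h \<in> representative_functions"
    show "\<omega> (\<lambda>x. c * h x) = c * \<omega> h"
      unfolding \<omega>_def T_def by (simp add: matrix_repD(2)[OF r h] sum_distrib_left)
  next
    fix h :: "'h \<Rightarrow> complex" assume h: "h \<in> representative_functions"
    show "0 \<le> Re (\<omega> (\<lambda>x. h x * cnj (h x)))"
      unfolding \<omega>_def T_sq[OF h] using \<open>t > 0\<close> by (simp only: Re_divide_of_real Re_complex_of_real)
        (intro divide_nonneg_pos sum_nonneg; simp)
  next
    show "\<omega> (\<lambda>x. 1) = 1" unfolding \<omega>_def T1 using \<open>t > 0\<close> by simp
  qed
  have "Re (\<omega> (\<lambda>x. f x * cnj (f x))) \<le> 0"
  proof (rule rep_state_eq_0_if_zeros[OF \<omega> f])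
    let ?J = "{h \<in> representative_functions. \<forall>i<n. \<forall>j<n. r h i j = 0}"
    show "?J \<subseteq> representative_functions" by auto
    show "\<omega> (\<lambda>x. h x * cnj (h x)) = 0" if "h \<in> ?J" for h
      using that T_sq[of h] by (simp add: \<omega>_def)
    show "\<exists>h\<in>?J. h x \<noteq> 0" if "f x \<noteq> 0" for x
      using zero[of x] that unfolding matrix_rep_zeros_def by blast
  qed
  then have "(\<Sum>a<n. \<Sum>b<n. (cmod (r f a b))\<^sup>2) \<le> 0"
    unfolding \<omega>_def T_sq[OF f] using \<open>t > 0\<close>
    by (simp only: Re_divide_of_real Re_complex_of_real divide_le_0_iff) simp
  moreover have "(cmod (r f i j))\<^sup>2 \<le> (\<Sum>b<n. (cmod (r f i b))\<^sup>2)" using ij by (intro member_le_sum) auto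
  moreover have "\<dots> \<le> (\<Sum>a<n. \<Sum>b<n. (cmod (r f a b))\<^sup>2)"
    using ij(1) by (intro member_le_sum[of i "{..<n}" "\<lambda>a. \<Sum>b<n. (cmod (r f a b))\<^sup>2"]) (auto intro: sum_nonneg)
  ultimately have "(cmod (r f i j))\<^sup>2 \<le> 0" by linarith
  then show ?thesis by simp
qed

end

section \<open>Representations of the bicrossed product\<close>

lemma mat_adjoint_carrier:
  assumes "A \<in> carrier_mat n m"
  shows "mat_adjoint A \<in> carrier_mat m n"
proof -
  have "dim_row A = n" "length (map conjugate (cols A)) = m" using assms by auto
  then show ?thesis unfolding mat_adjoint_def by (metis mat_of_rows_carrier(1))
qed

lemma index_mat_adjoint:
  assumes A: "A \<in> carrier_mat n m" and ij: "i < m" "j < n"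
  shows "mat_adjoint A $$ (i, j) = cnj (A $$ (j, i))"
proof -
  have d: "dim_row A = n" "dim_col A = m" using A by auto
  have "mat_adjoint A $$ (i, j) = map conjugate (cols A) ! i $ j"
    unfolding mat_adjoint_def by (rule mat_of_rows_index) (use d ij in auto)
  also have "map conjugate (cols A) ! i = conjugate (col A i)" using d ij by simp
  also have "conjugate (col A i) $ j = conjugate (col A i $ j)"
    by (rule vec_index_conjugate) (use d ij in simp)
  also have "\<dots> = cnj (A $$ (j, i))" using d ij by (simp add: conjugate_complex_def)
  finally show ?thesis .
qed

context matched_pair
begin

text \<open>The element u_\<gamma> f of the crossed product.\<close>

definition single_coeff :: "'g \<Rightarrow> ('h \<Rightarrow> complex) \<Rightarrow> 'g \<Rightarrow> 'h \<Rightarrow> complex" where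
  "single_coeff \<gamma> f = (\<lambda>\<gamma>' g. if \<gamma>' = \<gamma> then f g else 0)"

lemma cp_mult_apply:
  assumes "finite T" "{\<mu>. b \<mu> \<noteq> 0} \<subseteq> T"
  shows "cp_mult \<alpha> a b \<nu> g = (\<Sum>\<mu>\<in>T. a (\<nu> - \<mu>) (\<alpha> \<mu> g) * b \<mu> g)"
  unfolding cp_mult_def using assms by (intro sum.mono_neutral_left) auto

lemma single_coeff_mult:
  "cp_mult \<alpha> (single_coeff \<gamma> f) (single_coeff \<mu> h) = single_coeff (\<gamma> + \<mu>) (\<lambda>g. f (\<alpha> \<mu> g) * h g)"
proof (intro ext)
  fix \<nu> g
  have "{\<mu>'. single_coeff \<mu> h \<mu>' \<noteq> 0} \<subseteq> {\<mu>}"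
    by (auto simp: single_coeff_def fun_eq_iff)
  then have "cp_mult \<alpha> (single_coeff \<gamma> f) (single_coeff \<mu> h) \<nu> g =
      single_coeff \<gamma> f (\<nu> - \<mu>) (\<alpha> \<mu> g) * single_coeff \<mu> h \<mu> g"
    by (subst cp_mult_apply[of "{\<mu>}"]) auto
  then show "cp_mult \<alpha> (single_coeff \<gamma> f) (single_coeff \<mu> h) \<nu> g =
      single_coeff (\<gamma> + \<mu>) (\<lambda>g. f (\<alpha> \<mu> g) * h g) \<nu> g"
    by (auto simp: single_coeff_def diff_eq_eq)
qed

lemma cp_star_single_coeff_0:
  "cp_star \<alpha> (single_coeff 0 f) = single_coeff 0 (\<lambda>g. cnj (f g))"
  by (auto simp: cp_star_def single_coeff_def \<alpha>_zero fun_eq_iff)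

lemma single_coeff_carrier:
  assumes "f \<in> representative_functions"
  shows "single_coeff \<gamma> f \<in> carrier (bicrossed_cqg_algebra \<alpha> \<beta>)"
proof -
  have "{\<gamma>'. single_coeff \<gamma> f \<gamma>' \<noteq> 0} \<subseteq> {\<gamma>}" by (auto simp: single_coeff_def fun_eq_iff)
  then have "finite {\<gamma>'. single_coeff \<gamma> f \<gamma>' \<noteq> 0}" by (rule finite_subset) simp
  moreover have "single_coeff \<gamma> f \<gamma>' \<in> representative_functions" for \<gamma>'
    using assms rep_const[of 0] by (cases "\<gamma>' = \<gamma>") (simp_all add: single_coeff_def)
  ultimately show ?thesis by (simp add: carrier_bicrossed_cqg_algebra algebraic_crossed_product_def)
qed

lemma bicrossed_cqg_algebra_ops:
  "mult (bicrossed_cqg_algebra \<alpha> \<beta>) = cp_mult \<alpha>" "add (bicrossed_cqg_algebra \<alpha> \<beta>) = (+)"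
  "zero (bicrossed_cqg_algebra \<alpha> \<beta>) = 0" "star (bicrossed_cqg_algebra \<alpha> \<beta>) = cp_star \<alpha>"
  "smult (bicrossed_cqg_algebra \<alpha> \<beta>) = (\<lambda>c a \<gamma> g. c * a \<gamma> g)"
  unfolding bicrossed_cqg_algebra_def by (rule monoid.select_convs ring.select_convs module.select_convs star_algebra.select_convs)+

lemma star_repD:
  assumes "star_rep (bicrossed_cqg_algebra \<alpha> \<beta>) n \<pi>"
    and a: "a \<in> carrier (bicrossed_cqg_algebra \<alpha> \<beta>)"
  shows "\<pi> a \<in> carrier_mat n n"
    and "b \<in> carrier (bicrossed_cqg_algebra \<alpha> \<beta>) \<Longrightarrow> \<pi> (a + b) = \<pi> a + \<pi> b"
    and "\<pi> (\<lambda>\<gamma> g. c * a \<gamma> g) = c \<cdot>\<^sub>m \<pi> a"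
    and "b \<in> carrier (bicrossed_cqg_algebra \<alpha> \<beta>) \<Longrightarrow> \<pi> (cp_mult \<alpha> a b) = \<pi> a * \<pi> b"
    and "\<pi> (cp_star \<alpha> a) = mat_adjoint (\<pi> a)"
proof -
  note s = assms(1)[unfolded star_rep_def bicrossed_cqg_algebra_ops]
  show "\<pi> a \<in> carrier_mat n n"
    by (rule s[THEN conjunct1, THEN bspec, OF a])
  show "b \<in> carrier (bicrossed_cqg_algebra \<alpha> \<beta>) \<Longrightarrow> \<pi> (a + b) = \<pi> a + \<pi> b"
    by (rule s[THEN conjunct2, THEN conjunct1, THEN bspec, OF a, THEN bspec])
  show "\<pi> (\<lambda>\<gamma> g. c * a \<gamma> g) = c \<cdot>\<^sub>m \<pi> a"
    by (rule s[THEN conjunct2, THEN conjunct2, THEN conjunct1, THEN spec, THEN bspec, OF a])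
  show "b \<in> carrier (bicrossed_cqg_algebra \<alpha> \<beta>) \<Longrightarrow> \<pi> (cp_mult \<alpha> a b) = \<pi> a * \<pi> b"
    by (rule s[THEN conjunct2, THEN conjunct2, THEN conjunct2, THEN conjunct1, THEN bspec, OF a, THEN bspec])
  show "\<pi> (cp_star \<alpha> a) = mat_adjoint (\<pi> a)"
    by (rule s[THEN conjunct2, THEN conjunct2, THEN conjunct2, THEN conjunct2, THEN bspec, OF a])
qed

lemma matrix_rep_star_rep:
  assumes \<pi>: "star_rep (bicrossed_cqg_algebra \<alpha> \<beta>) n \<pi>"
  shows "matrix_rep n (\<lambda>f i j. \<pi> (single_coeff 0 f) $$ (i, j))"
  unfolding matrix_rep_def
proof (intro ballI allI impI conjI)
  fix f g :: "'h \<Rightarrow> complex" and i j c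
  assume f: "f \<in> representative_functions" and g: "g \<in> representative_functions" and ij: "i < n" "j < n"
  note F = single_coeff_carrier[OF f, of 0] and G = single_coeff_carrier[OF g, of 0]
  note D = star_repD[OF \<pi> F] and GD = star_repD[OF \<pi> G]
  have "single_coeff 0 (\<lambda>x. f x + g x) = single_coeff 0 f + single_coeff 0 g"
    by (auto simp: single_coeff_def fun_eq_iff)
  then show "\<pi> (single_coeff 0 (\<lambda>x. f x + g x)) $$ (i, j) = \<pi> (single_coeff 0 f) $$ (i, j) + \<pi> (single_coeff 0 g) $$ (i, j)"
    using D(1) D(2)[OF G] GD(1) ij by simp
  have "single_coeff 0 (\<lambda>x. c * f x) = (\<lambda>\<gamma> x. c * single_coeff 0 f \<gamma> x)"
    by (auto simp: single_coeff_def fun_eq_iff)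
  then show "\<pi> (single_coeff 0 (\<lambda>x. c * f x)) $$ (i, j) = c * \<pi> (single_coeff 0 f) $$ (i, j)"
    using D(1) D(3) ij by simp
  have "single_coeff 0 (\<lambda>x. f x * g x) = cp_mult \<alpha> (single_coeff 0 f) (single_coeff 0 g)"
    by (simp add: single_coeff_mult \<alpha>_zero)
  then show "\<pi> (single_coeff 0 (\<lambda>x. f x * g x)) $$ (i, j) =
      (\<Sum>k<n. \<pi> (single_coeff 0 f) $$ (i, k) * \<pi> (single_coeff 0 g) $$ (k, j))"
    using D(1) D(4)[OF G] GD(1) ij by (simp add: scalar_prod_def atLeast0LessThan)
  show "\<pi> (single_coeff 0 (\<lambda>x. cnj (f x))) $$ (i, j) = cnj (\<pi> (single_coeff 0 f) $$ (j, i))"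
    unfolding cp_star_single_coeff_0[symmetric] D(5) by (rule index_mat_adjoint[OF D(1) ij])
qed

abbreviation finite_orbit_points :: "'h set" where
  "finite_orbit_points \<equiv> {x. finite (range (\<lambda>\<gamma>. \<alpha> \<gamma> x))}"

text \<open>The common zeros of the kernel of a representation form a finite \<open>\<alpha>\<close>-invariant set.\<close>

lemma representative_eq_0_if_RFD:
  assumes RFD: "RFD (bicrossed_cqg_algebra \<alpha> \<beta>)"
    and f: "f \<in> representative_functions" and zero: "\<And>x. x \<in> finite_orbit_points \<Longrightarrow> f x = 0"
  shows "f = (\<lambda>x. 0)"
proof (rule ccontr)
  assume "f \<noteq> (\<lambda>x. 0)"
  then obtain g where "f g \<noteq> 0" by auto
  then have "single_coeff 0 f \<noteq> 0" by (auto simp: single_coeff_def fun_eq_iff)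
  then have "single_coeff 0 f \<noteq> \<zero>\<^bsub>bicrossed_cqg_algebra \<alpha> \<beta>\<^esub>" by (simp add: bicrossed_cqg_algebra_def)
  then obtain n \<pi> where \<pi>: "star_rep (bicrossed_cqg_algebra \<alpha> \<beta>) n \<pi>" "\<pi> (single_coeff 0 f) \<noteq> 0\<^sub>m n n"
    using RFD single_coeff_carrier[OF f] unfolding RFD_def by blast
  define r where "r f i j = \<pi> (single_coeff 0 f) $$ (i, j)" for f i j
  have r: "matrix_rep n r" using matrix_rep_star_rep[OF \<pi>(1)] by (simp add: r_def[abs_def])
  define Z where "Z = matrix_rep_zeros n r"
  have finZ: "finite Z" unfolding Z_def by (rule G.finite_matrix_rep_zeros[OF r])
  have inv: "\<alpha> \<gamma> x \<in> Z" if x: "x \<in> Z" for x \<gamma>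
    unfolding Z_def matrix_rep_zeros_def
  proof (intro CollectI ballI impI)
    fix h :: "'h \<Rightarrow> complex" assume h: "h \<in> representative_functions" and 0: "\<forall>i<n. \<forall>j<n. r h i j = 0"
    note C = single_coeff_carrier[OF h, of 0] single_coeff_carrier[OF rep_const[of 1], of \<gamma>]
      single_coeff_carrier[OF rep_const[of 1], of "- \<gamma>"] single_coeff_carrier[OF rep_\<alpha>[OF h, of \<gamma>], of \<gamma>]
    have z: "\<pi> (single_coeff 0 h) = 0\<^sub>m n n"
      using 0 star_repD(1)[OF \<pi>(1) C(1)] by (intro eq_matI) (auto simp: r_def)
    \<comment> \<open>In the crossed product the function h o \<alpha>_\<gamma> is u_{-\<gamma>} h
      u_\<gamma>, so \<open>\<pi>\<close> kills it together with h. The two identities carry out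
      this conjugation.\<close>
    have e1: "single_coeff \<gamma> (\<lambda>x. h (\<alpha> \<gamma> x)) = cp_mult \<alpha> (single_coeff 0 h) (single_coeff \<gamma> (\<lambda>x. 1))"
      by (simp add: single_coeff_mult)
    have e2: "single_coeff 0 (\<lambda>x. h (\<alpha> \<gamma> x)) =
        cp_mult \<alpha> (single_coeff (- \<gamma>) (\<lambda>x. 1)) (single_coeff \<gamma> (\<lambda>x. h (\<alpha> \<gamma> x)))"
      by (simp add: single_coeff_mult)
    have "\<pi> (single_coeff 0 (\<lambda>x. h (\<alpha> \<gamma> x))) =
        \<pi> (single_coeff (- \<gamma>) (\<lambda>x. 1)) * (0\<^sub>m n n * \<pi> (single_coeff \<gamma> (\<lambda>x. 1)))"
      unfolding e2 star_repD(4)[OF \<pi>(1) C(3,4)] unfolding e1 star_repD(4)[OF \<pi>(1) C(1,2)] z ..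
    also have "\<dots> = 0\<^sub>m n n"
      using star_repD(1)[OF \<pi>(1) C(2)] star_repD(1)[OF \<pi>(1) C(3)] by simp
    finally have "\<forall>i<n. \<forall>j<n. r (\<lambda>x. h (\<alpha> \<gamma> x)) i j = 0" by (simp add: r_def)
    then show "h (\<alpha> \<gamma> x) = 0"
      using x rep_\<alpha>[OF h, of \<gamma>] unfolding Z_def matrix_rep_zeros_def by blast
  qed
  have "Z \<subseteq> finite_orbit_points"
  proof
    fix x assume "x \<in> Z"
    then have "range (\<lambda>\<gamma>. \<alpha> \<gamma> x) \<subseteq> Z" using inv by auto
    then show "x \<in> finite_orbit_points" using finZ finite_subset by auto
  qed
  then have "r f i j = 0" if "i < n" "j < n" for i j
    using G.matrix_rep_eq_0_if_zeros[OF r f _ that] zero unfolding Z_def by blast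
  then have "\<pi> (single_coeff 0 f) = 0\<^sub>m n n"
    using star_repD(1)[OF \<pi>(1) single_coeff_carrier[OF f, of 0]] by (intro eq_matI) (auto simp: r_def)
  then show False using \<pi>(2) by simp
qed

text \<open>\<open>\<alpha>_matched\<close> puts the orbit of g + h inside the set of sums of the
  two orbits. Applied to g + (- g) it writes \<open>\<alpha> \<gamma> (- g)\<close> as the inverse
  of a point in the orbit of g.\<close>

lemma finite_orbit_subgroup: "subgroup_of_compact finite_orbit_points"
proof
  show "compact (UNIV :: 'h set)" by (rule compact_group)
  show "0 \<in> finite_orbit_points" by (simp add: \<alpha>_unit)
next
  fix g h assume "g \<in> finite_orbit_points" "h \<in> finite_orbit_points"
  then have "finite ((\<lambda>(x, y). x + y) ` (range (\<lambda>\<gamma>. \<alpha> \<gamma> g) \<times> range (\<lambda>\<gamma>. \<alpha> \<gamma> h)))" by simp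
  moreover have "range (\<lambda>\<gamma>. \<alpha> \<gamma> (g + h)) \<subseteq> (\<lambda>(x, y). x + y) ` (range (\<lambda>\<gamma>. \<alpha> \<gamma> g) \<times> range (\<lambda>\<gamma>. \<alpha> \<gamma> h))"
    by (auto simp: \<alpha>_matched image_iff)
  ultimately show "g + h \<in> finite_orbit_points" using finite_subset by blast
next
  fix g assume g: "g \<in> finite_orbit_points"
  have "\<alpha> \<gamma> (- g) = - \<alpha> (\<beta> (- g) \<gamma>) g" for \<gamma>
    using \<alpha>_matched[of "\<beta> (- g) \<gamma>" g "- g"] by (simp add: \<alpha>_unit \<beta>_cancel minus_unique)
  then have "range (\<lambda>\<gamma>. \<alpha> \<gamma> (- g)) \<subseteq> uminus ` range (\<lambda>\<gamma>. \<alpha> \<gamma> g)" by blast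
  moreover have "finite (uminus ` range (\<lambda>\<gamma>. \<alpha> \<gamma> g))" using g by blast
  ultimately show "- g \<in> finite_orbit_points" using finite_subset by blast
qed

text \<open>
  If representative functions are determined by their values on the points of finite orbit, their
  mean over these points is the Haar mean. A bump function supported off the closure of these points
  is uniformly approximated by representative functions, but its two means differ.
\<close>

lemma enough_finite_orbits_if_RFD:
  assumes RFD: "RFD (bicrossed_cqg_algebra \<alpha> \<beta>)"
  shows "enough_finite_orbits \<alpha>"
proof (rule ccontr)
  interpret F: subgroup_of_compact finite_orbit_points by (rule finite_orbit_subgroup)
  let ?F = finite_orbit_points
  assume "\<not> enough_finite_orbits \<alpha>"
  then obtain x0 where x0: "x0 \<notin> closure ?F" unfolding enough_finite_orbits_def by auto
  have means: "cmean ?F f = cmean UNIV f" if f: "f \<in> representative_functions" for f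
  proof -
    obtain n :: nat and a b where a: "\<And>i. i < n \<Longrightarrow> a i \<in> representative_functions"
      and b: "\<And>i. i < n \<Longrightarrow> b i \<in> representative_functions"
      and ex: "\<And>x y. f (x + y) = (\<Sum>i<n. a i x * b i y)"
      using rep_expansion[OF f] by metis
    note fc = rep_continuous[OF f]
    have ac: "continuous_on UNIV (a i)" and bc: "continuous_on UNIV (b i)" if "i < n" for i
      using a b that by (auto intro: rep_continuous)
    \<comment> \<open>The mean over \<open>?F\<close> in the second variable. It is representative
      by the expansion and constant on \<open>?F\<close> by invariance, hence constant everywhere.
      Its Haar mean is then evaluated a second time, with the two means exchanged inside the finite
      sum.\<close>
    define q where "q x = cmean ?F (\<lambda>y. f (x + y))" for x
    have q_eq: "q x = (\<Sum>i<n. cmean ?F (b i) * a i x)" for x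
    proof -
      have "q x = (\<Sum>i<n. cmean ?F (\<lambda>y. a i x * b i y))"
        unfolding q_def ex using bc by (intro F.cmean_sum continuous_on_mult_left) auto
      also have "\<dots> = (\<Sum>i<n. cmean ?F (b i) * a i x)"
        using bc by (intro sum.cong) (auto simp: F.cmean_cmult)
      finally show ?thesis .
    qed
    have qA: "q \<in> representative_functions"
      unfolding q_eq[abs_def] using a by (intro rep_sum rep_cmult) auto
    have "q x = cmean ?F f" if "x \<in> ?F" for x
      unfolding q_def by (rule F.cmean_left_translate[OF fc that])
    then have "(\<lambda>x. q x - cmean ?F f) = (\<lambda>x. 0)"
      by (intro representative_eq_0_if_RFD[OF RFD] rep_diff qA rep_const) simp
    then have "q x - cmean ?F f = 0" for x by (rule fun_cong)
    then have qc: "q = (\<lambda>x. cmean ?F f)" by auto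
    have "cmean ?F f = cmean UNIV q" unfolding qc by (rule G.cmean_const[symmetric])
    also have "\<dots> = (\<Sum>i<n. cmean UNIV (\<lambda>x. cmean ?F (b i) * a i x))"
      unfolding q_eq[abs_def] using ac by (intro G.cmean_sum continuous_on_mult_left) auto
    also have "\<dots> = (\<Sum>i<n. cmean UNIV (a i) * cmean ?F (b i))"
      using ac by (intro sum.cong) (auto simp: G.cmean_cmult)
    also have "\<dots> = (\<Sum>i<n. cmean ?F (\<lambda>y. cmean UNIV (a i) * b i y))"
      using bc by (intro sum.cong) (auto simp: F.cmean_cmult)
    also have "\<dots> = cmean ?F (\<lambda>y. \<Sum>i<n. cmean UNIV (a i) * b i y)"
      using bc by (intro F.cmean_sum[symmetric] continuous_on_mult_left) auto
    also have "(\<lambda>y. \<Sum>i<n. cmean UNIV (a i) * b i y) = (\<lambda>y. cmean UNIV f)"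
    proof
      fix y
      have "cmean UNIV f = cmean UNIV (\<lambda>x. f (x + y))"
        by (rule G.cmean_right_translate[OF fc UNIV_I, symmetric])
      also have "\<dots> = (\<Sum>i<n. cmean UNIV (\<lambda>x. b i y * a i x))"
        unfolding ex mult.commute[of "a _ _"] using ac by (intro G.cmean_sum continuous_on_mult_left) auto
      also have "\<dots> = (\<Sum>i<n. cmean UNIV (a i) * b i y)"
        using ac by (intro sum.cong) (auto simp: G.cmean_cmult)
      finally show "(\<Sum>i<n. cmean UNIV (a i) * b i y) = cmean UNIV f" ..
    qed
    finally show ?thesis by (simp add: F.cmean_const)
  qed
  obtain \<phi> :: "'h \<Rightarrow> real" where \<phi>: "continuous_on UNIV \<phi>" "\<And>x. 0 \<le> \<phi> x"
    "\<And>x. x \<in> closure ?F \<Longrightarrow> \<phi> x = 0" "\<phi> x0 = 1"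
    by (rule G.bump_function[OF closed_closure x0]) auto
  \<comment> \<open>The two means of \<open>\<phi>\<close> are 0 and c. Those of an approximation
    within c / 3 coincide, so c would be at most 2 c / 3.\<close>
  define c where "c = mean UNIV \<phi>"
  have "c > 0" unfolding c_def by (rule G.mean_pos[OF \<phi>(1,2), of x0]) (simp add: \<phi>)
  then obtain f :: "'h \<Rightarrow> real" where f: "(\<lambda>x. complex_of_real (f x)) \<in> representative_functions"
    "\<And>x. \<bar>\<phi> x - f x\<bar> < c / 3"
    using G.representative_dense[OF \<phi>(1), of "c / 3"] by auto
  have fc: "continuous_on UNIV f" using continuous_on_Re[OF rep_continuous[OF f(1)]] by simp
  have near: "\<bar>\<phi> x - f x\<bar> \<le> c / 3" for x using f(2)[of x] by simp
  have "\<bar>mean ?F \<phi> - mean ?F f\<bar> \<le> c / 3" by (rule F.mean_dist_le[OF \<phi>(1) fc near])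
  moreover have "\<bar>mean UNIV \<phi> - mean UNIV f\<bar> \<le> c / 3" by (rule G.mean_dist_le[OF \<phi>(1) fc near])
  moreover have "complex_of_real (mean ?F f) = of_real (mean UNIV f)"
    using means[OF f(1)] unfolding F.cmean_of_real G.cmean_of_real .
  moreover have "\<bar>mean ?F \<phi> - mean ?F (\<lambda>x. 0)\<bar> \<le> 0"
    using \<phi>(3) closure_subset[of ?F] by (intro F.mean_dist_le \<phi>(1) continuous_on_const) auto
  ultimately show False using \<open>c > 0\<close> by (simp add: F.mean_const c_def)
qed

end

section \<open>Representations of the group algebra\<close>

lemma lookup_times_group:
  fixes a b :: "'g::group_add \<Rightarrow>\<^sub>0 complex"
  assumes "finite T" "\<And>\<mu>. poly_mapping.lookup b \<mu> \<noteq> 0 \<Longrightarrow> \<mu> \<in> T"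
  shows "poly_mapping.lookup (a * b) \<nu> =
    (\<Sum>\<mu>\<in>T. poly_mapping.lookup a (\<nu> - \<mu>) * poly_mapping.lookup b \<mu>)"
proof -
  let ?f = "\<lambda>(l, \<mu>). poly_mapping.lookup a l * poly_mapping.lookup b \<mu> when \<nu> = l + \<mu>"
  have "poly_mapping.lookup (a * b) \<nu> = Sum_any ?f"
    unfolding times_poly_mapping.rep_eq by (rule prod_fun_unfold_prod) simp_all
  also have "\<dots> = sum ?f ((\<lambda>\<mu>. (\<nu> - \<mu>, \<mu>)) ` T)"
  proof (rule Sum_any.expand_superset)
    show "{p. ?f p \<noteq> 0} \<subseteq> (\<lambda>\<mu>. (\<nu> - \<mu>, \<mu>)) ` T"
    proof
      fix p assume "p \<in> {p. ?f p \<noteq> 0}"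
      then have "\<nu> = fst p + snd p" "snd p \<in> T"
        using assms(2) by (auto simp: when_def case_prod_beta split: if_splits)
      then show "p \<in> (\<lambda>\<mu>. (\<nu> - \<mu>, \<mu>)) ` T" by (intro image_eqI[of _ _ "snd p"]) (simp_all add: prod_eq_iff)
    qed
  qed (use assms in simp)
  also have "\<dots> = (\<Sum>\<mu>\<in>T. poly_mapping.lookup a (\<nu> - \<mu>) * poly_mapping.lookup b \<mu>)"
    by (subst sum.reindex) (auto simp: inj_on_def)
  finally show ?thesis .
qed

lemma group_algebra_ops:
  "carrier group_algebra = UNIV" "mult group_algebra = (*)" "add group_algebra = (+)" "zero group_algebra = 0"
  "smult group_algebra = (\<lambda>c. Poly_Mapping.map ((*) c))"
  unfolding group_algebra_def
  by (rule partial_object.select_convs monoid.select_convs ring.select_convs module.select_convs)+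

lemma lookup_smult_group_algebra:
  "poly_mapping.lookup (Poly_Mapping.map ((*) c) a) \<gamma> = c * poly_mapping.lookup a \<gamma>"
  for c :: complex
  by (simp add: Poly_Mapping.map.rep_eq when_def)

lemma star_rep_group_algebraD:
  fixes a b :: "'g::group_add \<Rightarrow>\<^sub>0 complex"
  assumes "star_rep group_algebra n \<pi>"
  shows "\<pi> a \<in> carrier_mat n n" "\<pi> (a + b) = \<pi> a + \<pi> b"
    "\<pi> (Poly_Mapping.map ((*) c) a) = c \<cdot>\<^sub>m \<pi> a" "\<pi> (a * b) = \<pi> a * \<pi> b"
    "\<pi> (star group_algebra a) = mat_adjoint (\<pi> a)"
  using assms unfolding star_rep_def group_algebra_ops by blast+

lemma star_rep_sum_index:
  fixes z :: "'i \<Rightarrow> 'g::group_add \<Rightarrow>\<^sub>0 complex"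
  assumes \<pi>: "star_rep group_algebra n \<pi>" and ij: "i < n" "j < n"
  shows "\<pi> (\<Sum>p\<in>P. z p) $$ (i, j) = (\<Sum>p\<in>P. \<pi> (z p) $$ (i, j))"
proof -
  note D = star_rep_group_algebraD[OF \<pi>]
  have 0: "\<pi> 0 $$ (i, j) = 0"
  proof -
    have "\<pi> 0 $$ (i, j) = (\<pi> 0 + \<pi> 0) $$ (i, j)" using D(2)[of 0 0] by simp
    also have "\<dots> = \<pi> 0 $$ (i, j) + \<pi> 0 $$ (i, j)" using D(1)[of 0] ij by (intro index_add_mat) auto
    finally show ?thesis by simp
  qed
  show ?thesis
  proof (induction P rule: infinite_finite_induct)
    case (insert p P)
    have "\<pi> (z p + (\<Sum>p\<in>P. z p)) $$ (i, j) = \<pi> (z p) $$ (i, j) + \<pi> (\<Sum>p\<in>P. z p) $$ (i, j)"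
      unfolding D(2) using D(1)[of "\<Sum>p\<in>P. z p"] ij by (intro index_add_mat) auto
    then show ?case using insert by simp
  qed (simp_all add: 0)
qed

text \<open>Row and column k of a block matrix with blocks of size n stand for the pair (k div n, k
  mod n).\<close>

lemma sum_div_mod:
  fixes f :: "nat \<Rightarrow> nat \<Rightarrow> 'a::comm_monoid_add"
  shows "(\<Sum>k<m * n. f (k div n) (k mod n)) = (\<Sum>p<m. \<Sum>q<n. f p q)"
proof -
  have "(\<Sum>k<m * n. f (k div n) (k mod n)) = (\<Sum>p<m. \<Sum>k\<in>{p * n..<p * n + n}. f (k div n) (k mod n))"
    by (rule sum.nat_group[symmetric])
  also have "\<dots> = (\<Sum>p<m. \<Sum>q<n. f p q)"
    by (rule sum.cong[OF refl], subst sum.atLeastLessThan_shift_0)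
      (simp add: atLeast0LessThan)
  finally show ?thesis .
qed

section \<open>Passage between the crossed product and the group algebra\<close>

context matched_pair
begin

lemma carrier_finite_support:
  "a \<in> carrier (bicrossed_cqg_algebra \<alpha> \<beta>) \<Longrightarrow> finite {\<gamma>. a \<gamma> \<noteq> 0}"
  by (simp add: carrier_bicrossed_cqg_algebra algebraic_crossed_product_def)

text \<open>Constant functions are invariant under \<open>\<alpha>\<close>, so the sums with
  constant coefficients form a copy of the group algebra. Representations are restricted to
  it.\<close>

lemma RFD_group_algebra_if_RFD:
  assumes RFD: "RFD (bicrossed_cqg_algebra \<alpha> \<beta>)"
  shows "RFD (group_algebra :: ('g \<Rightarrow>\<^sub>0 complex) star_algebra)"
  unfolding RFD_def
proof (intro ballI impI)
  define E :: "('g \<Rightarrow>\<^sub>0 complex) \<Rightarrow> 'g \<Rightarrow> 'h \<Rightarrow> complex" where "E a \<gamma> g = poly_mapping.lookup a \<gamma>" for a \<gamma> g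
  have E0: "E a \<gamma> \<noteq> 0 \<longleftrightarrow> poly_mapping.lookup a \<gamma> \<noteq> 0" for a \<gamma> by (simp add: E_def fun_eq_iff)
  have EC: "E a \<in> carrier (bicrossed_cqg_algebra \<alpha> \<beta>)" for a
  proof -
    have "finite {\<gamma>. E a \<gamma> \<noteq> 0}" unfolding E0 by simp
    moreover have "E a \<gamma> \<in> representative_functions" for \<gamma> unfolding E_def[abs_def] by (rule rep_const)
    ultimately show ?thesis by (simp add: carrier_bicrossed_cqg_algebra algebraic_crossed_product_def)
  qed
  fix a :: "'g \<Rightarrow>\<^sub>0 complex" assume "a \<noteq> \<zero>\<^bsub>group_algebra\<^esub>"
  then obtain \<gamma> where "poly_mapping.lookup a \<gamma> \<noteq> 0"
    unfolding group_algebra_ops by (metis lookup_zero poly_mapping_eqI)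
  then have "E a \<noteq> \<zero>\<^bsub>bicrossed_cqg_algebra \<alpha> \<beta>\<^esub>"
    unfolding bicrossed_cqg_algebra_ops using E0[of a \<gamma>] by auto
  then obtain n \<pi> where \<pi>: "star_rep (bicrossed_cqg_algebra \<alpha> \<beta>) n \<pi>" "\<pi> (E a) \<noteq> 0\<^sub>m n n"
    using RFD EC unfolding RFD_def by blast
  have "star_rep group_algebra n (\<lambda>a. \<pi> (E a))"
    unfolding star_rep_def group_algebra_ops
  proof (intro conjI allI ballI)
    fix a b :: "'g \<Rightarrow>\<^sub>0 complex" and c :: complex
    note D = star_repD[OF \<pi>(1) EC[of a]]
    show "\<pi> (E a) \<in> carrier_mat n n" by (rule D)
    have "E (a + b) = E a + E b" by (simp add: E_def fun_eq_iff lookup_add)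
    then show "\<pi> (E (a + b)) = \<pi> (E a) + \<pi> (E b)" by (simp add: D(2)[OF EC])
    have "E (Poly_Mapping.map ((*) c) a) = (\<lambda>\<gamma> g. c * E a \<gamma> g)"
      by (simp add: E_def fun_eq_iff lookup_smult_group_algebra)
    then show "\<pi> (E (Poly_Mapping.map ((*) c) a)) = c \<cdot>\<^sub>m \<pi> (E a)" by (simp only: D(3))
    have "E (a * b) = cp_mult \<alpha> (E a) (E b)"
    proof (intro ext)
      fix \<nu> g
      have "E (a * b) \<nu> g = (\<Sum>\<mu>\<in>{\<mu>. E b \<mu> \<noteq> 0}. E a (\<nu> - \<mu>) (\<alpha> \<mu> g) * E b \<mu> g)"
        unfolding E0 unfolding E_def by (rule lookup_times_group) simp_all
      then show "E (a * b) \<nu> g = cp_mult \<alpha> (E a) (E b) \<nu> g" by (simp add: cp_mult_def)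
    qed
    then show "\<pi> (E (a * b)) = \<pi> (E a) * \<pi> (E b)" by (simp only: D(4)[OF EC])
    have "E (star group_algebra a) = cp_star \<alpha> (E a)"
      by (intro ext) (simp add: E_def cp_star_def lookup_star_group_algebra)
    then show "\<pi> (E (star group_algebra a)) = mat_adjoint (\<pi> (E a))" by (simp only: D(5))
  qed
  then show "\<exists>n \<pi>. star_rep group_algebra n \<pi> \<and> \<pi> a \<noteq> 0\<^sub>m n n"
    using \<pi>(2) by (intro exI[of _ n] exI[of _ "\<lambda>a. \<pi> (E a)"] conjI)
qed

text \<open>The (y, x) entry of a matrix over the group algebra: u_\<mu> f sends the basis vector of
  x to f(x) \<mu> at the basis vector of \<alpha>_\<mu>(x).\<close>

definition orbit_block :: "('g \<Rightarrow> 'h \<Rightarrow> complex) \<Rightarrow> 'h \<Rightarrow> 'h \<Rightarrow> 'g \<Rightarrow>\<^sub>0 complex" where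
  "orbit_block a y x = Abs_poly_mapping (\<lambda>\<mu>. if \<alpha> \<mu> x = y then a \<mu> x else 0)"

lemma lookup_orbit_block:
  assumes "finite {\<gamma>. a \<gamma> \<noteq> 0}"
  shows "poly_mapping.lookup (orbit_block a y x) \<mu> = (if \<alpha> \<mu> x = y then a \<mu> x else 0)"
proof -
  have "finite {\<mu>. (if \<alpha> \<mu> x = y then a \<mu> x else 0) \<noteq> 0}"
    by (rule finite_subset[OF _ assms]) auto
  then show ?thesis unfolding orbit_block_def by (subst lookup_Abs_poly_mapping) auto
qed

lemma orbit_block_add:
  assumes "finite {\<gamma>. a \<gamma> \<noteq> 0}" "finite {\<gamma>. b \<gamma> \<noteq> 0}"
  shows "orbit_block (a + b) y x = orbit_block a y x + orbit_block b y x"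
proof (rule poly_mapping_eqI)
  have "finite {\<gamma>. (a + b) \<gamma> \<noteq> 0}"
    by (rule finite_subset[of _ "{\<gamma>. a \<gamma> \<noteq> 0} \<union> {\<gamma>. b \<gamma> \<noteq> 0}"]) (use assms in auto)
  then show "poly_mapping.lookup (orbit_block (a + b) y x) \<mu> =
      poly_mapping.lookup (orbit_block a y x + orbit_block b y x) \<mu>" for \<mu>
    by (simp add: lookup_orbit_block assms lookup_add)
qed

lemma orbit_block_smult:
  assumes "finite {\<gamma>. a \<gamma> \<noteq> 0}"
  shows "orbit_block (\<lambda>\<gamma> g. c * a \<gamma> g) y x = Poly_Mapping.map ((*) c) (orbit_block a y x)"
proof (rule poly_mapping_eqI)
  have "finite {\<gamma>. (\<lambda>g. c * a \<gamma> g) \<noteq> 0}"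
    by (rule finite_subset[OF _ assms]) (auto simp: fun_eq_iff)
  then show "poly_mapping.lookup (orbit_block (\<lambda>\<gamma> g. c * a \<gamma> g) y x) \<mu> =
      poly_mapping.lookup (Poly_Mapping.map ((*) c) (orbit_block a y x)) \<mu>" for \<mu>
    by (simp add: lookup_orbit_block assms lookup_smult_group_algebra)
qed

lemma orbit_block_star:
  assumes "finite {\<gamma>. a \<gamma> \<noteq> 0}"
  shows "orbit_block (cp_star \<alpha> a) y x = star group_algebra (orbit_block a x y)"
proof (rule poly_mapping_eqI)
  have "{\<gamma>. cp_star \<alpha> a \<gamma> \<noteq> 0} \<subseteq> uminus ` {\<gamma>. a \<gamma> \<noteq> 0}"
  proof
    fix \<gamma> assume "\<gamma> \<in> {\<gamma>. cp_star \<alpha> a \<gamma> \<noteq> 0}"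
    then have "- \<gamma> \<in> {\<gamma>. a \<gamma> \<noteq> 0}" by (auto simp: cp_star_def fun_eq_iff)
    then show "\<gamma> \<in> uminus ` {\<gamma>. a \<gamma> \<noteq> 0}" by (metis image_eqI minus_minus)
  qed
  then have fin: "finite {\<gamma>. cp_star \<alpha> a \<gamma> \<noteq> 0}" using assms finite_subset by blast
  fix \<mu>
  have "\<alpha> (- \<mu>) y = x \<longleftrightarrow> \<alpha> \<mu> x = y" using \<alpha>_cancel by metis
  then show "poly_mapping.lookup (orbit_block (cp_star \<alpha> a) y x) \<mu> =
      poly_mapping.lookup (star group_algebra (orbit_block a x y)) \<mu>"
    by (auto simp: lookup_orbit_block[OF fin] lookup_orbit_block[OF assms] lookup_star_group_algebra cp_star_def)
qed

text \<open>Each \<mu> moves x to a single point, so the sum over the intermediate point y collapses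
  to y = \<alpha>_\<mu>(x) and leaves the convolution. \<open>X\<close> must contain the whole orbit
  of x for that point to occur.\<close>

lemma orbit_block_mult:
  assumes a: "finite {\<gamma>. a \<gamma> \<noteq> 0}" and b: "finite {\<gamma>. b \<gamma> \<noteq> 0}"
    and X: "finite X" "\<And>\<mu>. \<alpha> \<mu> x \<in> X"
  shows "orbit_block (cp_mult \<alpha> a b) z x = (\<Sum>y\<in>X. orbit_block a z y * orbit_block b y x)"
proof (rule poly_mapping_eqI)
  let ?T = "{\<gamma>. b \<gamma> \<noteq> 0}"
  have "{\<nu>. cp_mult \<alpha> a b \<nu> \<noteq> 0} \<subseteq> (\<lambda>(\<kappa>, \<mu>). \<kappa> + \<mu>) ` ({\<gamma>. a \<gamma> \<noteq> 0} \<times> ?T)"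
  proof
    fix \<nu> assume "\<nu> \<in> {\<nu>. cp_mult \<alpha> a b \<nu> \<noteq> 0}"
    then obtain g where "cp_mult \<alpha> a b \<nu> g \<noteq> 0" by (auto simp: fun_eq_iff)
    then obtain \<mu> where "b \<mu> \<noteq> 0" "a (\<nu> - \<mu>) (\<alpha> \<mu> g) \<noteq> 0"
      unfolding cp_mult_def by (metis (mono_tags, lifting) mem_Collect_eq mult_zero_left sum.neutral)
    then have "(\<nu> - \<mu>, \<mu>) \<in> {\<gamma>. a \<gamma> \<noteq> 0} \<times> ?T" by auto
    then show "\<nu> \<in> (\<lambda>(\<kappa>, \<mu>). \<kappa> + \<mu>) ` ({\<gamma>. a \<gamma> \<noteq> 0} \<times> ?T)" by (rule rev_image_eqI) simp
  qed
  then have fin: "finite {\<nu>. cp_mult \<alpha> a b \<nu> \<noteq> 0}" using a b finite_subset by blast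
  fix \<nu>
  have "poly_mapping.lookup (\<Sum>y\<in>X. orbit_block a z y * orbit_block b y x) \<nu> =
      (\<Sum>y\<in>X. \<Sum>\<mu>\<in>?T. poly_mapping.lookup (orbit_block a z y) (\<nu> - \<mu>) * poly_mapping.lookup (orbit_block b y x) \<mu>)"
    unfolding lookup_sum
    by (intro sum.cong refl lookup_times_group b) (auto simp: lookup_orbit_block[OF b] split: if_splits)
  also have "\<dots> = (\<Sum>\<mu>\<in>?T. \<Sum>y\<in>X. if \<alpha> \<mu> x = y then (if \<alpha> (\<nu> - \<mu>) y = z then a (\<nu> - \<mu>) y * b \<mu> x else 0) else 0)"
    unfolding lookup_orbit_block[OF a] lookup_orbit_block[OF b]
    by (subst sum.swap) (intro sum.cong refl, auto)
  also have "\<dots> = (\<Sum>\<mu>\<in>?T. if \<alpha> \<nu> x = z then a (\<nu> - \<mu>) (\<alpha> \<mu> x) * b \<mu> x else 0)"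
    using X by (intro sum.cong refl) (simp add: sum.delta' flip: \<alpha>_add)
  also have "\<dots> = poly_mapping.lookup (orbit_block (cp_mult \<alpha> a b) z x) \<nu>"
    by (simp add: lookup_orbit_block[OF fin] cp_mult_def)
  finally show "poly_mapping.lookup (orbit_block (cp_mult \<alpha> a b) z x) \<nu> =
      poly_mapping.lookup (\<Sum>y\<in>X. orbit_block a z y * orbit_block b y x) \<nu>" ..
qed

text \<open>Induce a representation of the group algebra to the crossed product along a finite orbit.\<close>

lemma star_rep_orbit:
  assumes \<pi>: "star_rep (group_algebra :: ('g \<Rightarrow>\<^sub>0 complex) star_algebra) n \<pi>"
    and X: "finite X" "\<And>\<mu> x. x \<in> X \<Longrightarrow> \<alpha> \<mu> x \<in> X" and \<phi>: "bij_betw \<phi> {..<m} X"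
  shows "star_rep (bicrossed_cqg_algebra \<alpha> \<beta>) (m * n) (\<lambda>a. mat (m * n) (m * n)
    (\<lambda>(i, j). \<pi> (orbit_block a (\<phi> (i div n)) (\<phi> (j div n))) $$ (i mod n, j mod n)))"
    (is "star_rep _ _ ?M")
  unfolding star_rep_def bicrossed_cqg_algebra_ops
proof (intro conjI allI ballI)
  note D = star_rep_group_algebraD[OF \<pi>]
  \<comment> \<open>\<open>i < m * n\<close> excludes n = 0, for which \<open>i mod n\<close> would
    be i.\<close>
  have lt: "i div n < m" "i mod n < n" if "i < m * n" for i
    using that by (simp_all add: less_mult_imp_div_less) (metis gr_zeroI mod_less_divisor mult_0_right not_less0)
  have \<phi>X: "\<phi> (i div n) \<in> X" if "i < m * n" for i
    using \<phi> lt(1)[OF that] by (auto dest: bij_betwE)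
  fix a b c assume aC: "a \<in> carrier (bicrossed_cqg_algebra \<alpha> \<beta>)"
  note a = carrier_finite_support[OF aC]
  show M: "?M a \<in> carrier_mat (m * n) (m * n)" by simp
  show "?M (\<lambda>\<gamma> g. c * a \<gamma> g) = c \<cdot>\<^sub>m ?M a"
  proof (rule eq_matI)
    fix i j assume "i < dim_row (c \<cdot>\<^sub>m ?M a)" "j < dim_col (c \<cdot>\<^sub>m ?M a)"
    then have ij: "i < m * n" "j < m * n" by auto
    show "?M (\<lambda>\<gamma> g. c * a \<gamma> g) $$ (i, j) = (c \<cdot>\<^sub>m ?M a) $$ (i, j)"
      using ij lt(2)[OF ij(1)] lt(2)[OF ij(2)] D(1)[of "orbit_block a (\<phi> (i div n)) (\<phi> (j div n))"]
      by (simp add: orbit_block_smult[OF a] D(3))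
  qed auto
  show "?M (cp_star \<alpha> a) = mat_adjoint (?M a)"
  proof (rule eq_matI)
    fix i j assume "i < dim_row (mat_adjoint (?M a))" "j < dim_col (mat_adjoint (?M a))"
    then have ij: "i < m * n" "j < m * n" using mat_adjoint_carrier[OF M] by auto
    show "?M (cp_star \<alpha> a) $$ (i, j) = mat_adjoint (?M a) $$ (i, j)"
      unfolding index_mat_adjoint[OF M ij]
      using ij index_mat_adjoint[OF D(1) lt(2)[OF ij(1)] lt(2)[OF ij(2)]]
      by (simp add: orbit_block_star[OF a] D(5))
  qed (use mat_adjoint_carrier[OF M] in auto)
  assume bC: "b \<in> carrier (bicrossed_cqg_algebra \<alpha> \<beta>)"
  note b = carrier_finite_support[OF bC]
  show "?M (a + b) = ?M a + ?M b"
  proof (rule eq_matI)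
    fix i j assume "i < dim_row (?M a + ?M b)" "j < dim_col (?M a + ?M b)"
    then have ij: "i < m * n" "j < m * n" by auto
    show "?M (a + b) $$ (i, j) = (?M a + ?M b) $$ (i, j)"
      using ij lt(2)[OF ij(1)] lt(2)[OF ij(2)] D(1)[of "orbit_block b (\<phi> (i div n)) (\<phi> (j div n))"]
      by (simp add: orbit_block_add[OF a b] D(2))
  qed auto
  show "?M (cp_mult \<alpha> a b) = ?M a * ?M b"
  proof (rule eq_matI)
    fix i j assume "i < dim_row (?M a * ?M b)" "j < dim_col (?M a * ?M b)"
    then have ij: "i < m * n" "j < m * n" by auto
    let ?i = "\<phi> (i div n)" and ?j = "\<phi> (j div n)" and ?i' = "i mod n" and ?j' = "j mod n"
    have "(?M a * ?M b) $$ (i, j) = (\<Sum>k<m * n. \<pi> (orbit_block a ?i (\<phi> (k div n))) $$ (?i', k mod n) *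
        \<pi> (orbit_block b (\<phi> (k div n)) ?j) $$ (k mod n, ?j'))"
      using ij by (simp add: scalar_prod_def atLeast0LessThan)
    also have "\<dots> = (\<Sum>p<m. \<Sum>q<n. \<pi> (orbit_block a ?i (\<phi> p)) $$ (?i', q) * \<pi> (orbit_block b (\<phi> p) ?j) $$ (q, ?j'))"
      by (rule sum_div_mod)
    also have "\<dots> = (\<Sum>p<m. \<pi> (orbit_block a ?i (\<phi> p) * orbit_block b (\<phi> p) ?j) $$ (?i', ?j'))"
    proof (rule sum.cong[OF refl])
      fix p
      show "(\<Sum>q<n. \<pi> (orbit_block a ?i (\<phi> p)) $$ (?i', q) * \<pi> (orbit_block b (\<phi> p) ?j) $$ (q, ?j')) =
          \<pi> (orbit_block a ?i (\<phi> p) * orbit_block b (\<phi> p) ?j) $$ (?i', ?j')"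
        using D(1)[of "orbit_block a ?i (\<phi> p)"] D(1)[of "orbit_block b (\<phi> p) ?j"] lt(2)[OF ij(1)] lt(2)[OF ij(2)]
        by (simp add: D(4) scalar_prod_def atLeast0LessThan)
    qed
    also have "\<dots> = (\<Sum>y\<in>X. \<pi> (orbit_block a ?i y * orbit_block b y ?j) $$ (?i', ?j'))"
      by (rule sum.reindex_bij_betw[OF \<phi>])
    also have "\<dots> = \<pi> (\<Sum>y\<in>X. orbit_block a ?i y * orbit_block b y ?j) $$ (?i', ?j')"
      by (rule star_rep_sum_index[OF \<pi> lt(2)[OF ij(1)] lt(2)[OF ij(2)], symmetric])
    also have "\<dots> = \<pi> (orbit_block (cp_mult \<alpha> a b) ?i ?j) $$ (?i', ?j')"
      using orbit_block_mult[OF a b X(1) X(2)[OF \<phi>X[OF ij(2)]]] by simp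
    finally show "?M (cp_mult \<alpha> a b) $$ (i, j) = (?M a * ?M b) $$ (i, j)" using ij by simp
  qed auto
qed

text \<open>A non-zero coefficient \<open>a \<gamma>\<close> is non-zero on an open set, hence at
  some x of finite orbit. The block of a at (\<open>\<alpha> \<gamma> x\<close>, x) then has the
  non-zero coefficient \<open>a \<gamma> x\<close> at \<gamma>; a representation of the group
  algebra that detects this block induces one that detects a.\<close>

lemma RFD_if_enough_finite_orbits:
  assumes orbits: "enough_finite_orbits \<alpha>" and RFD: "RFD (group_algebra :: ('g \<Rightarrow>\<^sub>0 complex) star_algebra)"
  shows "RFD (bicrossed_cqg_algebra \<alpha> \<beta>)"
  unfolding RFD_def
proof (intro ballI impI)
  fix a assume aC: "a \<in> carrier (bicrossed_cqg_algebra \<alpha> \<beta>)" and "a \<noteq> \<zero>\<^bsub>bicrossed_cqg_algebra \<alpha> \<beta>\<^esub>"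
  then have "a \<noteq> 0" unfolding bicrossed_cqg_algebra_ops by simp
  then obtain \<gamma> g where ag: "a \<gamma> g \<noteq> 0" by (auto simp: fun_eq_iff)
  have "a \<gamma> \<in> representative_functions"
    using aC by (simp add: carrier_bicrossed_cqg_algebra algebraic_crossed_product_def)
  then have "open {g. a \<gamma> g \<noteq> 0}"
    by (intro open_Collect_neq rep_continuous continuous_on_const)
  moreover have "g \<in> closure finite_orbit_points"
    using orbits unfolding enough_finite_orbits_def by simp
  ultimately have "{g. a \<gamma> g \<noteq> 0} \<inter> finite_orbit_points \<noteq> {}"
    using ag open_Int_closure_eq_empty by blast
  then obtain x where ax: "a \<gamma> x \<noteq> 0" and "finite (range (\<lambda>\<gamma>. \<alpha> \<gamma> x))" by auto
  define X where "X = range (\<lambda>\<gamma>. \<alpha> \<gamma> x)"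
  have X: "finite X" "\<And>\<mu> y. y \<in> X \<Longrightarrow> \<alpha> \<mu> y \<in> X"
    using \<open>finite (range (\<lambda>\<gamma>. \<alpha> \<gamma> x))\<close> unfolding X_def by (auto simp flip: \<alpha>_add)
  have xX: "x \<in> X" unfolding X_def by (rule range_eqI[of _ _ 0]) (simp add: \<alpha>_zero)
  obtain \<phi> where \<phi>: "bij_betw \<phi> {..<card X} X"
    using ex_bij_betw_nat_finite[OF X(1)] by (auto simp: atLeast0LessThan)
  let ?m = "card X" and ?y = "\<alpha> \<gamma> x"
  have "poly_mapping.lookup (orbit_block a ?y x) \<gamma> \<noteq> 0"
    using ax by (simp add: lookup_orbit_block[OF carrier_finite_support[OF aC]])
  then have "orbit_block a ?y x \<noteq> \<zero>\<^bsub>group_algebra\<^esub>" unfolding group_algebra_ops by auto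
  then obtain n \<pi> where \<pi>: "star_rep (group_algebra :: ('g \<Rightarrow>\<^sub>0 complex) star_algebra) n \<pi>"
    "\<pi> (orbit_block a ?y x) \<noteq> 0\<^sub>m n n"
    using RFD unfolding RFD_def group_algebra_ops(1) by blast
  define M where "M a = mat (?m * n) (?m * n)
    (\<lambda>(i, j). \<pi> (orbit_block a (\<phi> (i div n)) (\<phi> (j div n))) $$ (i mod n, j mod n))" for a
  have "star_rep (bicrossed_cqg_algebra \<alpha> \<beta>) (?m * n) M"
    using star_rep_orbit[OF \<pi>(1) X \<phi>] by (simp add: M_def[abs_def])
  moreover have "M a \<noteq> 0\<^sub>m (?m * n) (?m * n)"
  proof
    assume M0: "M a = 0\<^sub>m (?m * n) (?m * n)"
    have "?y \<in> \<phi> ` {..<?m}" "x \<in> \<phi> ` {..<?m}"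
      using \<phi> X(2)[OF xX, of \<gamma>] xX by (simp_all add: bij_betw_def)
    then obtain p q where p: "p < ?m" "\<phi> p = ?y" and q: "q < ?m" "\<phi> q = x"
      by (metis imageE lessThan_iff)
    have "\<pi> (orbit_block a ?y x) = 0\<^sub>m n n"
    proof (rule eq_matI)
      fix i j assume "i < dim_row (0\<^sub>m n n)" "j < dim_col (0\<^sub>m n n)"
      then have ij: "i < n" "j < n" by auto
      have lt: "r * n + k < ?m * n" if "r < ?m" "k < n" for r k
      proof -
        have "r * n + k < Suc r * n" using that(2) by simp
        also have "\<dots> \<le> ?m * n" using that(1) by (intro mult_le_mono1) simp
        finally show ?thesis .
      qed
      have "M a $$ (p * n + i, q * n + j) = 0"
        unfolding M0 using lt[OF p(1) ij(1)] lt[OF q(1) ij(2)] by simp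
      then show "\<pi> (orbit_block a ?y x) $$ (i, j) = 0\<^sub>m n n $$ (i, j)"
        using lt[OF p(1) ij(1)] lt[OF q(1) ij(2)] ij p(2) q(2) by (simp add: M_def)
    qed (use star_rep_group_algebraD(1)[OF \<pi>(1)] in auto)
    then show False using \<pi>(2) by simp
  qed
  ultimately show "\<exists>n \<pi>. star_rep (bicrossed_cqg_algebra \<alpha> \<beta>) n \<pi> \<and> \<pi> a \<noteq> 0\<^sub>m n n"
    by blast
qed

end

theorem theorem4p2:
  fixes \<alpha> :: "'g::group_add \<Rightarrow> 'h::{topological_group_add, t2_space} \<Rightarrow> 'h"
    and \<beta> :: "'h \<Rightarrow> 'g \<Rightarrow> 'g"
  assumes "matched_pair \<alpha> \<beta>"
  shows "RFD (bicrossed_cqg_algebra \<alpha> \<beta>) \<longleftrightarrow>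
         enough_finite_orbits \<alpha> \<and> RFD (group_algebra :: ('g \<Rightarrow>\<^sub>0 complex) star_algebra)"
  using matched_pair.enough_finite_orbits_if_RFD[OF assms] matched_pair.RFD_group_algebra_if_RFD[OF assms]
    matched_pair.RFD_if_enough_finite_orbits[OF assms] by blast

end
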